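(* Let $p$ be a prime and $q=p^h$ with $h\in\mathbb{N}$. Let $f\in\mathbb{Z}_q[x_1,\dots,x_n]$ be a nonzero polynomial, let $m\in\mathbb{N}$, and let $V:=\{X\in T_q^n: f(X)\equiv0\pmod{p^m}\}$. Let $f=\sum_{i=0}^\infty p^if_i$ be the Teichm\"uller expansion of $f$ and let $d\in\mathbb{N}$. If $\deg(f_i)\leq dp^{h\lfloor i/h\rfloor}$ for all $i\in[0,m-1]$, then $$\mathrm{ord}_q(|V|)\geq\left\lceil\frac{n-\frac{p^m-1}{p-1}d}{p^{m-1}d}\right\rceil^*.$$
   Context: $\mathbb{N}$ = positive integers, $[a,b]=\{x\in\mathbb{Z}:a\le x\le b\}$, $\lfloor x\rfloor$ is the floor. $\mathbb{Z}_q$ is the ring of integers of the unramified extension of $\mathbb{Q}_p$ of degree $h$ (residue field $\mathbb{F}_q$). $T_q\subset\mathbb{Z}_q$ is the set of Teichm\"uller representatives of $\mathbb{F}_q$ (i.e. $0$ together with the $(q-1)$-th roots of unity), and $T_q^n$ is called the Teichm\"uller box. A polynomial in $\mathbb{Z}_q[x_1,\dots,x_n]$ is a Teichm\"uller polynomial if all its coefficients lie in $T_q$; every $f$ has a unique Teichm\"uller expansion $f=\sum_{i\ge0}p^if_i$ with each $f_i$ a Teichm\"uller polynomial (obtained by expanding each coefficient as $\sum_i a_ip^i$, $a_i\in T_q$). $\deg$ is total degree. $\mathrm{ord}_q$ is the $q$-adic valuation normalized by $\mathrm{ord}_q(q)=1$. For $t\in\mathbb{R}$, $\lceil t\rceil^*$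 is the least nonnegative integer $\geq t$. *)

theory Defs
  imports
    "HOL-Analysis.Analysis"
    "HOL-Computational_Algebra.Primes"
    "HOL-Algebra.Algebraic_Closure_Type"
    "HOL-Library.Poly_Mapping"
begin

text \<open>
  The unramified extension \<open>K\<close> of \<open>\<rat>\<^sub>p\<close> of degree \<open>h\<close> is rendered axiomatically, as a type
  whose metric comes from an absolute value. The type class \<open>complete_space\<close> makes the
  closure of \<open>\<rat>\<close> in \<open>K\<close> a completion of \<open>\<rat>\<close> for the \<open>p\<close>-adic absolute value.
\<close>

definition absval :: "'a::{zero,metric_space} \<Rightarrow> real" where
  "absval x = dist x 0"

definition Qp :: "'a::{field_char_0,complete_space} set" where
  "Qp = closure \<rat>"

definition Zq :: "'a::{field_char_0,complete_space} set" where
  "Zq = {x. absval x \<le> 1}"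

text \<open>The equivalence classes of congruence modulo the maximal ideal of \<open>Zq\<close>.\<close>

definition residue_field :: "'a::{field_char_0,complete_space} set set" where
  "residue_field = Zq // {(x, y). x \<in> Zq \<and> y \<in> Zq \<and> absval (x - y) < 1}"

text \<open>
  The conditions on \<open>absval\<close> say that the metric is induced by a non-archimedean absolute value,
  normalised by \<open>|p| = 1/p\<close>; for a prime \<open>p\<close> it therefore restricts to the \<open>p\<close>-adic absolute
  value on \<open>\<rat>\<close>. The last two conditions are \<open>[K : \<rat>\<^sub>p] = h\<close> and unramifiedness: the residue
  field has the same degree \<open>h\<close> over \<open>\<bbbF>\<^sub>p\<close>, i.e. it has \<open>p^h\<close> elements.
\<close>

definition unramified_extension ::
  "'a::{field_char_0,complete_space} itself \<Rightarrow> nat \<Rightarrow> nat \<Rightarrow> bool" where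
  "unramified_extension _ p h \<longleftrightarrow>
     (\<forall>x y :: 'a. dist x y = absval (x - y)) \<and>
     (\<forall>x y :: 'a. absval (x * y) = absval x * absval y) \<and>
     (\<forall>x y :: 'a. absval (x + y) \<le> max (absval x) (absval y)) \<and>
     absval (of_nat p :: 'a) = 1 / real p \<and>
     ring.dimension (ring_of_type_algebra :: 'a ring) h Qp UNIV \<and>
     card (residue_field :: 'a set set) = p ^ h"

definition Tq :: "nat \<Rightarrow> 'a::{field_char_0,complete_space} set" where
  "Tq q = insert 0 {x. x ^ (q - 1) = 1}"

text \<open>
  Polynomials in the variables \<open>x\<^sub>0, \<dots>, x\<^sub>n\<^sub>-\<^sub>1\<close>: finitely supported coefficient functions on
  monomials, a monomial being a finitely supported exponent function.
\<close>

type_synonym 'a mpoly = "(nat \<Rightarrow>\<^sub>0 nat) \<Rightarrow>\<^sub>0 'a"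

definition mpolys :: "'a::zero set \<Rightarrow> nat \<Rightarrow> 'a mpoly set" where
  "mpolys A n =
     {f. (\<forall>\<mu>. Poly_Mapping.lookup f \<mu> \<in> A) \<and>
         (\<forall>\<mu> \<in> Poly_Mapping.keys f. Poly_Mapping.keys \<mu> \<subseteq> {..<n})}"

definition eval_mpoly :: "'a::comm_semiring_1 mpoly \<Rightarrow> (nat \<Rightarrow> 'a) \<Rightarrow> 'a" where
  "eval_mpoly f x =
     (\<Sum>\<mu>\<in>Poly_Mapping.keys f.
        Poly_Mapping.lookup f \<mu> * (\<Prod>i\<in>Poly_Mapping.keys \<mu>. x i ^ Poly_Mapping.lookup \<mu> i))"

text \<open>The zero polynomial gets degree \<open>0\<close>; degrees are only ever bounded from above.\<close>

definition total_degree :: "'a::zero mpoly \<Rightarrow> nat" where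
  "total_degree f =
     Max (insert 0 ((\<lambda>\<mu>. \<Sum>i\<in>Poly_Mapping.keys \<mu>. Poly_Mapping.lookup \<mu> i) ` Poly_Mapping.keys f))"

text \<open>The set \<open>mpolys (Tq q) n\<close> is the set of Teichmueller polynomials in \<open>n\<close> variables.\<close>

definition teichmueller_expansion ::
  "nat \<Rightarrow> nat \<Rightarrow> nat \<Rightarrow> 'a::{field_char_0,complete_space} mpoly \<Rightarrow> (nat \<Rightarrow> 'a mpoly) \<Rightarrow> bool" where
  "teichmueller_expansion p q n f F \<longleftrightarrow>
     (\<forall>i. F i \<in> mpolys (Tq q) n) \<and>
     (\<forall>\<mu>. (\<lambda>i. of_nat p ^ i * Poly_Mapping.lookup (F i) \<mu>) sums Poly_Mapping.lookup f \<mu>)"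

definition cong_Zq :: "'a::{field_char_0,complete_space} \<Rightarrow> 'a \<Rightarrow> 'a \<Rightarrow> bool" where
  "cong_Zq a b c \<longleftrightarrow> (\<exists>z\<in>Zq. a - b = c * z)"

text \<open>
  The valuation \<open>ord\<^sub>q\<close> for \<open>q = p^h\<close>, on natural numbers: the \<open>p\<close>-adic valuation rescaled so that
  \<open>ord\<^sub>q q = 1\<close>. Its values lie in \<open>(1/h)\<int>\<close>, not only in \<open>\<int>\<close>.
\<close>

definition ord_q :: "nat \<Rightarrow> nat \<Rightarrow> nat \<Rightarrow> ereal" where
  "ord_q p h x = (if x = 0 then \<infinity> else ereal (real (multiplicity p x) / real h))"

definition ceiling_star :: "real \<Rightarrow> nat" where
  "ceiling_star t = (LEAST k. t \<le> real k)"

end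

theory Submission
  imports Defs "HOL-Computational_Algebra.Polynomial" "HOL-Number_Theory.Cong"
begin

text \<open>
  For \<open>x\<close> in the Teichmueller box the value \<open>f x\<close> is, modulo \<open>p ^ m\<close>, a sum of terms \<open>p ^ i * t\<close> with
  \<open>t\<close> a Teichmueller representative. Its first \<open>m\<close> Teichmueller digits vanish iff \<open>m\<close> polynomials
  \<open>A\<^sub>k\<close>, the Witt coordinates, vanish modulo \<open>p\<close>. Since \<open>t ^ q = t\<close>, the term \<open>t ^ (p ^ k)\<close> in
  the \<open>k\<close>-th ghost component may be replaced by \<open>t ^ (p ^ (k - h * (i div h)))\<close>, so the hypothesis on
  the degrees gives \<open>deg A\<^sub>k \<le> d * p ^ k\<close>, and the claim becomes the Ax--Katz theorem for
  \<open>A\<^sub>0, \<dots>, A\<^sub>m\<^sub>-\<^sub>1\<close>.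

  The Ax--Katz part needs neither characters nor Gauss sums: \<open>1 - A\<^sub>k x ^ ((q - 1) * q ^ N)\<close> approximates
  the indicator of \<open>A\<^sub>k x \<equiv> 0\<close> modulo \<open>p\<close>. Multinomial expansion leaves power sums over the
  Teichmueller representatives, and by Legendre's formula the valuations of the multinomial
  coefficients are given by base-\<open>p\<close> digit sums, exactly as Stickelberger's theorem does for Gauss sums.
\<close>

section \<open>The absolute value\<close>

text \<open>The hypotheses on the field give a degree and a count of residue classes, whereas the
  argument needs \<open>p\<close> to generate the maximal ideal. This is the equality of degree and
  ramification index times residue degree, obtained by lifting a basis of the residue field to a
  basis of the field.

  Carries prevent the digits of \<open>f x\<close> from being read off the coefficients of
  \<open>f\<close>. Witt coordinates organise the carries: the \<open>k\<close>-th one is isobaric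
  of weight \<open>p ^ k\<close> in the ghost components, which is where the degrees
  \<open>d * p ^ k\<close> come from. Their sum \<open>d * (p ^ m - 1) / (p - 1)\<close> and their
  maximum \<open>d * p ^ (m - 1)\<close> are the two constants of the bound.

  The exponent \<open>(q - 1) * q ^ N\<close> has base-\<open>p\<close> digit sum
  \<open>h * (p - 1)\<close> for every \<open>N\<close>. Hence the approximation of the indicator
  can be made as sharp as desired without any change to what Legendre's formula loses.\<close>

locale unramified =
  fixes ty :: "'a::{field_char_0,complete_space} itself" and p h q :: nat
  assumes prime_p: "Factorial_Ring.prime p"
    and h_pos: "h \<ge> 1"
    and q_eq: "q = p ^ h"
    and ext: "unramified_extension ty p h"
begin

lemma dist_absval: "dist x y = absval (x - y)" for x y :: 'a
  using ext by (simp add: unramified_extension_def)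

lemma absval_mult: "absval (x * y) = absval x * absval y" for x y :: 'a
  using ext by (simp add: unramified_extension_def)

lemma absval_add_max: "absval (x + y) \<le> max (absval x) (absval y)" for x y :: 'a
  using ext by (simp add: unramified_extension_def)

lemma absval_p: "absval (of_nat p :: 'a) = 1 / real p"
  using ext by (simp add: unramified_extension_def)

lemma dimension_h: "ring.dimension (ring_of_type_algebra :: 'a ring) h Qp UNIV"
  using ext by (simp add: unramified_extension_def)

lemma card_residue_field: "card (residue_field :: 'a set set) = q"
  using ext by (simp add: unramified_extension_def q_eq)

lemma p_gt_1: "p > 1"
  using prime_p prime_gt_1_nat by blast

lemma p_neq_0 [simp]: "p \<noteq> 0"
  using p_gt_1 by simp

lemma q_gt_1: "q > 1"
  using p_gt_1 h_pos one_less_power[of p h] by (simp add: q_eq)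

lemma absval_nonneg [simp]: "absval x \<ge> 0" for x :: 'a
  by (simp add: absval_def)

lemma absval_0 [simp]: "absval (0::'a) = 0"
  by (simp add: absval_def)

lemma absval_eq_0_iff [simp]: "absval x = 0 \<longleftrightarrow> x = 0" for x :: 'a
  by (simp add: absval_def)

lemma absval_less_0_iff [simp]: "\<not> absval x < 0" for x :: 'a
  by (simp add: not_less)

lemma absval_pos_iff [simp]: "0 < absval x \<longleftrightarrow> x \<noteq> 0" for x :: 'a
  by (simp add: less_le)

lemma absval_1 [simp]: "absval (1::'a) = 1"
  using absval_mult[of 1 1] absval_eq_0_iff[of 1] by simp

lemma absval_minus_1: "absval (-1::'a) = 1"
proof -
  have "absval (-1::'a) * absval (-1::'a) = 1"
    using absval_mult[of "-1" "-1"] by simp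
  then have "absval (-1::'a) ^ 2 = 1" by (simp add: power2_eq_square)
  then show ?thesis
    using absval_nonneg[of "-1"] power2_eq_1_iff[of "absval (-1::'a)"] by linarith
qed

lemma absval_minus [simp]: "absval (- x) = absval x" for x :: 'a
  using absval_mult[of "-1" x] absval_minus_1 by simp

lemma absval_diff_commute: "absval (x - y) = absval (y - x)" for x y :: 'a
  using absval_minus[of "x - y"] by simp

lemma absval_power: "absval (x ^ n) = absval x ^ n" for x :: 'a
  by (induction n) (auto simp: absval_mult)

lemma absval_inverse: "absval (inverse x) = inverse (absval x)" for x :: 'a
proof (cases "x = 0")
  case False
  then have "absval x * absval (inverse x) = 1"
    using absval_mult[of x "inverse x"] by simp
  then show ?thesis
    by (metis inverse_unique)
qed auto

lemma absval_divide: "absval (x / y) = absval x / absval y" for x y :: 'a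
  by (simp add: divide_inverse absval_mult absval_inverse)

lemma absval_prod: "absval (prod f A) = (\<Prod>i\<in>A. absval (f i))" for f :: "_ \<Rightarrow> 'a"
  by (induction A rule: infinite_finite_induct) (auto simp: absval_mult)

lemma absval_add_le: "absval x \<le> c \<Longrightarrow> absval y \<le> c \<Longrightarrow> absval (x + y) \<le> c" for x y :: 'a
  using absval_add_max[of x y] by linarith

lemma absval_diff_le: "absval x \<le> c \<Longrightarrow> absval y \<le> c \<Longrightarrow> absval (x - y) \<le> c" for x y :: 'a
  using absval_add_le[of x c "-y"] by simp

lemma absval_add_less: "absval x < c \<Longrightarrow> absval y < c \<Longrightarrow> absval (x + y) < c" for x y :: 'a
  using absval_add_max[of x y] by linarith

lemma absval_diff_less: "absval x < c \<Longrightarrow> absval y < c \<Longrightarrow> absval (x - y) < c" for x y :: 'a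
  using absval_add_less[of x c "-y"] by simp

lemma absval_diff_trans_le:
  "absval (x - y) \<le> c \<Longrightarrow> absval (y - z) \<le> c \<Longrightarrow> absval (x - z) \<le> c" for x y z :: 'a
  using absval_add_le[of "x - y" c "y - z"] by simp

lemma absval_sum_le:
  "0 \<le> c \<Longrightarrow> (\<And>i. i \<in> A \<Longrightarrow> absval (f i) \<le> c) \<Longrightarrow> absval (sum f A) \<le> c" for f :: "_ \<Rightarrow> 'a"
  by (induction A rule: infinite_finite_induct) (auto intro: absval_add_le)

lemma absval_add_eq: "absval x < absval y \<Longrightarrow> absval (x + y) = absval y" for x y :: 'a
  using absval_add_max[of x y] absval_add_max[of "x + y" "-x"] by auto

lemma absval_eq_of_diff: "absval (x - y) < absval y \<Longrightarrow> absval x = absval y" for x y :: 'a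
  using absval_add_eq[of "x - y" y] by simp

lemma absval_of_nat_le_1: "absval (of_nat n :: 'a) \<le> 1"
  by (induction n) (auto intro: absval_add_le)

lemma absval_of_int_le_1: "absval (of_int n :: 'a) \<le> 1"
  by (cases n rule: int_cases2) (auto simp: absval_of_nat_le_1)

lemma inverse_p_less_1: "1 / real p < 1"
  using p_gt_1 by simp

text \<open>Otherwise a Bezout relation between \<open>n\<close> and \<open>p\<close> would give 1
  an absolute value below 1.\<close>

lemma absval_of_nat_coprime:
  assumes "\<not> p dvd n"
  shows "absval (of_nat n :: 'a) = 1"
proof (rule ccontr)
  assume "absval (of_nat n :: 'a) \<noteq> 1"
  then have less: "absval (of_nat n :: 'a) < 1"
    using absval_of_nat_le_1[of n] by simp
  have "coprime (int n) (int p)"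
    using prime_imp_coprime[OF prime_p assms] by (simp add: coprime_commute)
  then obtain u v where uv: "u * int n + v * int p = 1"
    by (metis bezout_int coprime_imp_gcd_eq_1)
  have "(of_int u :: 'a) * of_nat n + of_int v * of_nat p = of_int (u * int n + v * int p)"
    by simp
  then have eq: "(of_int u :: 'a) * of_nat n + of_int v * of_nat p = 1"
    by (simp add: uv)
  have "absval ((of_int u :: 'a) * of_nat n) < 1"
    using less absval_of_int_le_1[of u]
    by (simp add: absval_mult) (meson absval_nonneg le_less_trans mult_left_le_one_le)
  moreover have "absval ((of_int v :: 'a) * of_nat p) < 1"
    using inverse_p_less_1 absval_of_int_le_1[of v]
    by (simp only: absval_mult absval_p) (meson absval_nonneg le_less_trans mult_left_le_one_le divide_nonneg_nonneg of_nat_0_le_iff zero_le_one)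
  ultimately show False
    using absval_add_less[of "(of_int u :: 'a) * of_nat n" 1 "(of_int v :: 'a) * of_nat p"] eq by simp
qed

lemma absval_of_nat:
  assumes "n > 0"
  shows "absval (of_nat n :: 'a) = (1 / real p) ^ multiplicity p n"
proof -
  obtain k where k: "n = p ^ multiplicity p n * k" "\<not> p dvd k"
    using multiplicity_decompose'[of n p] assms p_gt_1 by auto
  have "absval (of_nat n :: 'a) = absval (of_nat p :: 'a) ^ multiplicity p n * absval (of_nat k :: 'a)"
    by (metis k(1) absval_mult absval_power of_nat_mult of_nat_power)
  then show ?thesis
    using k(2) by (simp add: absval_p absval_of_nat_coprime)
qed

lemma absval_Rats:
  assumes "x \<in> \<rat>" "x \<noteq> (0::'a)"
  obtains z where "absval x = real p powi z"
proof -
  obtain a b where ab: "b > 0" "x = of_int a / of_int b"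
    using assms(1) by (auto elim!: Rats_cases')
  have "a \<noteq> 0" using ab assms by auto
  have i: "absval (of_int c :: 'a) = (1 / real p) ^ multiplicity p (nat \<bar>c\<bar>)" if "c \<noteq> 0" for c
  proof -
    have "absval (of_int c :: 'a) = absval (of_nat (nat \<bar>c\<bar>) :: 'a)"
      by (cases "c \<ge> 0") auto
    then show ?thesis using that absval_of_nat[of "nat \<bar>c\<bar>"] by simp
  qed
  have "absval x = (1 / real p) ^ multiplicity p (nat \<bar>a\<bar>) / (1 / real p) ^ multiplicity p (nat \<bar>b\<bar>)"
    using ab i[OF \<open>a \<noteq> 0\<close>] i[of b] by (simp add: absval_divide)
  also have "\<dots> = real p powi (int (multiplicity p (nat \<bar>b\<bar>)) - int (multiplicity p (nat \<bar>a\<bar>)))"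
    using p_gt_1 by (simp add: power_int_diff power_one_over)
  finally show ?thesis by (rule that)
qed

section \<open>The closure of the rationals as a valued subfield\<close>

lemma Qp_iff: "x \<in> Qp \<longleftrightarrow> (\<forall>e>0. \<exists>r\<in>\<rat>. absval (x - r) < e)" for x :: 'a
  unfolding Qp_def closure_approachable dist_absval using absval_diff_commute by metis

lemma Qp_approx:
  assumes "x \<in> Qp" "(e::real) > 0"
  obtains r :: 'a where "r \<in> \<rat>" "absval (x - r) < e"
  using assms Qp_iff by blast

lemma Rats_subset_Qp: "x \<in> \<rat> \<Longrightarrow> x \<in> Qp" for x :: 'a
  unfolding Qp_iff by force

lemma Qp_minus: "x \<in> Qp \<Longrightarrow> - x \<in> Qp" for x :: 'a
  unfolding Qp_iff
proof (intro allI impI)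
  fix e :: real assume "\<forall>e>0. \<exists>r\<in>\<rat>. absval (x - r) < e" "e > 0"
  then obtain r where "r \<in> \<rat>" "absval (x - r) < e" by blast
  then show "\<exists>r\<in>\<rat>. absval (- x - r) < e"
    using absval_minus[of "x - r"] by (intro bexI[of _ "-r"]) (auto simp: algebra_simps)
qed

lemma Qp_add: "x \<in> Qp \<Longrightarrow> y \<in> Qp \<Longrightarrow> x + y \<in> Qp" for x y :: 'a
  unfolding Qp_iff[of "x + y"]
proof (intro allI impI)
  fix e :: real assume x: "x \<in> Qp" and y: "y \<in> Qp" and e: "e > 0"
  obtain r where r: "r \<in> \<rat>" "absval (x - r) < e" using Qp_approx[OF x e] .
  obtain s where s: "s \<in> \<rat>" "absval (y - s) < e" using Qp_approx[OF y e] .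
  have "absval (x + y - (r + s)) < e"
    using absval_add_less[OF r(2) s(2)] by (simp add: algebra_simps)
  then show "\<exists>r\<in>\<rat>. absval (x + y - r) < e" using Rats_add[OF r(1) s(1)] Rats_mult[OF r(1) s(1)] by blast
qed

lemma Qp_mult: "x \<in> Qp \<Longrightarrow> y \<in> Qp \<Longrightarrow> x * y \<in> Qp" for x y :: 'a
  unfolding Qp_iff[of "x * y"]
proof (intro allI impI)
  fix e :: real assume x: "x \<in> Qp" and y: "y \<in> Qp" and e: "e > 0"
  define c where "c = max 1 (max (absval x) (absval y))"
  \<comment> \<open>The bound \<open>c\<close> keeps the approximation \<open>r\<close> no larger
    than \<open>c\<close>; the bound \<open>e / c\<close> then makes both parts of
    \<open>x * y - r * s = (x - r) * y + r * (y - s)\<close> smaller than \<open>e\<close>.\<close>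
  define e' where "e' = min c (e / c)"
  have c: "c \<ge> 1" "absval x \<le> c" "absval y \<le> c" by (auto simp: c_def)
  have e': "e' > 0" "e' \<le> c" "e' * c \<le> e" using c(1) e by (auto simp: e'_def min_def field_simps)
  obtain r where r: "r \<in> \<rat>" "absval (x - r) < e'" using Qp_approx[OF x e'(1)] .
  obtain s where s: "s \<in> \<rat>" "absval (y - s) < e'" using Qp_approx[OF y e'(1)] .
  have "absval r \<le> c"
    using absval_diff_le[of x c "x - r"] c r e' by simp
  then have "absval (r * (y - s)) < e"
    using e' s(2) c(1) unfolding absval_mult
    by (smt (verit, best) absval_nonneg mult.commute mult_less_cancel_left_pos mult_right_mono)
  moreover have "absval ((x - r) * y) < e"
    using e' r(2) c unfolding absval_mult
    by (smt (verit, best) absval_nonneg mult_less_cancel_right_pos mult_left_mono)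
  ultimately have "absval ((x - r) * y + r * (y - s)) < e"
    by (rule absval_add_less[rotated])
  then have "absval (x * y - r * s) < e"
    by (simp add: algebra_simps)
  then show "\<exists>r\<in>\<rat>. absval (x * y - r) < e" using Rats_add[OF r(1) s(1)] Rats_mult[OF r(1) s(1)] by blast
qed

lemma Qp_inverse: "x \<in> Qp \<Longrightarrow> x \<noteq> 0 \<Longrightarrow> inverse x \<in> Qp" for x :: 'a
  unfolding Qp_iff[of "inverse x"]
proof (intro allI impI)
  fix e :: real assume x: "x \<in> Qp" "x \<noteq> 0" and e: "e > 0"
  \<comment> \<open>Closeness below \<open>absval x\<close> forces \<open>r\<close> to have the
    absolute value of \<open>x\<close>; the factor \<open>absval x ^ 2\<close> compensates the
    denominator of \<open>(r - x) / (x * r)\<close>.\<close>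
  define e' where "e' = min (absval x) (e * absval x ^ 2)"
  have "absval x > 0" using x absval_nonneg[of x] absval_eq_0_iff[of x] by linarith
  then have e': "e' > 0" "e' \<le> absval x" "e' \<le> e * absval x ^ 2"
    using e x(2) by (auto simp: e'_def)
  obtain r where r: "r \<in> \<rat>" "absval (x - r) < e'" using Qp_approx[OF x(1) e'(1)] .
  have ar: "absval r = absval x"
    using absval_eq_of_diff[of r x] r(2) e'(2) absval_diff_commute[of x r] by linarith
  then have "r \<noteq> 0" using x(2) absval_eq_0_iff by metis
  have "inverse x - inverse r = (r - x) / (x * r)"
    using x(2) \<open>r \<noteq> 0\<close> by (simp add: field_simps)
  then have "absval (inverse x - inverse r) = absval (x - r) / absval x ^ 2"
    by (simp add: absval_divide absval_mult ar power2_eq_square absval_diff_commute[of r x])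
  also have "\<dots> < e"
    using r(2) e'(3) x(2) by (simp add: divide_less_eq)
  finally show "\<exists>r\<in>\<rat>. absval (inverse x - r) < e"
    using Rats_inverse[OF r(1)] by blast
qed

text \<open>A rational closer to \<open>x\<close> than \<open>absval x\<close> has the same absolute
  value, so passing to the closure adds no new values.\<close>

lemma absval_Qp:
  assumes "x \<in> Qp" "x \<noteq> (0::'a)"
  obtains z where "absval x = real p powi z"
proof -
  have "absval x > 0" using assms absval_nonneg[of x] absval_eq_0_iff[of x] by linarith
  then obtain r where r: "r \<in> \<rat>" "absval (x - r) < absval x"
    using Qp_approx[OF assms(1)] by blast
  then have ar: "absval r = absval x"
    using absval_eq_of_diff[of r x] absval_diff_commute[of x r] by linarith
  then have "r \<noteq> 0" using assms(2) absval_eq_0_iff by metis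
  then show ?thesis using absval_Rats[OF r(1)] ar that by metis
qed

text \<open>The residue field of \<open>Qp\<close> is the prime field: modulo the maximal ideal
  \<open>x\<close> is a fraction whose denominator is prime to \<open>p\<close> and can be inverted
  modulo \<open>p\<close>.\<close>

lemma Qp_integral_residue:
  assumes "x \<in> Qp" "absval (x::'a) \<le> 1"
  obtains i where "i < p" "absval (x - of_nat i) < 1"
proof -
  obtain r where r: "r \<in> \<rat>" "absval (x - r) < 1"
    using Qp_approx[OF assms(1), of 1] by auto
  have r1: "absval r \<le> 1" using absval_diff_le[of x 1 "x - r"] assms(2) r(2) by simp
  obtain a b where ab: "b > 0" "coprime a b" "r = of_int a / of_int b"
    using r(1) by (auto elim!: Rats_cases')
  \<comment> \<open>In lowest terms a denominator divisible by \<open>p\<close> leaves a numerator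
    that is a unit, so that \<open>r\<close> would not be integral.\<close>
  have nb: "\<not> int p dvd b"
  proof
    assume *: "int p dvd b"
    then obtain b' where b': "b = int p * b'" by auto
    have "absval (of_int b :: 'a) < 1"
      unfolding b' using absval_of_int_le_1[of b'] p_gt_1
      by (simp add: absval_mult absval_p divide_less_eq)
    moreover have "\<not> int p dvd a"
      using ab(2) * prime_p by (meson coprime_common_divisor not_prime_unit prime_nat_int_transfer)
    then have "\<not> p dvd nat \<bar>a\<bar>" by (simp add: nat_dvd_iff int_dvd_int_iff[symmetric])
    then have "absval (of_nat (nat \<bar>a\<bar>) :: 'a) = 1" by (rule absval_of_nat_coprime)
    then have "absval (of_int a :: 'a) = 1"
      by (cases "a \<ge> 0") auto
    ultimately have "absval r > 1"
      using ab(1,3) by (simp add: absval_divide less_divide_eq)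
    then show False using r1 by simp
  qed
  have bunit: "absval (of_int b :: 'a) = 1"
    using absval_of_nat_coprime[of "nat b"] nb ab(1) by (simp add: nat_dvd_iff int_dvd_int_iff[symmetric])
  have "coprime b (int p)"
    using prime_imp_coprime[of "int p" b] nb prime_p by (simp add: coprime_commute)
  then obtain u v where uv: "u * b + v * int p = 1"
    by (metis bezout_int coprime_imp_gcd_eq_1)
  \<comment> \<open>The Bezout coefficient \<open>u\<close> inverts \<open>b\<close> modulo
    \<open>p\<close>, hence \<open>a * u\<close> represents \<open>a / b\<close>.\<close>
  define i where "i = nat ((a * u) mod int p)"
  have ip: "i < p" using p_gt_1 by (simp add: i_def nat_less_iff)
  have ii: "int i = (a * u) mod int p" using p_gt_1 by (simp add: i_def)
  have "int p dvd a - int i * b"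
  proof -
    have "int p dvd a * u - int i" unfolding ii by (simp add: mod_eq_dvd_iff[symmetric])
    then obtain w where w: "a * u - int i = int p * w" ..
    have "a - int i * b = a * (u * b + v * int p) - int i * b" by (simp add: uv)
    also have "\<dots> = (a * u - int i) * b + a * v * int p" by (simp add: algebra_simps)
    also have "\<dots> = int p * (w * b + a * v)" by (simp add: w algebra_simps)
    finally show ?thesis by simp
  qed
  then obtain w where w: "a - int i * b = int p * w" ..
  have "absval (r - of_nat i) = absval (of_int (a - int i * b) :: 'a)"
  proof -
    have "r - of_nat i = of_int (a - int i * b) / of_int b"
      using ab by (simp add: field_simps)
    then show ?thesis by (simp only: absval_divide bunit)
  qed
  also have "\<dots> < 1"
    unfolding w using absval_of_int_le_1[of w] p_gt_1
    by (simp add: absval_mult absval_p divide_less_eq)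
  finally have "absval (x - r + (r - of_nat i)) < 1"
    using absval_add_less[OF r(2)] by blast
  then show ?thesis using that[OF ip] by simp
qed

section \<open>Orthonormal families over the closure of the rationals\<close>

abbreviation comb :: "'a list \<Rightarrow> 'a list \<Rightarrow> 'a" where
  "comb ks us \<equiv> sum_list (map2 (*) ks us)"

lemma combine_eq_comb:
  "length ks = length us \<Longrightarrow> ring.combine (ring_of_type_algebra :: 'a ring) ks us = comb ks us"
proof (induction ks us rule: list_induct2)
  case Nil
  then show ?case
    by (simp add: ring.combine.simps[OF ring_from_type_algebra]) (simp add: ring_of_type_algebra_def)
next
  case (Cons k ks u us)
  then show ?case
    by (simp add: ring.combine.simps[OF ring_from_type_algebra]) (simp add: ring_of_type_algebra_def)
qed

lemma subfield_Qp: "subfield (Qp :: 'a set) (ring_of_type_algebra :: 'a ring)"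
proof -
  interpret R: field "ring_of_type_algebra :: 'a ring" by (rule field_from_type_algebra)
  have carr: "carrier (ring_of_type_algebra :: 'a ring) = UNIV"
    and mu: "x \<otimes>\<^bsub>ring_of_type_algebra\<^esub> y = x * y"
    and ad: "x \<oplus>\<^bsub>ring_of_type_algebra\<^esub> y = x + y"
    and on: "\<one>\<^bsub>ring_of_type_algebra\<^esub> = (1::'a)"
    and ze: "\<zero>\<^bsub>ring_of_type_algebra\<^esub> = (0::'a)" for x y :: 'a
    by (simp_all add: ring_of_type_algebra_def)
  have mi: "\<ominus>\<^bsub>ring_of_type_algebra\<^esub> x = - x" for x :: 'a
    using R.minus_equality[of "-x" x] by (simp add: carr ad ze)
  have iv: "inv\<^bsub>ring_of_type_algebra\<^esub> x = inverse x" if "x \<noteq> 0" for x :: 'a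
    using R.inv_unique'[of x "inverse x"] that by (simp add: carr mu on)
  have "subring (Qp :: 'a set) ring_of_type_algebra"
    by (rule R.subringI) (auto simp: carr mu ad on mi intro: Rats_subset_Qp Qp_add Qp_mult Qp_minus)
  then show ?thesis
    by (rule R.subfieldI') (auto simp: iv ze intro!: Qp_inverse)
qed

text \<open>Equivalently, the residues of \<open>us\<close> are linearly independent over the prime
  field. In this form the condition speaks about absolute values and needs no vector space structure
  on the quotient.\<close>

definition orthonormal :: "'a list \<Rightarrow> bool" where
  "orthonormal us \<longleftrightarrow> set us \<subseteq> Zq \<and>
     (\<forall>ks. length ks = length us \<longrightarrow> set ks \<subseteq> Qp \<inter> Zq \<longrightarrow> (\<exists>k\<in>set ks. absval k = 1) \<longrightarrow>
        absval (comb ks us) = 1)"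

lemma comb_divide: "length ks = length us \<Longrightarrow> comb (map (\<lambda>x. x / k) ks) us = comb ks us / k"
  by (induction ks us rule: list_induct2) (auto simp: field_simps add_divide_distrib)

lemma absval_comb_le_1:
  "length ks = length us \<Longrightarrow> set ks \<subseteq> Zq \<Longrightarrow> set us \<subseteq> Zq \<Longrightarrow> absval (comb ks us) \<le> 1"
  by (induction ks us rule: list_induct2) (auto simp: Zq_def absval_mult intro!: absval_add_le mult_le_one)

text \<open>Dividing by a coefficient of largest absolute value makes all coefficients integral and
  one of them a unit. So the absolute value on the span is the maximum norm of the coordinates and
  takes only values of \<open>Qp\<close>.\<close>

lemma orthonormal_absval:
  assumes "orthonormal us" "length ks = length us" "set ks \<subseteq> Qp" "\<exists>k\<in>set ks. k \<noteq> 0"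
  obtains k where "k \<in> set ks" "k \<noteq> 0" "absval (comb ks us) = absval k"
proof -
  have fin: "finite (absval ` set ks)" "absval ` set ks \<noteq> {}" using assms(4) by auto
  obtain k where k: "k \<in> set ks" "absval k = Max (absval ` set ks)"
    using Max_in[OF fin] by auto
  have le: "absval x \<le> absval k" if "x \<in> set ks" for x
    unfolding k(2) using Max_ge[OF fin(1)] that by blast
  have k0: "k \<noteq> 0"
  proof
    assume "k = 0"
    then have "x = 0" if "x \<in> set ks" for x
      using le[OF that] absval_nonneg[of x] absval_eq_0_iff[of x] by simp
    then show False using assms(4) by blast
  qed
  have "x / k \<in> Qp \<inter> Zq" if x: "x \<in> set ks" for x
  proof
    have "x \<in> Qp" "k \<in> Qp" using x assms(3) k(1) by auto
    then have "x * inverse k \<in> Qp" by (intro Qp_mult Qp_inverse k0)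
    then show "x / k \<in> Qp" by (simp add: divide_inverse)
    show "x / k \<in> Zq" using le[OF x] k0 by (simp add: Zq_def absval_divide divide_le_eq_1)
  qed
  then have *: "set (map (\<lambda>x. x / k) ks) \<subseteq> Qp \<inter> Zq" by auto
  have "k / k \<in> set (map (\<lambda>x. x / k) ks)" using k(1) by simp
  moreover have "absval (k / k) = 1" using k0 by simp
  ultimately have "absval (comb (map (\<lambda>x. x / k) ks) us) = 1"
    using assms(1,2) * unfolding orthonormal_def by (metis length_map)
  then have "absval (comb ks us) = absval k"
    using k0 assms(2) by (simp add: comb_divide absval_divide)
  then show ?thesis using that k k0 by blast
qed

text \<open>A nontrivial combination has the absolute value of a nonzero coefficient. This transfers
  independence of residues to independence over \<open>Qp\<close>, where the dimension
  \<open>h\<close> bounds the length.\<close>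

lemma orthonormal_independent:
  assumes "orthonormal us"
  shows "ring.independent (ring_of_type_algebra :: 'a ring) Qp us"
proof (rule ccontr)
  interpret R: field "ring_of_type_algebra :: 'a ring" by (rule field_from_type_algebra)
  assume "\<not> R.independent Qp us"
  have carr: "set us \<subseteq> carrier (ring_of_type_algebra :: 'a ring)"
    by (simp add: ring_of_type_algebra_def)
  obtain ks where ks: "length ks = length us" "R.combine ks us = \<zero>\<^bsub>ring_of_type_algebra\<^esub>"
    "set ks \<subseteq> Qp" "set ks \<noteq> {\<zero>\<^bsub>ring_of_type_algebra\<^esub>}"
    using R.dependent_imp_non_trivial_combine[OF subfield_Qp carr \<open>\<not> R.independent Qp us\<close>] by blast
  have ze: "\<zero>\<^bsub>ring_of_type_algebra\<^esub> = (0::'a)" by (simp add: ring_of_type_algebra_def)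
  have "us \<noteq> []"
    using \<open>\<not> R.independent Qp us\<close> by auto
  then have "\<exists>k\<in>set ks. k \<noteq> 0"
    using ks(1,4) unfolding ze by (cases ks) auto
  then obtain k where "k \<in> set ks" "k \<noteq> 0" "absval (comb ks us) = absval k"
    by (rule orthonormal_absval[OF assms ks(1,3)])
  then show False using ks(2) by (simp add: combine_eq_comb[OF ks(1)] ze)
qed

lemma orthonormal_length: "orthonormal us \<Longrightarrow> length us \<le> h"
  using ring.independent_length_le_dimension[OF ring_from_type_algebra subfield_Qp dimension_h
      orthonormal_independent] by auto

text \<open>Modulo the maximal ideal integral coefficients matter only through their residues, which
  are represented by the numbers below \<open>p\<close>. This makes the span of \<open>us\<close> in
  the residue field a set of at most \<open>p ^ length us\<close> classes.\<close>

lemma comb_round: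
  assumes "length ks = length us" "set ks \<subseteq> Qp \<inter> Zq" "set us \<subseteq> Zq"
  obtains ls where "length ls = length us" "set ls \<subseteq> {..<p}"
    "absval (comb ks us - comb (map of_nat ls) us) < 1"
proof -
  have "\<exists>ls. length ls = length us \<and> set ls \<subseteq> {..<p} \<and>
    absval (comb ks us - comb (map of_nat ls) us) < 1"
    using assms
  proof (induction ks us rule: list_induct2)
    case Nil
    show ?case by simp
  next
    case (Cons k ks u us)
    then obtain js where js: "length js = length us" "set js \<subseteq> {..<p}"
      "absval (comb ks us - comb (map of_nat js) us) < 1" by auto
    obtain i where i: "i < p" "absval (k - of_nat i) < 1"
      using Qp_integral_residue[of k] Cons.prems by (auto simp: Zq_def)
    have "absval ((k - of_nat i) * u) < 1"
      using i(2) Cons.prems by (simp add: absval_mult Zq_def) (meson absval_nonneg mult_right_le_one_le le_less_trans)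
    from absval_add_less[OF this js(3)]
    have "absval (comb (k # ks) (u # us) - comb (map of_nat (i # js)) (u # us)) < 1"
      by (simp add: algebra_simps)
    then show ?case using i js by (intro exI[of _ "i # js"]) auto
  qed
  then show ?thesis using that by blast
qed

text \<open>In the residue field, \<open>new\<close> says that \<open>x\<close> lies outside the
  span of \<open>us\<close> over the prime field. If the coefficient of \<open>x\<close> is in the
  maximal ideal, the combination is decided by \<open>us\<close> alone; the other case is the usual
  exchange argument.\<close>

lemma orthonormal_extend:
  assumes us: "orthonormal us" and x: "x \<in> Zq"
    and new: "\<And>ls. length ls = length us \<Longrightarrow> set ls \<subseteq> {..<p} \<Longrightarrow>
      \<not> absval (x - comb (map of_nat ls) us) < 1"
  shows "orthonormal (x # us)"
  unfolding orthonormal_def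
proof (intro conjI allI impI)
  show "set (x # us) \<subseteq> Zq" using us x by (auto simp: orthonormal_def)
  fix ks :: "'a list" assume *: "length ks = length (x # us)" "set ks \<subseteq> Qp \<inter> Zq" "\<exists>k\<in>set ks. absval k = 1"
  obtain k ls where ks: "ks = k # ls" using *(1) by (cases ks) auto
  have ls: "length ls = length us" "set ls \<subseteq> Qp \<inter> Zq" and k: "k \<in> Qp" "absval k \<le> 1"
    using * ks by (auto simp: Zq_def)
  have usZ: "set us \<subseteq> Zq" using us by (simp add: orthonormal_def)
  have l1: "absval (comb ls us) \<le> 1" using absval_comb_le_1 ls usZ by blast
  have x1: "absval x \<le> 1" using x by (simp add: Zq_def)
  show "absval (comb ks (x # us)) = 1"
  proof (cases "absval k = 1")
    case False
    then have "absval (k * x) < 1"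
      using k x1 by (simp add: absval_mult) (meson absval_nonneg mult_right_le_one_le le_less_trans le_less)
    moreover have "absval (comb ls us) = 1"
      using *(3) False us ls unfolding ks orthonormal_def by auto
    ultimately show ?thesis
      using absval_add_eq[of "k * x" "comb ls us"] by (simp add: ks)
  next
    case True
    then have k0: "k \<noteq> 0" by auto
    have "absval (k * x + comb ls us) \<le> 1"
      using l1 x1 True by (intro absval_add_le) (auto simp: absval_mult)
    moreover have "\<not> absval (k * x + comb ls us) < 1"
    proof
      \<comment> \<open>A relation modulo the maximal ideal with unit coefficient \<open>k\<close>
        can be solved for \<open>x\<close>; rounding the solution to coefficients below
        \<open>p\<close> contradicts \<open>new\<close>.\<close>
      assume less: "absval (k * x + comb ls us) < 1"
      have eq: "comb (map (\<lambda>y. y / (- k)) ls) us = comb ls us / (- k)"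
        by (rule comb_divide[OF ls(1)])
      have "set (map (\<lambda>y. y / (- k)) ls) \<subseteq> Qp \<inter> Zq"
        using ls(2) k k0 True
        by (auto simp: Zq_def absval_divide divide_inverse absval_mult absval_inverse intro!: Qp_mult Qp_inverse Qp_minus)
      from comb_round[OF _ this usZ] ls(1) obtain js where js: "length js = length us" "set js \<subseteq> {..<p}"
        "absval (comb (map (\<lambda>y. y / (- k)) ls) us - comb (map of_nat js) us) < 1" by auto
      have "x - comb (map (\<lambda>y. y / (- k)) ls) us = (k * x + comb ls us) / k"
        unfolding eq using k0 by (simp add: field_simps)
      then have "absval (x - comb (map (\<lambda>y. y / (- k)) ls) us) < 1"
        using less True by (simp add: absval_divide)
      from absval_add_less[OF this js(3)] have "absval (x - comb (map of_nat js) us) < 1"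
        by simp
      then show False using new js by blast
    qed
    ultimately show ?thesis by (simp add: ks)
  qed
qed

section \<open>The residue field\<close>

definition residue_rel :: "('a \<times> 'a) set" where
  "residue_rel = {(x, y). x \<in> Zq \<and> y \<in> Zq \<and> absval (x - y) < 1}"

lemma residue_field_eq: "residue_field = Zq // residue_rel"
  by (simp add: residue_field_def residue_rel_def)

lemma equiv_residue_rel: "equiv Zq residue_rel"
proof (rule equivI)
  show "refl_on Zq residue_rel" by (auto simp: refl_on_def residue_rel_def)
  show "sym residue_rel"
    by (auto simp: sym_def residue_rel_def absval_diff_commute)
  show "trans residue_rel"
  proof (rule transI)
    fix x y z assume "(x, y) \<in> residue_rel" "(y, z) \<in> residue_rel"
    then show "(x, z) \<in> residue_rel"
      using absval_add_less[of "x - y" 1 "y - z"] by (auto simp: residue_rel_def)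
  qed
qed (auto simp: residue_rel_def)

lemma finite_residue_field: "finite (residue_field :: 'a set set)"
  using card_residue_field q_gt_1 by (metis card.infinite not_one_less_zero)

lemma orthonormal_basis:
  obtains us where "orthonormal us" "length us = h"
proof -
  have ex: "orthonormal []" by (simp add: orthonormal_def)
  \<comment> \<open>Lengths are bounded by \<open>h\<close>, so a longest family exists. Since it
    cannot be extended, its combinations with coefficients below \<open>p\<close> meet every residue
    class.\<close>
  obtain us where us: "orthonormal us" "\<And>vs. orthonormal vs \<Longrightarrow> length vs \<le> length us"
    using ex_has_greatest_nat[of orthonormal "[]" length "Suc h"] ex orthonormal_length
    by (metis le_imp_less_Suc)
  have gen: "\<exists>ls. length ls = length us \<and> set ls \<subseteq> {..<p} \<and> absval (x - comb (map of_nat ls) us) < 1"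
    if "x \<in> Zq" for x
    using orthonormal_extend[OF us(1) that] us(2)[of "x # us"] by auto
  define L where "L = {ls. set ls \<subseteq> {..<p} \<and> length ls = length us}"
  have finL: "finite L" "card L = p ^ length us"
    unfolding L_def using card_lists_length_eq[of "{..<p}" "length us"]
      finite_lists_length_eq[of "{..<p}" "length us"] by auto
  have "residue_field \<subseteq> (\<lambda>ls. residue_rel `` {comb (map of_nat ls) us}) ` L"
  proof
    fix C :: "'a set" assume "C \<in> residue_field"
    then obtain x where x: "x \<in> Zq" "C = residue_rel `` {x}"
      unfolding residue_field_eq by (auto elim: quotientE)
    obtain js where js: "length js = length us" "set js \<subseteq> {..<p}" "absval (x - comb (map of_nat js) us) < 1"
      using gen[OF x(1)] by auto
    have "comb (map of_nat js) us \<in> Zq"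
      using absval_comb_le_1[of "map of_nat js" us] js(1) us(1)
      by (force simp: Zq_def orthonormal_def absval_of_nat_le_1)
    then have "(x, comb (map of_nat js) us) \<in> residue_rel"
      using x(1) js(3) by (simp add: residue_rel_def)
    then have "C = residue_rel `` {comb (map of_nat js) us}"
      using x(2) equiv_class_eq[OF equiv_residue_rel] by auto
    then show "C \<in> (\<lambda>ls. residue_rel `` {comb (map of_nat ls) us}) ` L"
      using js by (auto simp: L_def)
  qed
  \<comment> \<open>There are \<open>p ^ h\<close> classes and only \<open>p ^ length us\<close>
    combinations to represent them.\<close>
  from surj_card_le[OF finL(1) this] have "p ^ h \<le> p ^ length us"
    using card_residue_field q_eq finL(2) by simp
  then have "h \<le> length us"
    by (rule power_le_imp_le_exp[OF p_gt_1])
  then show ?thesis using that us(1) orthonormal_length[OF us(1)] by force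
qed

text \<open>This is where unramifiedness enters: an orthonormal family of \<open>h\<close> elements,
  \<open>h\<close> being both the degree and the residue degree, spans the field, so the value group
  is that of \<open>Qp\<close>.\<close>

lemma absval_values:
  assumes "x \<noteq> (0::'a)"
  obtains z where "absval x = real p powi z"
proof -
  interpret R: field "ring_of_type_algebra :: 'a ring" by (rule field_from_type_algebra)
  obtain us where us: "orthonormal us" "length us = h" by (rule orthonormal_basis)
  have carr: "set us \<subseteq> carrier (ring_of_type_algebra :: 'a ring)"
    by (simp add: ring_of_type_algebra_def)
  have "R.Span Qp us = UNIV"
    using R.independent_length_eq_dimension[OF subfield_Qp dimension_h orthonormal_independent[OF us(1)]] us(2)
    by simp
  then have "x \<in> {R.combine ks us |ks. length ks = length us \<and> set ks \<subseteq> Qp}"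
    using R.Span_eq_combine_set_length_version[OF subfield_Qp carr] by auto
  then obtain ks where ks: "length ks = length us" "set ks \<subseteq> Qp" "x = comb ks us"
    by (auto simp: combine_eq_comb)
  have "\<exists>k\<in>set ks. k \<noteq> 0"
  proof (rule ccontr)
    assume "\<not> ?thesis"
    then have "\<forall>k\<in>set ks. k = 0" by blast
    with ks(1) have "comb ks us = 0"
      by (induction ks us rule: list_induct2) auto
    then show False using assms ks(3) by simp
  qed
  then obtain k where k: "k \<in> set ks" "k \<noteq> 0" "absval x = absval k"
    unfolding ks(3) by (rule orthonormal_absval[OF us(1) ks(1,2)])
  with ks(2) have "k \<in> Qp" by blast
  then show ?thesis using absval_Qp[OF _ k(2)] k(3) that by metis
qed

text \<open>There is no power of \<open>p\<close> strictly between \<open>1 / p\<close> and 1, so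
  the maximal ideal is generated by \<open>p\<close>; every congruence modulo the maximal ideal
  becomes one modulo \<open>p\<close>.\<close>

lemma absval_less_1:
  assumes "absval x < (1::real)"
  shows "absval (x::'a) \<le> 1 / real p"
proof (cases "x = 0")
  case False
  then obtain z where z: "absval x = real p powi z" by (rule absval_values)
  have "z \<le> -1"
  proof (rule ccontr)
    assume "\<not> z \<le> -1"
    then have "z \<ge> 0" by simp
    then have "real p powi z \<ge> 1"
      using p_gt_1 by (simp add: one_le_power_int)
    then show False using assms z by simp
  qed
  then have "real p powi z \<le> real p powi (-1)"
    using p_gt_1 by (intro power_int_increasing) auto
  then show ?thesis using z by (simp add: power_int_minus inverse_eq_divide)
qed (simp)

section \<open>Fermat's theorem and congruences between powers\<close>

lemma absval_prod_diff_le: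
  assumes "finite A" "c \<ge> 0" "\<And>i. i \<in> A \<Longrightarrow> absval (f i) \<le> 1" "\<And>i. i \<in> A \<Longrightarrow> absval (g i) \<le> 1"
    and "\<And>i. i \<in> A \<Longrightarrow> absval (f i - g i) \<le> c"
  shows "absval (prod f A - prod g A :: 'a) \<le> c"
  using assms
proof (induction A rule: finite_induct)
  case (insert i A)
  have IH: "absval (prod f A - prod g A) \<le> c" using insert by simp
  have g1: "absval (prod g A) \<le> 1"
    unfolding absval_prod using insert.prems by (intro prod_le_1) auto
  have "absval (f i * (prod f A - prod g A)) \<le> 1 * c"
    using IH insert.prems unfolding absval_mult by (intro mult_mono) auto
  moreover have "absval ((f i - g i) * prod g A) \<le> c * 1"
    using g1 insert.prems unfolding absval_mult by (intro mult_mono) auto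
  ultimately have "absval (f i * (prod f A - prod g A) + (f i - g i) * prod g A) \<le> c"
    by (intro absval_add_le) auto
  then show ?case using insert.hyps by (simp add: algebra_simps)
qed simp

lemma residue_class_eq_iff:
  assumes "x \<in> Zq" "y \<in> Zq"
  shows "residue_rel `` {x} = residue_rel `` {y} \<longleftrightarrow> absval (x - y) < 1"
  using eq_equiv_class_iff[OF equiv_residue_rel assms] assms by (simp add: residue_rel_def)

lemma residue_classI: "x \<in> Zq \<Longrightarrow> residue_rel `` {x} \<in> residue_field"
  by (simp add: residue_field_eq quotientI)

text \<open>Multiplication by \<open>x\<close> permutes the \<open>q - 1\<close> nonzero residue classes.\<close>

lemma absval_power_q_minus_1:
  fixes x :: 'a
  assumes x: "absval x = (1::real)"
  shows "absval (x ^ (q - 1) - 1) < (1::real)"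
proof -
  let ?c = "\<lambda>y. residue_rel `` {y}"
  define C where "C = residue_field - {?c 0}"
  define r where "r = (\<lambda>c. SOME y. y \<in> Zq \<and> ?c y = c)"
  define \<phi> where "\<phi> = (\<lambda>c. ?c (x * r c))"
  have finC: "finite C" by (simp add: C_def finite_residue_field)
  have zero: "(0::'a) \<in> Zq" by (simp add: Zq_def)
  have cardC: "card C = q - 1"
    using card_Diff_singleton[OF residue_classI[OF zero]] card_residue_field by (simp add: C_def)
  have r: "r c \<in> Zq" "?c (r c) = c" if "c \<in> residue_field" for c
  proof -
    have "\<exists>y. y \<in> Zq \<and> ?c y = c" using that by (auto simp: residue_field_eq elim: quotientE)
    from someI_ex[OF this] show "r c \<in> Zq" "?c (r c) = c" by (auto simp: r_def)
  qed
  have r1: "absval (r c) = 1" if "c \<in> C" for c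
  proof -
    have "c \<in> residue_field" "?c (r c) \<noteq> ?c 0" using that r by (auto simp: C_def)
    then have "\<not> absval (r c) < 1" "absval (r c) \<le> 1"
      using residue_class_eq_iff[OF r(1) zero, of c] r(1)[of c] by (auto simp: Zq_def)
    then show ?thesis by simp
  qed
  have xr: "x * r c \<in> Zq" "absval (x * r c) = 1" if "c \<in> C" for c
    using r1[OF that] x by (auto simp: Zq_def absval_mult)
  have \<phi>C: "\<phi> c \<in> C" if "c \<in> C" for c
    using residue_classI[OF xr(1)[OF that]] residue_class_eq_iff[OF xr(1)[OF that] zero] xr(2)[OF that]
    by (auto simp: C_def \<phi>_def)
  have inj: "inj_on \<phi> C"
  proof (rule inj_onI)
    fix c d assume cd: "c \<in> C" "d \<in> C" "\<phi> c = \<phi> d"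
    then have "absval (x * r c - x * r d) < 1"
      using residue_class_eq_iff xr unfolding \<phi>_def by blast
    then have "absval (r c - r d) < 1"
      using x by (simp add: right_diff_distrib[symmetric] absval_mult)
    then show "c = d"
      using residue_class_eq_iff[of "r c" "r d"] r cd by (auto simp: C_def)
  qed
  have bij: "bij_betw \<phi> C C"
    using inj endo_inj_surj[OF finC _ inj] \<phi>C by (auto simp: bij_betw_def)
  \<comment> \<open>Multiplication by \<open>x\<close> permutes the classes, so both products run
    over representatives of the same classes up to multiples of \<open>p\<close>. The product of the
    representatives is a unit and can be cancelled from the result.\<close>
  have "absval ((\<Prod>c\<in>C. x * r c) - (\<Prod>c\<in>C. r (\<phi> c))) \<le> 1 / real p"
  proof (rule absval_prod_diff_le[OF finC])
    show "1 / real p \<ge> 0" by simp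
    fix c assume c: "c \<in> C"
    show "absval (x * r c) \<le> 1" using xr[OF c] by simp
    show "absval (r (\<phi> c)) \<le> 1" using r1[OF \<phi>C[OF c]] by simp
    have "?c (x * r c) = ?c (r (\<phi> c))"
      using r(2)[of "\<phi> c"] \<phi>C[OF c] by (simp add: C_def \<phi>_def)
    then have "absval (x * r c - r (\<phi> c)) < 1"
      using residue_class_eq_iff[OF xr(1)[OF c] r(1)[of "\<phi> c"]] \<phi>C[OF c] by (simp add: C_def)
    then show "absval (x * r c - r (\<phi> c)) \<le> 1 / real p" by (rule absval_less_1)
  qed
  also have "(\<Prod>c\<in>C. r (\<phi> c)) = prod r C"
    by (rule prod.reindex_bij_betw[OF bij])
  also have "(\<Prod>c\<in>C. x * r c) = x ^ (q - 1) * prod r C"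
    by (simp add: prod.distrib cardC)
  finally have "absval ((x ^ (q - 1) - 1) * prod r C) < 1"
    using inverse_p_less_1 by (simp add: algebra_simps)
  moreover have "absval (prod r C) = 1"
    unfolding absval_prod using r1 by simp
  ultimately show ?thesis by (simp add: absval_mult)
qed

lemma absval_power_q:
  fixes x :: 'a
  assumes "absval x \<le> (1::real)"
  shows "absval (x ^ q - x) \<le> 1 / real p"
proof (cases "absval x = 1")
  case True
  have "x ^ q - x = x * (x ^ (q - 1) - 1)"
    using q_gt_1 by (simp add: right_diff_distrib power_eq_if)
  then show ?thesis
    using absval_less_1[OF absval_power_q_minus_1[OF True]] True by (simp add: absval_mult)
next
  case False
  then have *: "absval x \<le> 1 / real p" using absval_less_1 assms by simp
  have "absval (x ^ q) \<le> absval x"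
    unfolding absval_power using q_gt_1 assms power_decreasing[of 1 q "absval x"] by simp
  then show ?thesis using * by (intro absval_diff_le) auto
qed

lemma absval_power_diff_le:
  fixes x y :: 'a
  assumes "absval x \<le> 1" "absval y \<le> (1::real)"
  shows "absval (x ^ n - y ^ n) \<le> absval (x - y)"
proof -
  have "absval (\<Sum>i<n. y ^ (n - Suc i) * x ^ i) \<le> 1"
    using assms by (intro absval_sum_le) (auto simp: absval_mult absval_power power_le_one mult_le_one)
  then have "absval (x - y) * absval (\<Sum>i<n. y ^ (n - Suc i) * x ^ i) \<le> absval (x - y)"
    by (simp add: mult_right_le_one_le)
  then show ?thesis by (simp only: power_diff_sumr2 absval_mult)
qed

text \<open>Modulo \<open>x - y\<close>, which is divisible by \<open>p\<close>, the cofactor of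
  \<open>x - y\<close> in \<open>x ^ p - y ^ p\<close> is \<open>p * y ^ (p - 1)\<close>; hence the
  cofactor supplies one further factor \<open>p\<close>.\<close>

lemma absval_power_p_diff_le:
  fixes x y :: 'a
  assumes "absval x \<le> 1" "absval y \<le> (1::real)" "absval (x - y) \<le> (1 / real p) ^ Suc j"
  shows "absval (x ^ p - y ^ p) \<le> (1 / real p) ^ Suc (Suc j)"
proof -
  have le: "absval (x - y) \<le> 1 / real p"
  proof -
    have "(1 / real p) ^ Suc j \<le> (1 / real p) ^ 1"
      using inverse_p_less_1 by (intro power_decreasing) auto
    then show ?thesis using assms(3) by simp
  qed
  have eq: "(\<Sum>i<p. y ^ (p - Suc i) * x ^ i) =
      (\<Sum>i<p. y ^ (p - Suc i) * (x ^ i - y ^ i)) + of_nat p * y ^ (p - 1)"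
  proof -
    have "y ^ (p - Suc i) * x ^ i = y ^ (p - Suc i) * (x ^ i - y ^ i) + y ^ (p - 1)" if "i < p" for i
    proof -
      have "y ^ (p - Suc i) * y ^ i = y ^ (p - 1)"
        using that by (simp flip: power_add)
      then show ?thesis by (simp add: algebra_simps)
    qed
    then show ?thesis by (simp add: sum.distrib)
  qed
  have "absval (\<Sum>i<p. y ^ (p - Suc i) * x ^ i) \<le> 1 / real p"
    unfolding eq
  proof (intro absval_add_le absval_sum_le)
    fix i
    have "absval (y ^ (p - Suc i)) * absval (x ^ i - y ^ i) \<le> 1 * (1 / real p)"
      using le absval_power_diff_le[OF assms(1,2), of i] assms(2)
      by (intro mult_mono) (auto simp: absval_power power_le_one)
    then show "absval (y ^ (p - Suc i) * (x ^ i - y ^ i)) \<le> 1 / real p" by (simp add: absval_mult)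
    have "1 / real p * absval y ^ (p - 1) \<le> 1 / real p * 1"
      using assms(2) by (intro mult_left_mono) (auto simp: power_le_one)
    then show "absval (of_nat p * y ^ (p - 1)) \<le> 1 / real p"
      by (simp add: absval_mult absval_p absval_power)
  qed simp
  then have "absval (x - y) * absval (\<Sum>i<p. y ^ (p - Suc i) * x ^ i) \<le> (1 / real p) ^ Suc j * (1 / real p)"
    by (intro mult_mono assms(3)) auto
  then show ?thesis by (simp only: power_diff_sumr2 absval_mult power_Suc mult_ac)
qed

lemma absval_power_p_power_diff_le:
  fixes x y :: 'a
  assumes "absval x \<le> 1" "absval y \<le> (1::real)" "absval (x - y) \<le> (1 / real p) ^ Suc j"
  shows "absval (x ^ (p ^ r) - y ^ (p ^ r)) \<le> (1 / real p) ^ Suc (j + r)"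
proof (induction r)
  case (Suc r)
  have "absval ((x ^ (p ^ r)) ^ p - (y ^ (p ^ r)) ^ p) \<le> (1 / real p) ^ Suc (Suc (j + r))"
    using assms(1,2) Suc by (intro absval_power_p_diff_le) (auto simp: absval_power power_le_one)
  then show ?case by (simp add: power_mult[symmetric] mult.commute)
qed (use assms in simp)

lemma absval_le_all_powers:
  assumes "\<And>n. absval x \<le> (1 / real p) ^ n"
  shows "x = (0::'a)"
proof -
  have "(\<lambda>n. (1 / real p) ^ n) \<longlonglongrightarrow> 0"
    using inverse_p_less_1 by (intro LIMSEQ_realpow_zero) auto
  then have "absval x \<le> 0"
    using assms by (intro tendsto_lowerbound[of _ _ sequentially "absval x"]) auto
  then show ?thesis using absval_nonneg[of x] absval_eq_0_iff[of x] by simp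
qed

section \<open>Teichmueller representatives\<close>

lemma Tq_power_q: "t \<in> Tq q \<Longrightarrow> t ^ q = t" for t :: 'a
  using q_gt_1 power_minus_mult[of q t] by (auto simp: Tq_def)

lemma Tq_iff: "t \<in> Tq q \<longleftrightarrow> t ^ q = t" for t :: 'a
proof
  assume "t ^ q = t"
  then have "t * t ^ (q - 1) = t * 1" using q_gt_1 by (simp add: power_eq_if)
  then show "t \<in> Tq q" by (auto simp: Tq_def)
qed (rule Tq_power_q)

lemma Tq_0 [simp]: "(0::'a) \<in> Tq q"
  by (simp add: Tq_def)

lemma Tq_1 [simp]: "(1::'a) \<in> Tq q"
  by (simp add: Tq_iff)

lemma Tq_mult: "s \<in> Tq q \<Longrightarrow> t \<in> Tq q \<Longrightarrow> s * t \<in> Tq q" for s t :: 'a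
  by (simp add: Tq_iff power_mult_distrib)

lemma Tq_power: "t \<in> Tq q \<Longrightarrow> t ^ n \<in> Tq q" for t :: 'a
  by (induction n) (auto intro: Tq_mult)

lemma Tq_prod: "(\<And>i. i \<in> A \<Longrightarrow> f i \<in> Tq q) \<Longrightarrow> prod f A \<in> Tq q" for f :: "'i \<Rightarrow> 'a"
  by (induction A rule: infinite_finite_induct) (auto intro: Tq_mult)

lemma Tq_absval: "t \<in> Tq q \<Longrightarrow> t \<noteq> 0 \<Longrightarrow> absval t = (1::real)" for t :: 'a
proof -
  assume "t \<in> Tq q" "t \<noteq> 0"
  then have "absval t ^ (q - 1) = 1"
    by (auto simp: Tq_def simp flip: absval_power)
  then show "absval t = 1"
    using power_eq_iff_eq_base[of "q - 1" "absval t" 1] q_gt_1 by simp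
qed

lemma Tq_absval_le_1: "t \<in> Tq q \<Longrightarrow> absval t \<le> (1::real)" for t :: 'a
  using Tq_absval[of t] by (cases "t = 0") auto

text \<open>The representative is the limit of \<open>x ^ (q ^ n)\<close>, which exists because the
  field is complete. Its limit is fixed by the \<open>q\<close>-th power and keeps the residue class
  of \<open>x\<close>.\<close>

lemma Teichmueller_ex:
  assumes "absval x \<le> (1::real)"
  obtains t :: 'a where "t \<in> Tq q" "absval (x - t) < 1"
proof -
  define s where "s n = x ^ (q ^ n)" for n
  have s1: "absval (s n) \<le> 1" for n
    using assms by (simp add: s_def absval_power power_le_one)
  have sq: "s (Suc n) = s n ^ q" for n
    by (simp add: s_def power_mult[symmetric] mult.commute)
  \<comment> \<open>Fermat's congruence starts the induction; a \<open>q\<close>-th power then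
    improves a congruence by \<open>h\<close> factors \<open>p\<close>, of which one is
    used.\<close>
  have step: "absval (s (Suc n) - s n) \<le> (1 / real p) ^ Suc n" for n
  proof (induction n)
    case 0
    show ?case using absval_power_q[OF assms] by (simp add: s_def)
  next
    case (Suc n)
    have "absval (s (Suc n) ^ q - s n ^ q) \<le> (1 / real p) ^ Suc (n + h)"
      unfolding q_eq by (rule absval_power_p_power_diff_le[OF s1 s1 Suc])
    also have "\<dots> \<le> (1 / real p) ^ Suc (Suc n)"
      using h_pos inverse_p_less_1 by (intro power_decreasing) auto
    finally show ?case by (simp only: sq)
  qed
  have far: "absval (s (n + k) - s n) \<le> (1 / real p) ^ Suc n" for n k
  proof (induction k)
    case (Suc k)
    have "absval (s (Suc (n + k)) - s (n + k)) \<le> (1 / real p) ^ Suc n"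
      using step[of "n + k"] inverse_p_less_1
      by (elim order_trans, intro power_decreasing) auto
    from absval_diff_trans_le[OF this Suc] show ?case by simp
  qed simp
  have "Cauchy s"
    unfolding Cauchy_altdef2
  proof (intro allI impI)
    fix e :: real assume "e > 0"
    then obtain N where N: "(1 / real p) ^ N < e"
      using real_arch_pow_inv[of e "1 / real p"] inverse_p_less_1 by auto
    have "dist (s n) (s N) < e" if "n \<ge> N" for n
    proof -
      have "absval (s n - s N) \<le> (1 / real p) ^ Suc N"
        using far[of N "n - N"] that by simp
      also have "\<dots> \<le> (1 / real p) ^ N" 
        using inverse_p_less_1 by (intro power_decreasing) auto
      finally show ?thesis using N by (simp add: dist_absval)
    qed
    then show "\<exists>N. \<forall>n\<ge>N. dist (s n) (s N) < e" by blast
  qed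
  then obtain t where t: "s \<longlonglongrightarrow> t"
    using Cauchy_convergent convergent_def by blast
  have near: "absval (t - s n) \<le> (1 / real p) ^ Suc n" for n
  proof -
    have "(1 / real p) ^ Suc n > 0" using p_gt_1 by simp
    then obtain M where M: "\<And>k. k \<ge> M \<Longrightarrow> dist (s k) t < (1 / real p) ^ Suc n"
      using t unfolding lim_sequentially by blast
    have "absval (t - s (n + M)) \<le> (1 / real p) ^ Suc n"
      using M[of "n + M"] by (simp add: dist_absval absval_diff_commute)
    from absval_diff_trans_le[OF this far] show ?thesis .
  qed
  have t1: "absval t \<le> 1"
  proof -
    have "absval (t - s 0) \<le> 1" using near[of 0] inverse_p_less_1 by simp
    from absval_add_le[OF this s1[of 0]] show ?thesis by simp
  qed
  have "absval (t ^ q - t) \<le> (1 / real p) ^ n" for n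
  proof -
    have "absval (t ^ q - s (Suc n)) \<le> (1 / real p) ^ Suc n"
      unfolding sq using absval_power_diff_le[OF t1 s1[of n], of q] near[of n] by linarith
    moreover have "absval (s (Suc n) - t) \<le> (1 / real p) ^ Suc n"
      using near[of "Suc n"] absval_diff_commute[of t "s (Suc n)"] inverse_p_less_1
        power_decreasing[of "Suc n" "Suc (Suc n)" "1 / real p"] by simp
    ultimately have "absval (t ^ q - t) \<le> (1 / real p) ^ Suc n"
      by (rule absval_diff_trans_le)
    also have "\<dots> \<le> (1 / real p) ^ n"
      using inverse_p_less_1 by (intro power_decreasing) auto
    finally show ?thesis .
  qed
  then have "t ^ q - t = 0" by (rule absval_le_all_powers)
  then have "t \<in> Tq q" by (simp add: Tq_iff)
  moreover have "absval (x - t) < 1"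
    using near[of 0] absval_diff_commute[of t x] inverse_p_less_1 by (simp add: s_def)
  ultimately show ?thesis by (rule that)
qed

section \<open>Number and power sums of Teichmueller representatives\<close>

lemma card_power_eq_self_le:
  assumes "n > 1"
  shows "finite {x :: 'a. x ^ n = x}" "card {x :: 'a. x ^ n = x} \<le> n"
proof -
  define P :: "'a poly" where "P = Polynomial.monom 1 n - Polynomial.monom 1 1"
  have deg: "Polynomial.degree P \<le> n"
    unfolding P_def using assms by (intro degree_diff_le) (auto simp: degree_monom_eq)
  have "poly.coeff P n = 1" using assms by (simp add: P_def)
  then have P0: "P \<noteq> 0" by auto
  have eq: "{x. x ^ n = x} = {x. poly P x = 0}"
    by (simp add: P_def poly_monom)
  show "finite {x :: 'a. x ^ n = x}" unfolding eq using P0 by (rule poly_roots_finite)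
  show "card {x :: 'a. x ^ n = x} \<le> n"
    unfolding eq using card_poly_roots_bound[OF P0] deg by linarith
qed

lemma Tq_eq_Collect: "(Tq q :: 'a set) = {x. x ^ q = x}"
  using Tq_iff by blast

lemma finite_Tq: "finite (Tq q :: 'a set)"
  unfolding Tq_eq_Collect by (rule card_power_eq_self_le[OF q_gt_1])

lemma card_Tq_le: "card (Tq q :: 'a set) \<le> q"
  unfolding Tq_eq_Collect by (rule card_power_eq_self_le[OF q_gt_1])

lemma Tq_residue_surj: "(\<lambda>t. residue_rel `` {t}) ` (Tq q) = (residue_field :: 'a set set)"
proof (intro equalityI subsetI)
  fix c :: "'a set" assume "c \<in> residue_field"
  then obtain x where x: "x \<in> Zq" "c = residue_rel `` {x}"
    unfolding residue_field_eq by (auto elim: quotientE)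
  obtain t where t: "t \<in> Tq q" "absval (x - t) < 1"
    using Teichmueller_ex[of x] x(1) by (auto simp: Zq_def)
  then show "c \<in> (\<lambda>t. residue_rel `` {t}) ` (Tq q)"
    using x residue_class_eq_iff[OF x(1), of t] Tq_absval_le_1[of t] by (auto simp: Zq_def)
qed (auto intro!: residue_classI simp: Zq_def Tq_absval_le_1)

text \<open>As roots of \<open>X ^ q - X\<close> there are at most \<open>q\<close> of them, and as
  representatives of all \<open>q\<close> residue classes at least \<open>q\<close>.\<close>

lemma card_Tq: "card (Tq q :: 'a set) = q"
  using card_image_le[OF finite_Tq, of "\<lambda>t. residue_rel `` {t}"] card_Tq_le
  by (simp add: Tq_residue_surj card_residue_field)

text \<open>The case \<open>e = 0\<close> gives \<open>q\<close> instead of \<open>q - 1\<close>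
  because \<open>0 ^ 0 = 1\<close>; this is the source of a factor \<open>q\<close> for every
  variable missing from a monomial. If \<open>q - 1\<close> does not divide \<open>e\<close>, a
  shift by a suitable \<open>s\<close> multiplies the sum by
  \<open>s ^ e \<noteq> 1\<close>.\<close>

lemma sum_Tq_power:
  "(\<Sum>t\<in>Tq q. t ^ e) = (if e = 0 then of_nat q else if (q - 1) dvd e then of_nat (q - 1) else (0::'a))"
proof -
  define S where "S = Tq q - {0::'a}"
  have finS: "finite S" using finite_Tq by (simp add: S_def)
  have cardS: "card S = q - 1" using card_Tq by (simp add: S_def)
  have Tq_eq: "Tq q = insert (0::'a) S" by (auto simp: S_def)
  have S1: "s ^ (q - 1) = 1" if "s \<in> S" for s using that by (auto simp: S_def Tq_def)
  have eq: "(\<Sum>t\<in>Tq q. t ^ e) = 0 ^ e + (\<Sum>t\<in>S. t ^ e)"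
    unfolding Tq_eq using finS by (subst sum.insert) (auto simp: S_def)
  consider "e = 0" | "e > 0" "(q - 1) dvd e" | "e > 0" "\<not> (q - 1) dvd e" by blast
  then show ?thesis
  proof cases
    case 1
    then show ?thesis by (simp add: card_Tq)
  next
    case 2
    then obtain k where "e = (q - 1) * k" by auto
    then have "(\<Sum>t\<in>S. t ^ e) = (\<Sum>t\<in>S. 1)"
      by (intro sum.cong) (simp_all only: power_mult S1 power_one)
    then show ?thesis using 2 by (simp add: eq cardS)
  next
    case 3
    define e' where "e' = e mod (q - 1)"
    have e': "e' > 0" "e' < q - 1" using 3 q_gt_1 by (auto simp: e'_def dvd_eq_mod_eq_0)
    have pe: "s ^ e = s ^ e'" if "s \<in> S" for s
    proof -
      have "s ^ e = s ^ ((q - 1) * (e div (q - 1)) + e')" by (simp add: e'_def)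
      then show ?thesis by (simp only: power_add power_mult S1[OF that] power_one mult_1)
    qed
    \<comment> \<open>Otherwise all \<open>q\<close> representatives would be roots of
      \<open>X ^ (e' + 1) - X\<close>, whose degree is below \<open>q\<close>.\<close>
    have "\<exists>s\<in>S. s ^ e' \<noteq> 1"
    proof (rule ccontr)
      assume "\<not> ?thesis"
      then have "s ^ Suc e' = s" if "s \<in> Tq q" for s :: 'a using that by (cases "s = 0") (auto simp: S_def)
      then have "Tq q \<subseteq> {x::'a. x ^ Suc e' = x}" by blast
      then have "card (Tq q :: 'a set) \<le> Suc e'"
        using card_power_eq_self_le[of "Suc e'"] e' card_mono le_trans by (metis Suc_less_eq One_nat_def)
      then show False using card_Tq e' by simp
    qed
    then obtain s where s: "s \<in> S" "s ^ e' \<noteq> 1" by blast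
    have bij: "bij_betw ((*) s) S S"
    proof -
      have "inj_on ((*) s) S" using s(1) by (auto simp: inj_on_def S_def)
      moreover have "(*) s ` S \<subseteq> S" using s(1) by (auto simp: S_def intro: Tq_mult)
      ultimately show ?thesis using endo_inj_surj[OF finS] by (simp add: bij_betw_def)
    qed
    have "(\<Sum>t\<in>S. t ^ e) = (\<Sum>t\<in>S. (s * t) ^ e)"
      by (rule sum.reindex_bij_betw[OF bij, symmetric])
    also have "\<dots> = s ^ e * (\<Sum>t\<in>S. t ^ e)"
      by (simp add: power_mult_distrib sum_distrib_left)
    finally have "(1 - s ^ e) * (\<Sum>t\<in>S. t ^ e) = 0" by (simp add: algebra_simps)
    then have "(\<Sum>t\<in>S. t ^ e) = 0" using s pe[OF s(1)] by auto
    then show ?thesis using 3 by (simp add: eq)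
  qed
qed

end

section \<open>Digit sums\<close>

fun digit_sum :: "nat \<Rightarrow> nat \<Rightarrow> nat" where
  "digit_sum p n = (if n = 0 \<or> p \<le> 1 then 0 else n mod p + digit_sum p (n div p))"

text \<open>
  The base-\<open>p\<close> digits of \<open>n\<close> are moved up by \<open>j\<close> places and wrapped around with period \<open>h\<close>; the
  result represents \<open>p ^ j * n\<close> modulo \<open>p ^ h - 1\<close>.
\<close>

fun rotated_digits :: "nat \<Rightarrow> nat \<Rightarrow> nat \<Rightarrow> nat \<Rightarrow> nat" where
  "rotated_digits p h j n =
     (if n = 0 \<or> p \<le> 1 then 0 else (n mod p) * p ^ (j mod h) + rotated_digits p h (Suc j) (n div p))"

declare digit_sum.simps [simp del] rotated_digits.simps [simp del]

lemma digit_sum_0 [simp]: "digit_sum p 0 = 0"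
  by (simp add: digit_sum.simps)

lemma rotated_digits_0 [simp]: "rotated_digits p h j 0 = 0"
  by (simp add: rotated_digits.simps)

lemma digit_sum_step: "p > 1 \<Longrightarrow> b < p \<Longrightarrow> digit_sum p (p * a + b) = b + digit_sum p a"
  by (cases "p * a + b = 0") (auto simp: digit_sum.simps[of p "p * a + b"])

lemma digit_sum_power_mult: "p > 1 \<Longrightarrow> digit_sum p (p ^ k * n) = digit_sum p n"
  by (induction k) (auto simp: mult.assoc digit_sum_step[of p 0, simplified])

lemma digit_sum_power_minus_1: "p > 1 \<Longrightarrow> digit_sum p (p ^ h - 1) = h * (p - 1)"
proof (induction h)
  case (Suc h)
  have "p ^ Suc h - 1 = p * (p ^ h - 1) + (p - 1)"
    using Suc.prems by (simp add: right_diff_distrib')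
  then show ?case
    using digit_sum_step[of p "p - 1" "p ^ h - 1"] Suc by simp
qed simp

text \<open>Adding 1 carries through the trailing digits \<open>p - 1\<close>. Their number is the
  multiplicity of \<open>p\<close> in \<open>Suc n\<close>, and each of them lowers the digit sum by
  \<open>p - 1\<close>.\<close>

lemma digit_sum_Suc:
  assumes "p > 1"
  shows "digit_sum p (Suc n) + (p - 1) * multiplicity p (Suc n) = digit_sum p n + 1"
proof (induction n rule: less_induct)
  case (less n)
  define a b where "a = n div p" and "b = n mod p"
  have n: "n = p * a + b" "b < p" using assms by (auto simp: a_def b_def)
  show ?case
  proof (cases "Suc b < p")
    case True
    have "\<not> p dvd Suc n"
    proof
      assume "p dvd Suc n"
      then have "p dvd p * a + Suc b" using n by simp
      then have "p dvd Suc b" by (subst (asm) dvd_add_right_iff) auto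
      then show False using True by (auto dest: dvd_imp_le)
    qed
    then show ?thesis
      using True n digit_sum_step[OF assms True, of a] digit_sum_step[OF assms n(2), of a]
      by (simp add: not_dvd_imp_multiplicity_0)
  next
    case False
    then have b: "Suc b = p" using n(2) by simp
    then have eq: "Suc n = p * Suc a" using n by simp
    have "a < n \<or> n = 0" using n b assms by (cases a) auto
    then have "a < n" using eq assms by auto
    from less.IH[OF this] have "digit_sum p (Suc a) + (p - 1) * multiplicity p (Suc a) = digit_sum p a + 1" .
    moreover have "multiplicity p (Suc n) = Suc (multiplicity p (Suc a))"
      unfolding eq using assms by (intro multiplicity_times_same) auto
    moreover have "digit_sum p (Suc n) = digit_sum p (Suc a)"
      unfolding eq using digit_sum_step[of p 0 "Suc a"] assms by simp
    moreover have "digit_sum p n = b + digit_sum p a"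
      using n digit_sum_step[OF assms n(2)] by simp
    moreover have "p - 1 = b" using b by simp
    ultimately show ?thesis by simp
  qed
qed

text \<open>Legendre's formula, free of subtraction and division, by summing
  \<open>digit_sum_Suc\<close>.\<close>

lemma multiplicity_fact_digit_sum:
  assumes "Factorial_Ring.prime (p::nat)"
  shows "(p - 1) * multiplicity p (fact n) + digit_sum p n = n"
proof (induction n)
  case (Suc n)
  have "multiplicity p (fact (Suc n)) = multiplicity p (Suc n) + multiplicity p (fact n :: nat)"
    unfolding fact_Suc of_nat_id using assms
    by (intro prime_elem_multiplicity_mult_distrib) auto
  then show ?case
    using Suc digit_sum_Suc[OF prime_gt_1_nat[OF assms], of n] by (simp add: algebra_simps)
qed simp

text \<open>A number divisible by \<open>p ^ h - 1\<close> is bounded below by it only if it is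
  positive; this is what excludes 0.\<close>

lemma rotated_digits_pos:
  assumes "p > 1" "n > 0"
  shows "rotated_digits p h j n > 0"
  using assms(2)
proof (induction n arbitrary: j rule: less_induct)
  case (less n)
  show ?case
  proof (cases "n mod p = 0")
    case True
    then have "n div p > 0" "n div p < n" using less.prems assms(1) by (auto simp: div_eq_0_iff dest: mod_less)
    then have "rotated_digits p h (Suc j) (n div p) > 0" using less.IH by blast
    then show ?thesis using less.prems assms by (subst rotated_digits.simps) auto
  next
    case False
    then show ?thesis using less.prems assms by (subst rotated_digits.simps) auto
  qed
qed

lemma rotated_digits_add_period: "rotated_digits p h (j + h) n = rotated_digits p h j n"
proof (induction n arbitrary: j rule: less_induct)
  case (less n)
  show ?case
  proof (cases "n = 0 \<or> p \<le> 1")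
    case True
    then show ?thesis by (auto simp: rotated_digits.simps)
  next
    case False
    then have "n div p < n" by simp
    from less.IH[OF this, of "Suc j"] show ?thesis
      using False by (simp add: rotated_digits.simps[of p h _ n])
  qed
qed

text \<open>Over a full period each digit meets every power \<open>p ^ j\<close> with
  \<open>j < h\<close> exactly once.\<close>

lemma sum_rotated_digits:
  "(\<Sum>j<h. rotated_digits p h j n) = digit_sum p n * (\<Sum>j<h. p ^ j)"
proof (induction n rule: less_induct)
  case (less n)
  show ?case
  proof (cases "n = 0 \<or> p \<le> 1")
    case True
    then show ?thesis by (auto simp: rotated_digits.simps digit_sum.simps)
  next
    case False
    let ?g = "\<lambda>j. rotated_digits p h j (n div p)"
    have "?g 0 + (\<Sum>j<h. ?g (Suc j)) = (\<Sum>j<h. ?g j) + ?g h"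
      using sum.lessThan_Suc_shift[of ?g h] sum.lessThan_Suc[of ?g h] by simp
    moreover have "?g h = ?g 0" using rotated_digits_add_period[of p h 0] by simp
    ultimately have shift: "(\<Sum>j<h. ?g (Suc j)) = (\<Sum>j<h. ?g j)" by simp
    have "(\<Sum>j<h. rotated_digits p h j n) = (\<Sum>j<h. (n mod p) * p ^ j + ?g (Suc j))"
      using False by (intro sum.cong) (auto simp: rotated_digits.simps[of p h _ n])
    also have "\<dots> = (n mod p) * (\<Sum>j<h. p ^ j) + (\<Sum>j<h. ?g j)"
      by (simp add: sum.distrib sum_distrib_left shift)
    also have "\<dots> = (n mod p + digit_sum p (n div p)) * (\<Sum>j<h. p ^ j)"
      using less.IH[of "n div p"] False by (simp add: algebra_simps)
    also have "n mod p + digit_sum p (n div p) = digit_sum p n"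
      using False by (simp add: digit_sum.simps[of p n])
    finally show ?thesis .
  qed
qed

lemma sum_rotated_digits':
  assumes "p > 1"
  shows "(p - 1) * (\<Sum>j<h. rotated_digits p h j n) = digit_sum p n * (p ^ h - 1)"
proof -
  have "(p - 1) * (\<Sum>j<h. p ^ j) = p ^ h - 1"
  proof (induction h)
    case (Suc h)
    have "p ^ h \<ge> 1" using assms by simp
    with Suc show ?case using assms by (simp add: algebra_simps)
  qed simp
  then show ?thesis by (simp add: sum_rotated_digits mult.left_commute)
qed

lemma cong_power_mod_exponent: "[p ^ (j mod h) = p ^ j] (mod p ^ h - 1)" if "p > 1" for p :: nat
proof -
  have "[p ^ h = 1] (mod p ^ h - 1)"
    using that by (simp add: cong_altdef_nat)
  then have "[(p ^ h) ^ (j div h) * p ^ (j mod h) = 1 ^ (j div h) * p ^ (j mod h)] (mod p ^ h - 1)"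
    by (intro cong_mult cong_pow) auto
  then show ?thesis
    by (simp add: cong_sym_eq flip: power_mult power_add)
qed

lemma cong_rotated_digits:
  assumes "p > 1"
  shows "[rotated_digits p h j n = p ^ j * n] (mod p ^ h - 1)"
proof (induction n arbitrary: j rule: less_induct)
  case (less n)
  show ?case
  proof (cases "n = 0")
    case False
    have "[(n mod p) * p ^ (j mod h) + rotated_digits p h (Suc j) (n div p) =
        (n mod p) * p ^ j + p ^ Suc j * (n div p)] (mod p ^ h - 1)"
      using less.IH[of "n div p" "Suc j"] False assms cong_power_mod_exponent[OF assms]
      by (intro cong_add cong_mult) auto
    moreover have "(n mod p) * p ^ j + p ^ Suc j * (n div p) = p ^ j * (n mod p + p * (n div p))"
      by (simp only: distrib_left power_Suc mult_ac)
    ultimately show ?thesis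
      using False assms by (simp add: rotated_digits.simps[of p h j n])
  qed simp
qed

text \<open>Rotation is multiplication by \<open>p ^ j\<close> modulo \<open>p ^ h - 1\<close>, so
  it preserves divisibility relations. Each rotation thus yields a fresh inequality, and the digit
  sum is recovered from all of them together.\<close>

lemma dvd_sum_rotated_digits:
  assumes "p > 1" "(p ^ h - 1) dvd (\<Sum>i\<in>A. u i * a i)"
  shows "(p ^ h - 1) dvd (\<Sum>i\<in>A. rotated_digits p h j (u i) * a i)"
proof -
  have "[(\<Sum>i\<in>A. rotated_digits p h j (u i) * a i) = (\<Sum>i\<in>A. (p ^ j * u i) * a i)] (mod p ^ h - 1)"
    by (intro cong_sum cong_mult cong_rotated_digits assms) auto
  moreover have "(\<Sum>i\<in>A. (p ^ j * u i) * a i) = p ^ j * (\<Sum>i\<in>A. u i * a i)"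
    by (simp add: sum_distrib_left mult.assoc)
  ultimately show ?thesis
    using assms(2) by (simp add: cong_dvd_iff)
qed

text \<open>
  Each rotation \<open>j\<close> yields integers \<open>c k\<close> with
  \<open>n - r \<le> (\<Sum>k\<in>S. d * p ^ k * c k)\<close>; working with these integers, rather than with the average over
  all \<open>j\<close>, is what allows the rounding up in \<open>B\<close>.
\<close>

lemma weight_bound:
  fixes u :: "nat \<Rightarrow> (nat \<Rightarrow> nat) \<Rightarrow> nat" and E :: "(nat \<Rightarrow> nat) set"
  assumes p: "p > 1" and h: "h \<ge> 1" and E: "finite E" and S: "S \<subseteq> {..<m}" and m: "m \<ge> 1" and d: "d \<ge> 1"
    and M: "M > 0" "(p ^ h - 1) dvd M"
    and total: "\<And>k. k \<in> S \<Longrightarrow> (\<Sum>e\<in>E. u k e) = M"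
    and deg: "\<And>k e. k \<in> S \<Longrightarrow> e \<in> E \<Longrightarrow> u k e > 0 \<Longrightarrow> (\<Sum>i<n. e i) \<le> d * p ^ k"
    and dvd: "\<And>i. i < n \<Longrightarrow> (p ^ h - 1) dvd (\<Sum>k\<in>S. \<Sum>e\<in>E. u k e * e i)"
    and B: "\<And>t. n \<le> d * p ^ (m - 1) * t + d * (\<Sum>k<m. p ^ k) \<Longrightarrow> B \<le> t"
  defines "r \<equiv> card {i. i < n \<and> (\<Sum>k\<in>S. \<Sum>e\<in>E. u k e * e i) = 0}"
  shows "(p - 1) * h * (B + card S) \<le> (p - 1) * h * r + (\<Sum>k\<in>S. \<Sum>e\<in>E. digit_sum p (u k e))"
proof -
  let ?\<rho> = "rotated_digits p h"
  let ?s = "\<lambda>i. \<Sum>k\<in>S. \<Sum>e\<in>E. u k e * e i"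
  define Q where "Q = p ^ h - 1"
  have "p ^ h > 1" using one_less_power[OF p, of h] h by simp
  then have Q: "Q > 0" by (simp add: Q_def)
  have finS: "finite S" using S finite_subset by blast
  have main: "Q * (B + card S) \<le> Q * r + (\<Sum>k\<in>S. \<Sum>e\<in>E. ?\<rho> j (u k e))" for j
  proof -
    \<comment> \<open>\<open>Q\<close> divides the unrotated weights, whose sum is \<open>M\<close>,
      and hence also the rotated ones. The quotient is at least 1 because \<open>M > 0\<close> makes
      some weight positive.\<close>
    define c where "c k = (\<Sum>e\<in>E. ?\<rho> j (u k e)) div Q" for k
    have ck: "(\<Sum>e\<in>E. ?\<rho> j (u k e)) = Q * c k" and ck1: "c k \<ge> 1" if "k \<in> S" for k
    proof -
      have "Q dvd (\<Sum>e\<in>E. ?\<rho> j (u k e) * 1)"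
        unfolding Q_def using total[OF that] M by (intro dvd_sum_rotated_digits p) simp
      then show 1: "(\<Sum>e\<in>E. ?\<rho> j (u k e)) = Q * c k" by (simp add: c_def)
      have "\<exists>e\<in>E. u k e > 0"
        using total[OF that] M(1) by (metis neq0_conv sum.neutral)
      then obtain e where "e \<in> E" "u k e > 0" by blast
      then have "(\<Sum>e\<in>E. ?\<rho> j (u k e)) > 0"
        using rotated_digits_pos[OF p, of "u k e" h j] E by (intro sum_pos2[of _ e]) auto
      then show "c k \<ge> 1" using 1 by (cases "c k") auto
    qed
    \<comment> \<open>A variable that occurs has positive rotated exponent, and this exponent is a
      multiple of \<open>Q\<close>.\<close>
    have big: "Q \<le> (\<Sum>k\<in>S. \<Sum>e\<in>E. ?\<rho> j (u k e) * e i)" if i: "i < n" and nz: "?s i \<noteq> 0" for i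
    proof -
      have eq: "(\<Sum>k\<in>S. \<Sum>e\<in>E. g k e) = (\<Sum>(k,e)\<in>S \<times> E. g k e)" for g :: "nat \<Rightarrow> (nat \<Rightarrow> nat) \<Rightarrow> nat"
        by (rule sum.cartesian_product)
      have "Q dvd (\<Sum>x\<in>S \<times> E. ?\<rho> j (u (fst x) (snd x)) * snd x i)"
        unfolding Q_def using dvd[OF i] 
        by (intro dvd_sum_rotated_digits p) (simp add: eq case_prod_unfold)
      then have "Q dvd (\<Sum>k\<in>S. \<Sum>e\<in>E. ?\<rho> j (u k e) * e i)"
        by (simp add: eq case_prod_unfold)
      moreover have "(\<Sum>k\<in>S. \<Sum>e\<in>E. ?\<rho> j (u k e) * e i) > 0"
      proof -
        obtain k where k: "k \<in> S" "(\<Sum>e\<in>E. u k e * e i) \<noteq> 0" using nz by (meson sum.neutral)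
        then obtain e where e: "e \<in> E" "u k e * e i \<noteq> 0" by (meson sum.neutral)
        then have "?\<rho> j (u k e) * e i > 0" using rotated_digits_pos[OF p, of "u k e" h j] by simp
        then have "(\<Sum>e\<in>E. ?\<rho> j (u k e) * e i) > 0" using e(1) E by (intro sum_pos2[of _ e]) auto
        then show ?thesis using k(1) finS by (intro sum_pos2[of _ k]) auto
      qed
      ultimately show ?thesis by (simp add: dvd_imp_le)
    qed
    have "card {i. i < n \<and> ?s i \<noteq> 0} + r = card ({i. i < n \<and> ?s i \<noteq> 0} \<union> {i. i < n \<and> ?s i = 0})"
      unfolding r_def by (subst card_Un_disjoint) auto
    also have "{i. i < n \<and> ?s i \<noteq> 0} \<union> {i. i < n \<and> ?s i = 0} = {..<n}" by auto
    finally have n_eq: "n = card {i. i < n \<and> ?s i \<noteq> 0} + r" by simp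
    have "Q * card {i. i < n \<and> ?s i \<noteq> 0} = (\<Sum>i\<in>{i. i < n \<and> ?s i \<noteq> 0}. Q)" by simp
    also have "\<dots> \<le> (\<Sum>i\<in>{i. i < n \<and> ?s i \<noteq> 0}. \<Sum>k\<in>S. \<Sum>e\<in>E. ?\<rho> j (u k e) * e i)"
      by (intro sum_mono big) auto
    also have "\<dots> \<le> (\<Sum>i<n. \<Sum>k\<in>S. \<Sum>e\<in>E. ?\<rho> j (u k e) * e i)"
      by (intro sum_mono2) auto
    also have "\<dots> = (\<Sum>k\<in>S. \<Sum>i<n. \<Sum>e\<in>E. ?\<rho> j (u k e) * e i)"
      by (rule sum.swap)
    also have "\<dots> = (\<Sum>k\<in>S. \<Sum>e\<in>E. \<Sum>i<n. ?\<rho> j (u k e) * e i)"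
      by (intro sum.cong refl sum.swap)
    also have "\<dots> \<le> (\<Sum>k\<in>S. \<Sum>e\<in>E. ?\<rho> j (u k e) * (d * p ^ k))"
    proof (intro sum_mono)
      fix k e assume "k \<in> S" "e \<in> E"
      then show "(\<Sum>i<n. ?\<rho> j (u k e) * e i) \<le> ?\<rho> j (u k e) * (d * p ^ k)"
        using deg[of k e] by (cases "u k e = 0") (auto simp flip: sum_distrib_left)
    qed
    also have "\<dots> = (\<Sum>k\<in>S. (\<Sum>e\<in>E. ?\<rho> j (u k e)) * (d * p ^ k))"
      by (simp add: sum_distrib_right)
    also have "\<dots> = (\<Sum>k\<in>S. Q * c k * (d * p ^ k))"
      using ck by (intro sum.cong) auto
    also have "\<dots> = Q * (\<Sum>k\<in>S. c k * (d * p ^ k))"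
      by (simp add: sum_distrib_left mult.assoc)
    finally have "card {i. i < n \<and> ?s i \<noteq> 0} \<le> (\<Sum>k\<in>S. c k * (d * p ^ k))"
      using Q by simp
    \<comment> \<open>One unit of every \<open>c k\<close> is charged the actual degree, the
      remaining \<open>c k - 1\<close> the largest degree. These two charges are the shape that
      \<open>B\<close> expects.\<close>
    also have "\<dots> = (\<Sum>k\<in>S. (c k - 1) * (d * p ^ k)) + (\<Sum>k\<in>S. d * p ^ k)"
      unfolding sum.distrib[symmetric]
    proof (rule sum.cong[OF refl])
      fix k assume "k \<in> S"
      then obtain c' where "c k = Suc c'" using ck1[of k] by (cases "c k") auto
      then show "c k * (d * p ^ k) = (c k - 1) * (d * p ^ k) + d * p ^ k" by simp
    qed
    also have "(\<Sum>k\<in>S. (c k - 1) * (d * p ^ k)) \<le> (\<Sum>k\<in>S. (c k - 1) * (d * p ^ (m - 1)))"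
      using S p by (intro sum_mono mult_left_mono power_increasing) auto
    also have "\<dots> = d * p ^ (m - 1) * (\<Sum>k\<in>S. c k - 1)"
      by (simp add: sum_distrib_left sum_distrib_right mult.commute)
    also have "(\<Sum>k\<in>S. d * p ^ k) \<le> (\<Sum>k<m. d * p ^ k)"
      using S by (intro sum_mono2) auto
    finally have "card {i. i < n \<and> ?s i \<noteq> 0}
        \<le> d * p ^ (m - 1) * (\<Sum>k\<in>S. c k - 1) + d * (\<Sum>k<m. p ^ k)"
      by (simp add: sum_distrib_left)
    \<comment> \<open>The \<open>r\<close> missing variables are put into the multiplier of the
      largest degree, so that \<open>B\<close> applies with
      \<open>t = r + (\<Sum>k\<in>S. c k - 1)\<close>.\<close>
    moreover have "r \<le> d * p ^ (m - 1) * r" using d p by simp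
    ultimately have "n \<le> d * p ^ (m - 1) * (r + (\<Sum>k\<in>S. c k - 1)) + d * (\<Sum>k<m. p ^ k)"
      unfolding distrib_left using n_eq by linarith
    then have "B \<le> r + (\<Sum>k\<in>S. c k - 1)" by (rule B)
    moreover have "(\<Sum>k\<in>S. c k - 1) + card S = (\<Sum>k\<in>S. c k)"
    proof -
      have "(\<Sum>k\<in>S. c k - 1) + card S = (\<Sum>k\<in>S. (c k - 1) + 1)" by (simp only: sum.distrib card_eq_sum)
      also have "\<dots> = (\<Sum>k\<in>S. c k)" using ck1 by (intro sum.cong refl le_add_diff_inverse2)
      finally show ?thesis .
    qed
    ultimately have "B + card S \<le> r + (\<Sum>k\<in>S. c k)" by linarith
    then have "Q * (B + card S) \<le> Q * (r + (\<Sum>k\<in>S. c k))" by simp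
    also have "\<dots> = Q * r + (\<Sum>k\<in>S. \<Sum>e\<in>E. ?\<rho> j (u k e))"
      using ck by (simp add: distrib_left sum_distrib_left)
    finally show ?thesis .
  qed
  \<comment> \<open>Only now, with the rounding done for each \<open>j\<close>, are the inequalities
    summed over all rotations, which turns rotated weights into digit sums.\<close>
  have "Q * ((p - 1) * h * (B + card S)) = (p - 1) * (\<Sum>j<h. Q * (B + card S))"
    by simp
  also have "\<dots> \<le> (p - 1) * (\<Sum>j<h. Q * r + (\<Sum>k\<in>S. \<Sum>e\<in>E. ?\<rho> j (u k e)))"
    by (intro mult_left_mono sum_mono main) auto
  also have "\<dots> = Q * ((p - 1) * h * r) + (p - 1) * (\<Sum>j<h. \<Sum>k\<in>S. \<Sum>e\<in>E. ?\<rho> j (u k e))"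
    by (simp add: sum.distrib distrib_left)
  also have "(\<Sum>j<h. \<Sum>k\<in>S. \<Sum>e\<in>E. ?\<rho> j (u k e)) = (\<Sum>k\<in>S. \<Sum>j<h. \<Sum>e\<in>E. ?\<rho> j (u k e))"
    by (rule sum.swap)
  also have "\<dots> = (\<Sum>k\<in>S. \<Sum>e\<in>E. \<Sum>j<h. ?\<rho> j (u k e))"
    by (intro sum.cong refl sum.swap)
  also have "(p - 1) * \<dots> = (\<Sum>k\<in>S. \<Sum>e\<in>E. (p - 1) * (\<Sum>j<h. ?\<rho> j (u k e)))"
    by (simp only: sum_distrib_left)
  also have "\<dots> = (\<Sum>k\<in>S. \<Sum>e\<in>E. digit_sum p (u k e) * Q)"
    by (simp only: sum_rotated_digits'[OF p] Q_def)
  also have "\<dots> = Q * (\<Sum>k\<in>S. \<Sum>e\<in>E. digit_sum p (u k e))"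
    by (simp add: sum_distrib_left mult.commute)
  finally show ?thesis
    using Q by (simp flip: distrib_left)
qed

section \<open>Lifting powers of Frobenius\<close>

text \<open>The error is displayed as \<open>p\<close> times an explicit polynomial with natural
  coefficients, so that a relation respecting sums and products can be carried through it.\<close>

lemma freshman_power_add:
  fixes x y :: "'b :: comm_ring_1"
  assumes "Factorial_Ring.prime p"
  shows "(x + y) ^ p = x ^ p + y ^ p
    + of_nat p * (\<Sum>k\<in>{1..<p}. of_nat ((p choose k) div p) * x ^ k * y ^ (p - k))"
proof -
  have p: "p > 1" using assms prime_gt_1_nat by blast
  have "(x + y) ^ p = (\<Sum>k\<le>p. of_nat (p choose k) * x ^ k * y ^ (p - k))"
    by (rule binomial_ring)
  also have "{..p} = insert 0 (insert p {1..<p})" using p by auto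
  also have "(\<Sum>k\<in>\<dots>. of_nat (p choose k) * x ^ k * y ^ (p - k)) =
      y ^ p + (x ^ p + (\<Sum>k\<in>{1..<p}. of_nat (p choose k) * x ^ k * y ^ (p - k)))"
    using p by simp
  also have "(\<Sum>k\<in>{1..<p}. of_nat (p choose k) * x ^ k * y ^ (p - k)) =
      (\<Sum>k\<in>{1..<p}. of_nat p * (of_nat ((p choose k) div p) * x ^ k * y ^ (p - k)))"
  proof (rule sum.cong[OF refl])
    fix k assume "k \<in> {1..<p}"
    then have "p dvd (p choose k)" using assms by (intro dvd_choose_prime) auto
    then have "of_nat (p choose k) = (of_nat (p * ((p choose k) div p)) :: 'b)" by simp
    then show "of_nat (p choose k) * x ^ k * y ^ (p - k) =
        of_nat p * (of_nat ((p choose k) div p) * x ^ k * y ^ (p - k))"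
      by (simp only: of_nat_mult mult.assoc)
  qed
  finally show ?thesis by (simp add: sum_distrib_left algebra_simps)
qed

context unramified
begin

text \<open>
  The graph of the lift \<open>t \<mapsto> t ^ P\<close> on integral combinations of Teichmueller representatives. It stands
  in for a power of the Frobenius automorphism of \<open>Zq\<close>, whose existence is not needed: all that
  matters is that it preserves divisibility by powers of \<open>p\<close>.
\<close>

inductive frob_pair :: "nat \<Rightarrow> 'a \<Rightarrow> 'a \<Rightarrow> bool" for P where
  zero: "frob_pair P 0 0"
| plus: "frob_pair P a b \<Longrightarrow> t \<in> Tq q \<Longrightarrow> frob_pair P (a + t) (b + t ^ P)"
| minus: "frob_pair P a b \<Longrightarrow> t \<in> Tq q \<Longrightarrow> frob_pair P (a - t) (b - t ^ P)"

lemma frob_pair_Tq: "t \<in> Tq q \<Longrightarrow> frob_pair P t (t ^ P)"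
  using frob_pair.plus[OF frob_pair.zero] by fastforce

lemma frob_pair_add:
  assumes "frob_pair P a b" "frob_pair P c e"
  shows "frob_pair P (a + c) (b + e)"
  using assms(2)
proof induction
  case (plus c e t)
  then show ?case using frob_pair.plus[of P "a + c" "b + e" t] by (simp add: add.assoc)
next
  case (minus c e t)
  then show ?case using frob_pair.minus[of P "a + c" "b + e" t] by (simp add: add_diff_eq)
qed (use assms in simp)

lemma frob_pair_uminus: "frob_pair P a b \<Longrightarrow> frob_pair P (- a) (- b)"
proof (induction rule: frob_pair.induct)
  case (plus a b t)
  then show ?case using frob_pair.minus[of P "-a" "-b" t] by simp
next
  case (minus a b t)
  then show ?case using frob_pair.plus[of P "-a" "-b" t] by (simp add: add.commute)
qed (use frob_pair.zero in simp)

lemma frob_pair_diff: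
  "frob_pair P a b \<Longrightarrow> frob_pair P c e \<Longrightarrow> frob_pair P (a - c) (b - e)"
  using frob_pair_add[of P a b "-c" "-e"] frob_pair_uminus[of P c e] by simp

text \<open>The rules generate sums only; products are covered because Teichmueller representatives
  are closed under multiplication.\<close>

lemma frob_pair_mult:
  assumes "frob_pair P a b" "frob_pair P c e"
  shows "frob_pair P (a * c) (b * e)"
proof -
  have 1: "frob_pair P (a * t) (b * t ^ P)" if t: "t \<in> Tq q" for t
    using assms(1)
  proof induction
    case zero
    show ?case using frob_pair.zero by simp
  next
    case (plus a b s)
    then show ?case
      using frob_pair.plus[of P "a * t" "b * t ^ P" "s * t"] t Tq_mult by (simp add: algebra_simps power_mult_distrib)
  next
    case (minus a b s)
    then show ?case
      using frob_pair.minus[of P "a * t" "b * t ^ P" "s * t"] t Tq_mult by (simp add: algebra_simps power_mult_distrib)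
  qed
  show ?thesis
    using assms(2)
  proof induction
    case zero
    show ?case using frob_pair.zero by simp
  next
    case (plus c e t)
    then show ?case using frob_pair_add[OF plus.IH 1[of t]] by (simp add: algebra_simps)
  next
    case (minus c e t)
    then show ?case using frob_pair_diff[OF minus.IH 1[of t]] by (simp add: algebra_simps)
  qed
qed

lemma frob_pair_1: "frob_pair P 1 1"
  using frob_pair_Tq[OF Tq_1, of P] by simp

lemma frob_pair_power: "frob_pair P a b \<Longrightarrow> frob_pair P (a ^ n) (b ^ n)"
  by (induction n) (auto intro: frob_pair_mult frob_pair_1)

lemma frob_pair_of_nat: "frob_pair P (of_nat n) (of_nat n)"
  by (induction n) (auto intro: frob_pair_add frob_pair_1 frob_pair.zero)

lemma frob_pair_sum:
  "(\<And>i. i \<in> A \<Longrightarrow> frob_pair P (f i) (g i)) \<Longrightarrow> frob_pair P (sum f A) (sum g A)"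
  by (induction A rule: infinite_finite_induct) (auto intro: frob_pair_add frob_pair.zero)

lemma frob_pair_absval_le_1:
  assumes "frob_pair P a b"
  shows "absval a \<le> (1::real)" "absval b \<le> (1::real)"
  using assms
  by induction (auto intro!: absval_add_le absval_diff_le intro: Tq_absval_le_1 Tq_power)

text \<open>Perfectness of the residue field, witnessed on both sides of the relation at once:
  \<open>c\<close> and \<open>e\<close> are \<open>p\<close>-th roots modulo \<open>p\<close> that
  are themselves related, and so are the errors.\<close>

definition has_frob_root :: "nat \<Rightarrow> 'a \<Rightarrow> 'a \<Rightarrow> bool" where
  "has_frob_root P a b \<longleftrightarrow> (\<exists>c e \<alpha> \<beta>. frob_pair P c e \<and> frob_pair P \<alpha> \<beta> \<and>
     a = c ^ p + of_nat p * \<alpha> \<and> b = e ^ p + of_nat p * \<beta>)"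

text \<open>Roots are added. The error is the same integral polynomial in the roots on both sides,
  hence a related pair that can be moved into \<alpha> and \<beta>.\<close>

lemma has_frob_root_add:
  assumes "has_frob_root P a b" "has_frob_root P a' b'"
  shows "has_frob_root P (a + a') (b + b')"
proof -
  obtain c e \<alpha> \<beta> c' e' \<alpha>' \<beta>' where
    1: "frob_pair P c e" "frob_pair P \<alpha> \<beta>" "a = c ^ p + of_nat p * \<alpha>" "b = e ^ p + of_nat p * \<beta>"
    and 2: "frob_pair P c' e'" "frob_pair P \<alpha>' \<beta>'" "a' = c' ^ p + of_nat p * \<alpha>'" "b' = e' ^ p + of_nat p * \<beta>'"
    using assms unfolding has_frob_root_def by blast
  let ?s = "\<lambda>x y. \<Sum>k\<in>{1..<p}. of_nat ((p choose k) div p) * x ^ k * y ^ (p - k) :: 'a"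
  have s: "frob_pair P (?s c c') (?s e e')"
    using 1 2 by (intro frob_pair_sum frob_pair_mult frob_pair_of_nat frob_pair_power)
  have "a + a' = (c + c') ^ p + of_nat p * (\<alpha> + \<alpha>' - ?s c c')"
    unfolding 1 2 freshman_power_add[OF prime_p] by (simp add: algebra_simps)
  moreover have "b + b' = (e + e') ^ p + of_nat p * (\<beta> + \<beta>' - ?s e e')"
    unfolding 1 2 freshman_power_add[OF prime_p] by (simp add: algebra_simps)
  ultimately show ?thesis
    unfolding has_frob_root_def
    using frob_pair_add[OF 1(1) 2(1)] frob_pair_diff[OF frob_pair_add[OF 1(2) 2(2)] s] by blast
qed

lemma has_frob_root_Tq:
  assumes "t \<in> Tq q"
  shows "has_frob_root P t (t ^ P)" "has_frob_root P (- t) (- (t ^ P))"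
proof -
  define u where "u = t ^ (p ^ (h - 1))"
  have u: "u \<in> Tq q" using assms by (simp add: u_def Tq_power)
  have "p ^ (h - 1) * p = q" using h_pos by (simp add: q_eq power_eq_if mult.commute)
  then have up: "u ^ p = t" using Tq_power_q[OF assms] by (simp add: u_def flip: power_mult)
  have upP: "(u ^ P) ^ p = t ^ P" by (metis up power_mult mult.commute)
  have uu: "frob_pair P u (u ^ P)" by (rule frob_pair_Tq[OF u])
  show "has_frob_root P t (t ^ P)"
    unfolding has_frob_root_def using uu frob_pair.zero up upP by (metis add.right_neutral mult_zero_right)
  show "has_frob_root P (- t) (- (t ^ P))"
  proof (cases "odd p")
    case True
    then have "- t = (- u) ^ p + of_nat p * 0" "- (t ^ P) = (- (u ^ P)) ^ p + of_nat p * 0"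
      by (simp_all add: up upP power_minus_odd)
    then show ?thesis
      unfolding has_frob_root_def using frob_pair_uminus[OF uu] frob_pair.zero by blast
  next
    \<comment> \<open>For \<open>p = 2\<close> the sign does not pass through the power; it is
      absorbed by \<open>- t = t + 2 * (- t)\<close>.\<close>
    case False
    then have "p = 2" using prime_p p_gt_1 by (metis primes_dvd_imp_eq two_is_prime_nat)
    then have "- t = u ^ p + of_nat p * (- t)" "- (t ^ P) = (u ^ P) ^ p + of_nat p * (- (t ^ P))"
      using up upP by simp_all
    then show ?thesis
      unfolding has_frob_root_def using uu frob_pair_uminus[OF frob_pair_Tq[OF assms]] by blast
  qed
qed

lemma frob_pair_has_root: "frob_pair P a b \<Longrightarrow> has_frob_root P a b"
proof (induction rule: frob_pair.induct)
  case zero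
  have "(0::'a) = 0 ^ p + of_nat p * 0" using p_gt_1 by simp
  then show ?case unfolding has_frob_root_def using frob_pair.zero by blast
next
  case (plus a b t)
  then show ?case using has_frob_root_add has_frob_root_Tq(1) by blast
next
  case (minus a b t)
  then show ?case using has_frob_root_add[OF minus.IH has_frob_root_Tq(2)[of t]] by simp
qed

lemma frob_pair_power_perturb:
  assumes "frob_pair P x x'" "frob_pair P y y'"
  shows "\<exists>z z'. frob_pair P z z' \<and> (x + of_nat p * y) ^ n = x ^ n + of_nat p * z \<and>
    (x' + of_nat p * y') ^ n = x' ^ n + of_nat p * z'"
proof (induction n)
  case 0
  show ?case using frob_pair.zero by force
next
  case (Suc n)
  then obtain z z' where z: "frob_pair P z z'" "(x + of_nat p * y) ^ n = x ^ n + of_nat p * z"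
    "(x' + of_nat p * y') ^ n = x' ^ n + of_nat p * z'" by blast
  let ?w = "\<lambda>x y z. x * z + y * x ^ n + of_nat p * y * z :: 'a"
  have "frob_pair P (?w x y z) (?w x' y' z')"
    using assms z(1) by (intro frob_pair_add frob_pair_mult frob_pair_power frob_pair_of_nat)
  moreover have "(x + of_nat p * y) ^ Suc n = x ^ Suc n + of_nat p * ?w x y z"
    unfolding power_Suc z by (simp add: algebra_simps)
  moreover have "(x' + of_nat p * y') ^ Suc n = x' ^ Suc n + of_nat p * ?w x' y' z'"
    unfolding power_Suc z by (simp add: algebra_simps)
  ultimately show ?case by blast
qed

text \<open>Deep roots serve to isolate the multiple of \<open>p\<close>: if \<open>c\<close> is
  divisible by \<open>p\<close>, then \<open>c ^ (p ^ r)\<close> is divisible by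
  \<open>p ^ r\<close> and can be neglected at that precision.\<close>

lemma frob_pair_root:
  assumes "frob_pair P a b"
  shows "\<exists>c e \<alpha> \<beta>. frob_pair P c e \<and> frob_pair P \<alpha> \<beta> \<and>
     a = c ^ (p ^ r) + of_nat p * \<alpha> \<and> b = e ^ (p ^ r) + of_nat p * \<beta>"
proof (induction r)
  case 0
  have "a = a ^ (p ^ 0) + of_nat p * 0" "b = b ^ (p ^ 0) + of_nat p * 0" by auto
  then show ?case using assms frob_pair.zero by blast
next
  case (Suc r)
  then obtain c e \<alpha> \<beta> where 1: "frob_pair P c e" "frob_pair P \<alpha> \<beta>"
     "a = c ^ (p ^ r) + of_nat p * \<alpha>" "b = e ^ (p ^ r) + of_nat p * \<beta>" by blast
  obtain c' e' \<gamma> \<delta> where 2: "frob_pair P c' e'" "frob_pair P \<gamma> \<delta>"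
     "c = c' ^ p + of_nat p * \<gamma>" "e = e' ^ p + of_nat p * \<delta>"
    using frob_pair_has_root[OF 1(1)] unfolding has_frob_root_def by blast
  obtain z z' where 3: "frob_pair P z z'" "c ^ (p ^ r) = (c' ^ p) ^ (p ^ r) + of_nat p * z"
     "e ^ (p ^ r) = (e' ^ p) ^ (p ^ r) + of_nat p * z'"
    unfolding 2(3,4) using frob_pair_power_perturb[OF frob_pair_power[OF 2(1), of p] 2(2), of "p ^ r"] by blast
  have "a = c' ^ (p ^ Suc r) + of_nat p * (z + \<alpha>)" "b = e' ^ (p ^ Suc r) + of_nat p * (z' + \<beta>)"
    unfolding 1(3,4) 3 by (simp_all add: algebra_simps flip: power_mult)
  then show ?case using 2(1) frob_pair_add[OF 3(1) 1(2)] by blast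
qed

lemma absval_frob_add:
  assumes "absval x \<le> (1::real)" "absval y \<le> (1::real)"
  shows "absval ((x + y) ^ (p ^ s) - (x ^ (p ^ s) + y ^ (p ^ s)) :: 'a) \<le> 1 / real p"
proof (induction s)
  case (Suc s)
  let ?X = "x ^ (p ^ s)" and ?Y = "y ^ (p ^ s)"
  have xy: "absval ?X \<le> 1" "absval ?Y \<le> 1" "absval (x + y) \<le> 1"
    using assms by (auto simp: absval_power power_le_one intro: absval_add_le)
  have "absval (((x + y) ^ (p ^ s)) ^ p - (?X + ?Y) ^ p) \<le> 1 / real p"
    using absval_power_diff_le[of "(x + y) ^ (p ^ s)" "?X + ?Y" p] Suc xy
    by (simp add: absval_power power_le_one absval_add_le)
  moreover have "absval ((?X + ?Y) ^ p - (?X ^ p + ?Y ^ p)) \<le> 1 / real p"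
  proof -
    let ?S = "\<Sum>k\<in>{1..<p}. of_nat ((p choose k) div p) * ?X ^ k * ?Y ^ (p - k)"
    have "absval ?S \<le> 1"
      using xy by (intro absval_sum_le) (auto simp: absval_mult absval_power[of _ "_ :: nat"] power_le_one intro!: mult_le_one absval_of_nat_le_1)
    moreover have "(?X + ?Y) ^ p - (?X ^ p + ?Y ^ p) = of_nat p * ?S"
      unfolding freshman_power_add[OF prime_p] by simp
    ultimately show ?thesis
      using p_gt_1 by (simp only: absval_mult absval_p) (simp add: divide_le_cancel)
  qed
  ultimately have "absval (((x + y) ^ (p ^ s)) ^ p - (?X ^ p + ?Y ^ p)) \<le> 1 / real p"
    by (rule absval_diff_trans_le)
  then show ?case by (simp only: power_Suc2 power_mult)
qed simp

lemma frob_pair_cong: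
  assumes "frob_pair (p ^ s) a b"
  shows "absval (b - a ^ (p ^ s)) \<le> 1 / real p"
  using assms
proof induction
  case zero
  have "p ^ s > 0" using p_gt_1 by simp
  then have zp: "(0::'a) ^ (p ^ s) = 0" by (rule zero_power)
  show ?case unfolding zp by simp
next
  case (plus a b t)
  have "absval ((a + t) ^ (p ^ s) - (a ^ (p ^ s) + t ^ (p ^ s))) \<le> 1 / real p"
    using frob_pair_absval_le_1[OF plus.hyps(1)] Tq_absval_le_1[OF plus.hyps(2)] by (intro absval_frob_add)
  from absval_diff_le[OF plus.IH this] show ?case by (simp add: algebra_simps)
next
  case (minus a b t)
  have t1: "absval t \<le> 1" "absval (- t) \<le> 1" using Tq_absval_le_1[OF minus.hyps(2)] by auto
  have a1: "absval a \<le> 1" using frob_pair_absval_le_1[OF minus.hyps(1)] by simp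
  \<comment> \<open>Additivity applied to \<open>t + (- t)\<close> compares
    \<open>(- t) ^ (p ^ s)\<close> with \<open>- (t ^ (p ^ s))\<close> modulo \<open>p\<close> for
    even and odd \<open>p\<close> alike.\<close>
  have z: "(t + (- t)) ^ (p ^ s) = 0" using p_gt_1 by simp
  have "absval ((t + (- t)) ^ (p ^ s) - (t ^ (p ^ s) + (- t) ^ (p ^ s))) \<le> 1 / real p"
    by (rule absval_frob_add[OF t1])
  then have 1: "absval (t ^ (p ^ s) + (- t) ^ (p ^ s)) \<le> 1 / real p"
    unfolding z by (simp only: diff_0 absval_minus)
  have 2: "absval ((a + (- t)) ^ (p ^ s) - (a ^ (p ^ s) + (- t) ^ (p ^ s))) \<le> 1 / real p"
    by (rule absval_frob_add[OF a1 t1(2)])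
  have "b - t ^ (p ^ s) - (a - t) ^ (p ^ s) = (b - a ^ (p ^ s)) - (t ^ (p ^ s) + (- t) ^ (p ^ s))
      - ((a + (- t)) ^ (p ^ s) - (a ^ (p ^ s) + (- t) ^ (p ^ s)))"
    by simp
  then show ?case using absval_diff_le[OF absval_diff_le[OF minus.IH 1] 2] by (simp only:)
qed

text \<open>With deep roots, \<open>p\<close> divides \<open>a\<close> only if it divides
  \<open>c\<close>, hence also \<open>e\<close> because \<open>e\<close> is congruent to
  \<open>c ^ (p ^ s)\<close>. Both power parts are then negligible, and the claim passes to \<alpha>
  and \<beta> at one lower precision. For \<open>a = 0\<close> this says that the lift is well
  defined.\<close>

lemma frob_pair_absval_le:
  assumes "frob_pair (p ^ s) a b" "absval a \<le> (1 / real p) ^ M"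
  shows "absval b \<le> (1 / real p) ^ M"
  using assms
proof (induction M arbitrary: a b)
  case 0
  then show ?case using frob_pair_absval_le_1 by simp
next
  case (Suc M)
  obtain c e \<alpha> \<beta> where *: "frob_pair (p ^ s) c e" "frob_pair (p ^ s) \<alpha> \<beta>"
     "a = c ^ (p ^ Suc M) + of_nat p * \<alpha>" "b = e ^ (p ^ Suc M) + of_nat p * \<beta>"
    using frob_pair_root[OF Suc.prems(1), of "Suc M"] by blast
  have ge: "Suc M \<le> p ^ Suc M"
    using less_exp[of "Suc M"] power_mono[of 2 p "Suc M"] p_gt_1 by linarith
  have small: "absval (x ^ (p ^ Suc M)) \<le> (1 / real p) ^ Suc M" if "absval x \<le> 1 / real p" for x :: 'a
  proof -
    have "absval (x ^ (p ^ Suc M)) \<le> (1 / real p) ^ (p ^ Suc M)"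
      unfolding absval_power by (rule power_mono[OF that]) simp
    also have "\<dots> \<le> (1 / real p) ^ Suc M"
      using inverse_p_less_1 by (intro power_decreasing[OF ge]) auto
    finally show ?thesis .
  qed
  have "(1 / real p) ^ Suc M < 1" using inverse_p_less_1 by (intro power_Suc_less_one) (use p_gt_1 in auto)
  then have "absval a < 1" using Suc.prems(2) by linarith
  moreover have "absval (of_nat p * \<alpha>) < 1"
  proof -
    have "1 / real p * absval \<alpha> \<le> 1 / real p * 1"
      using frob_pair_absval_le_1(1)[OF *(2)] by (intro mult_left_mono) auto
    then show ?thesis using inverse_p_less_1 unfolding absval_mult absval_p by linarith
  qed
  ultimately have "absval (c ^ (p ^ Suc M)) < 1"
    using absval_diff_less[of a 1 "of_nat p * \<alpha>"] *(3) by simp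
  then have "absval c < 1"
    using one_le_power[of "absval c" "p ^ Suc M"] unfolding absval_power by (meson not_less)
  then have c: "absval c \<le> 1 / real p" by (rule absval_less_1)
  have "absval (c ^ (p ^ s)) \<le> absval c"
    unfolding absval_power using frob_pair_absval_le_1(1)[OF *(1)] p_gt_1
      power_decreasing[of 1 "p ^ s" "absval c"] by simp
  then have e: "absval e \<le> 1 / real p"
    using absval_add_le[OF frob_pair_cong[OF *(1)], of "c ^ (p ^ s)"] c by simp
  have "absval (of_nat p * \<alpha>) \<le> (1 / real p) ^ Suc M"
    using absval_diff_le[OF Suc.prems(2) small[OF c]] *(3) by simp
  then have "1 / real p * absval \<alpha> \<le> 1 / real p * (1 / real p) ^ M"
    unfolding absval_mult absval_p by simp
  then have "absval \<alpha> \<le> (1 / real p) ^ M"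
    using p_gt_1 by (simp add: divide_le_cancel)
  then have "absval \<beta> \<le> (1 / real p) ^ M" by (rule Suc.IH[OF *(2)])
  then have "absval (of_nat p * \<beta>) \<le> (1 / real p) ^ Suc M"
    unfolding absval_mult absval_p power_Suc by (intro mult_left_mono) auto
  then show ?case unfolding *(4) by (intro absval_add_le small e)
qed

section \<open>Polynomial functions on the Teichmueller box\<close>

definition teich_box :: "nat \<Rightarrow> (nat \<Rightarrow> 'a) set" where
  "teich_box n = ({..<n} \<rightarrow>\<^sub>E Tq q)"

definition mono_fun :: "nat \<Rightarrow> (nat \<Rightarrow> nat) \<Rightarrow> (nat \<Rightarrow> 'a) \<Rightarrow> 'a" where
  "mono_fun n e x = (\<Prod>i<n. x i ^ e i)"

text \<open>Since \<open>t ^ q = t\<close> on the box, exponents up to \<open>q - 1\<close> suffice.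
  The exponent \<open>q - 1\<close> must stay, as \<open>t ^ (q - 1)\<close> differs from 1 at
  \<open>t = 0\<close>. Distinct members are independent as functions on the box, so values
  determine coefficients.\<close>

definition expos :: "nat \<Rightarrow> nat \<Rightarrow> (nat \<Rightarrow> nat) set" where
  "expos n D = {e \<in> {..<n} \<rightarrow>\<^sub>E {..<q}. (\<Sum>i<n. e i) \<le> D}"

text \<open>
  The coefficients range over the field rather than \<open>Zq\<close>, so that dividing by \<open>p\<close> is harmless;
  their integrality is recovered from that of the values, by \<open>poly_rep_integral\<close>.
\<close>

definition poly_rep :: "nat \<Rightarrow> nat \<Rightarrow> ((nat \<Rightarrow> nat) \<Rightarrow> 'a) \<Rightarrow> ((nat \<Rightarrow> 'a) \<Rightarrow> 'a) \<Rightarrow> bool" where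
  "poly_rep n D c G \<longleftrightarrow> (\<forall>x\<in>teich_box n. G x = (\<Sum>e\<in>expos n D. c e * mono_fun n e x))"

definition poly_fun :: "nat \<Rightarrow> nat \<Rightarrow> ((nat \<Rightarrow> 'a) \<Rightarrow> 'a) \<Rightarrow> bool" where
  "poly_fun n D G \<longleftrightarrow> (\<exists>c. poly_rep n D c G)"

lemma finite_teich_box: "finite (teich_box n)"
  unfolding teich_box_def by (intro finite_PiE finite_Tq) auto

lemma finite_expos: "finite (expos n D)"
proof -
  have "finite ({..<n} \<rightarrow>\<^sub>E {..<q})" by (intro finite_PiE) auto
  then show ?thesis unfolding expos_def by (rule finite_subset[rotated]) auto
qed

lemma teich_box_Tq: "x \<in> teich_box n \<Longrightarrow> i < n \<Longrightarrow> x i \<in> Tq q"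
  by (auto simp: teich_box_def)

lemma poly_fun_cong:
  "poly_fun n D G \<Longrightarrow> (\<And>x. x \<in> teich_box n \<Longrightarrow> G x = H x) \<Longrightarrow> poly_fun n D H"
  unfolding poly_fun_def poly_rep_def by metis

lemma poly_fun_add:
  assumes "poly_fun n D G" "poly_fun n D H"
  shows "poly_fun n D (\<lambda>x. G x + H x)"
proof -
  obtain c c' where "poly_rep n D c G" "poly_rep n D c' H" using assms unfolding poly_fun_def by blast
  then have "poly_rep n D (\<lambda>e. c e + c' e) (\<lambda>x. G x + H x)"
    unfolding poly_rep_def by (auto simp: distrib_right sum.distrib)
  then show ?thesis unfolding poly_fun_def by blast
qed

lemma poly_fun_scale:
  assumes "poly_fun n D G"
  shows "poly_fun n D (\<lambda>x. a * G x)"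
proof -
  obtain c where "poly_rep n D c G" using assms unfolding poly_fun_def by blast
  then have "poly_rep n D (\<lambda>e. a * c e) (\<lambda>x. a * G x)"
    unfolding poly_rep_def by (auto simp: sum_distrib_left mult.assoc)
  then show ?thesis unfolding poly_fun_def by blast
qed

lemma poly_fun_0: "poly_fun n D (\<lambda>x. 0)"
  unfolding poly_fun_def poly_rep_def by (intro exI[of _ "\<lambda>_. 0"]) auto

lemma poly_fun_sum:
  "(\<And>i. i \<in> A \<Longrightarrow> poly_fun n D (f i)) \<Longrightarrow> poly_fun n D (\<lambda>x. \<Sum>i\<in>A. f i x)"
  by (induction A rule: infinite_finite_induct) (auto intro: poly_fun_add poly_fun_0)

text \<open>Positive exponents are reduced into the range from 1 to \<open>q - 1\<close>, not to 0,
  so that the value at \<open>t = 0\<close> is preserved.\<close>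

definition reduce_exp :: "nat \<Rightarrow> nat" where
  "reduce_exp a = (if a = 0 then 0 else (a - 1) mod (q - 1) + 1)"

lemma reduce_exp_le: "reduce_exp a \<le> a"
proof (cases "a = 0")
  case False
  then show ?thesis
    using mod_less_eq_dividend[of "a - 1" "q - 1"] unfolding reduce_exp_def by (simp only: if_False)
qed (simp add: reduce_exp_def)

lemma reduce_exp_less: "reduce_exp a < q"
proof -
  have "(a - 1) mod (q - 1) < q - 1" using q_gt_1 by (intro mod_less_divisor) simp
  then show ?thesis using q_gt_1 unfolding reduce_exp_def by (split if_split) linarith
qed

lemma power_reduce_exp:
  assumes "t \<in> Tq q"
  shows "t ^ reduce_exp a = (t ^ a :: 'a)"
proof (cases "a = 0 \<or> t = 0")
  case True
  then show ?thesis by (auto simp: reduce_exp_def)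
next
  case False
  then have t1: "t ^ (q - 1) = 1" using assms by (auto simp: Tq_def)
  have "a = (q - 1) * ((a - 1) div (q - 1)) + reduce_exp a"
    using False by (simp add: reduce_exp_def)
  then have "t ^ a = (t ^ (q - 1)) ^ ((a - 1) div (q - 1)) * t ^ reduce_exp a"
    by (metis power_add power_mult)
  then show ?thesis by (simp only: t1 power_one mult_1)
qed

lemma poly_fun_mono:
  assumes "(\<Sum>i<n. a i) \<le> D"
  shows "poly_fun n D (mono_fun n a)"
proof -
  define b where "b = restrict (\<lambda>i. reduce_exp (a i)) {..<n}"
  have "(\<Sum>i<n. b i) \<le> (\<Sum>i<n. a i)" by (intro sum_mono) (auto simp: b_def reduce_exp_le)
  then have b: "b \<in> expos n D" using assms by (auto simp: expos_def b_def reduce_exp_less)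
  have "poly_rep n D (\<lambda>e. if e = b then 1 else 0) (mono_fun n a)"
    unfolding poly_rep_def
  proof
    fix x assume x: "x \<in> teich_box n"
    have "(\<Sum>e\<in>expos n D. (if e = b then 1 else 0) * mono_fun n e x) =
        (\<Sum>e\<in>expos n D. if e = b then mono_fun n b x else 0)"
      by (intro sum.cong) auto
    also have "\<dots> = mono_fun n b x" using b finite_expos by simp
    also have "\<dots> = mono_fun n a x"
      unfolding mono_fun_def b_def by (intro prod.cong) (auto simp: power_reduce_exp teich_box_Tq[OF x])
    finally show "mono_fun n a x = (\<Sum>e\<in>expos n D. (if e = b then 1 else 0) * mono_fun n e x)" ..
  qed
  then show ?thesis unfolding poly_fun_def by blast
qed

lemma mono_fun_mult: "mono_fun n a x * mono_fun n b x = mono_fun n (\<lambda>i. a i + b i) x"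
  by (simp add: mono_fun_def power_add prod.distrib)

lemma poly_fun_mult:
  assumes "poly_fun n D G" "poly_fun n D' H"
  shows "poly_fun n (D + D') (\<lambda>x. G x * H x)"
proof -
  obtain c c' where cc: "poly_rep n D c G" "poly_rep n D' c' H" using assms unfolding poly_fun_def by blast
  have "poly_fun n (D + D') (\<lambda>x. \<Sum>e\<in>expos n D. \<Sum>e'\<in>expos n D'.
      (c e * c' e') * mono_fun n (\<lambda>i. e i + e' i) x)"
    by (intro poly_fun_sum poly_fun_scale poly_fun_mono) (auto simp: expos_def sum.distrib intro: add_mono)
  then show ?thesis
  proof (rule poly_fun_cong)
    fix x assume x: "x \<in> teich_box n"
    have "G x * H x = (\<Sum>e\<in>expos n D. \<Sum>e'\<in>expos n D'. (c e * mono_fun n e x) * (c' e' * mono_fun n e' x))"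
      using cc x by (simp add: poly_rep_def sum_product)
    also have "\<dots> = (\<Sum>e\<in>expos n D. \<Sum>e'\<in>expos n D'. (c e * c' e') * mono_fun n (\<lambda>i. e i + e' i) x)"
      unfolding mono_fun_mult[symmetric] by (simp add: mult_ac)
    finally show "(\<Sum>e\<in>expos n D. \<Sum>e'\<in>expos n D'. (c e * c' e') * mono_fun n (\<lambda>i. e i + e' i) x) = G x * H x" ..
  qed
qed

lemma poly_fun_1: "poly_fun n 0 (\<lambda>x. 1)"
  using poly_fun_mono[of "\<lambda>_. 0" n 0] by (simp add: mono_fun_def[abs_def])

lemma poly_fun_power: "poly_fun n D G \<Longrightarrow> poly_fun n (k * D) (\<lambda>x. G x ^ k)"
proof (induction k)
  case (Suc k)
  then show ?case using poly_fun_mult[of n D G "k * D" "\<lambda>x. G x ^ k"] by simp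
qed (simp add: poly_fun_1)

text \<open>For \<open>j < q\<close> this is the coefficient of \<open>X ^ j\<close> in the Lagrange
  polynomial that is 1 at \<open>t\<close> and 0 on the rest of \<open>Tq q\<close>. At
  \<open>t = 0\<close> that polynomial is \<open>1 - X ^ (q - 1)\<close>; subtracting
  \<open>q\<close> corrects the value \<open>0 ^ 0 = 1\<close> there.\<close>

definition dual :: "'a \<Rightarrow> nat \<Rightarrow> 'a" where
  "dual t j = (if j = 0 then (if t = 0 then 1 else 0)
     else (t ^ (q - 1 - j) - (if t = 0 \<and> j = q - 1 then of_nat q else 0)) / of_nat (q - 1))"

lemma sum_dual:
  assumes "j < q" "j' < q"
  shows "(\<Sum>t\<in>Tq q. t ^ j' * dual t j) = (if j' = j then 1 else 0)"
proof (cases "j = 0")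
  case True
  have "(\<Sum>t\<in>Tq q. t ^ j' * dual t j) = (\<Sum>t\<in>Tq q. if t = (0::'a) then 0 ^ j' else 0)"
    using True by (intro sum.cong) (auto simp: dual_def)
  then show ?thesis using True finite_Tq by (simp add: power_0_left)
next
  case False
  have q1: "(of_nat (q - 1) :: 'a) \<noteq> 0" using q_gt_1 by simp
  have "(\<Sum>t\<in>Tq q. t ^ j' * dual t j) =
      (\<Sum>t\<in>Tq q. (t ^ (j' + (q - 1 - j)) - (if t = 0 then (if j = q - 1 then 0 ^ j' * of_nat q else 0) else 0)) / of_nat (q - 1))"
    using False by (intro sum.cong) (auto simp: dual_def power_add algebra_simps)
  also have "\<dots> = ((\<Sum>t\<in>Tq q. t ^ (j' + (q - 1 - j))) - (if j = q - 1 then 0 ^ j' * of_nat q else 0)) / of_nat (q - 1)"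
    using finite_Tq by (simp add: sum_divide_distrib[symmetric] sum_subtractf)
  also have "\<dots> = (if j' = j then 1 else 0)"
  proof (cases "j' + (q - 1 - j) = 0")
    case True
    then have "j' = 0" "j = q - 1" using assms by auto
    then show ?thesis using False unfolding sum_Tq_power by simp
  next
    case nz: False
    \<comment> \<open>The exponent lies strictly between 0 and \<open>2 * (q - 1)\<close>, so
      \<open>q - 1\<close> is its only possible value among the multiples.\<close>
    have dvd: "(q - 1) dvd (j' + (q - 1 - j)) \<longleftrightarrow> j' + (q - 1 - j) = q - 1"
    proof
      assume "(q - 1) dvd (j' + (q - 1 - j))"
      then obtain k where k: "j' + (q - 1 - j) = (q - 1) * k" by auto
      moreover have "j' + (q - 1 - j) < (q - 1) * 2" using assms False by linarith
      ultimately have "k < 2" "k \<noteq> 0" using nz by auto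
      then have "k = 1" by simp
      then show "j' + (q - 1 - j) = q - 1" using k by simp
    qed auto
    have "j' + (q - 1 - j) = q - 1 \<longleftrightarrow> j' = j" using assms by auto
    moreover have "j = q - 1 \<Longrightarrow> j' \<noteq> 0" using nz by auto
    ultimately show ?thesis
      unfolding sum_Tq_power dvd using nz q1 False by (auto simp: power_0_left)
  qed
  finally show ?thesis .
qed

text \<open>The only denominator is \<open>q - 1\<close>, a unit because \<open>p\<close> divides
  \<open>q\<close>.\<close>

lemma absval_dual_le_1:
  assumes "t \<in> Tq q"
  shows "absval (dual t j) \<le> 1"
proof -
  have "\<not> p dvd (q - 1)"
  proof
    assume *: "p dvd (q - 1)"
    have "p dvd q" using h_pos by (simp add: q_eq)
    then have "p dvd q - (q - 1)" using * by (rule dvd_diff_nat)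
    then show False using p_gt_1 q_gt_1 by simp
  qed
  then have "absval (of_nat (q - 1) :: 'a) = 1" by (rule absval_of_nat_coprime)
  moreover have "absval (t ^ (q - 1 - j) - (if t = 0 \<and> j = q - 1 then of_nat q else 0)) \<le> 1"
    using Tq_absval_le_1[OF Tq_power[OF assms]] absval_of_nat_le_1 by (intro absval_diff_le) auto
  ultimately show ?thesis by (simp add: dual_def absval_divide del: of_nat_diff)
qed

text \<open>Pairing \<open>G\<close> with the product of the one-variable dual functions isolates
  \<open>c e\<close>, and these functions have integral values.\<close>

lemma poly_rep_integral:
  assumes rep: "poly_rep n D c G" and int: "\<And>x. x \<in> teich_box n \<Longrightarrow> absval (G x) \<le> 1" and e: "e \<in> expos n D"
  shows "absval (c e) \<le> 1"
proof -
  have "(\<Sum>x\<in>teich_box n. G x * (\<Prod>i<n. dual (x i) (e i))) =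
      (\<Sum>x\<in>teich_box n. \<Sum>e'\<in>expos n D. c e' * (\<Prod>i<n. x i ^ e' i * dual (x i) (e i)))"
    using rep by (intro sum.cong) (auto simp: poly_rep_def sum_distrib_right mono_fun_def prod.distrib mult.assoc)
  also have "\<dots> = (\<Sum>e'\<in>expos n D. \<Sum>x\<in>teich_box n. c e' * (\<Prod>i<n. x i ^ e' i * dual (x i) (e i)))"
    by (rule sum.swap)
  also have "\<dots> = (\<Sum>e'\<in>expos n D. c e' * (\<Prod>i<n. \<Sum>t\<in>Tq q. t ^ e' i * dual t (e i)))"
    unfolding teich_box_def using finite_Tq by (subst prod_sum_PiE) (auto simp: sum_distrib_left)
  also have "\<dots> = (\<Sum>e'\<in>expos n D. if e' = e then c e else 0)"
  proof (rule sum.cong[OF refl])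
    fix e' assume e': "e' \<in> expos n D"
    have "(\<Prod>i<n. \<Sum>t\<in>Tq q. t ^ e' i * dual t (e i)) = (\<Prod>i<n. if e' i = e i then 1 else 0)"
      using e e' by (intro prod.cong sum_dual) (auto simp: expos_def)
    also have "\<dots> = (if \<forall>i<n. e' i = e i then 1 else 0)"
      by (auto simp: prod_zero_iff)
    also have "(\<forall>i<n. e' i = e i) \<longleftrightarrow> e' = e"
      using e e' by (auto simp: expos_def intro: PiE_ext)
    finally show "c e' * (\<Prod>i<n. \<Sum>t\<in>Tq q. t ^ e' i * dual t (e i)) = (if e' = e then c e else 0)"
      by simp
  qed
  also have "\<dots> = c e" using e finite_expos by simp
  finally have "c e = (\<Sum>x\<in>teich_box n. G x * (\<Prod>i<n. dual (x i) (e i)))" ..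
  also have "absval \<dots> \<le> 1"
    using int by (intro absval_sum_le)
      (auto simp: absval_mult absval_prod intro!: mult_le_one prod_le_1 prod_nonneg absval_dual_le_1 teich_box_Tq)
  finally show ?thesis .
qed

section \<open>Witt coordinates\<close>

text \<open>
  The Witt coordinates determined by the ghost components \<open>\<Phi>\<close>:
  \<open>\<Phi> k = (\<Sum>i\<le>k. p ^ i * witt_coord \<Phi> i ^ (p ^ (k - i)))\<close>.
\<close>

fun witt_coord :: "(nat \<Rightarrow> 'a) \<Rightarrow> nat \<Rightarrow> 'a" where
  "witt_coord \<Phi> k = (\<Phi> k - (\<Sum>i<k. of_nat p ^ i * witt_coord \<Phi> i ^ (p ^ (k - i)))) / of_nat p ^ k"

declare witt_coord.simps [simp del]

text \<open>The recursion is isobaric: raising the \<open>i\<close>-th coordinate to the power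
  \<open>p ^ (k - i)\<close> turns degree \<open>d * p ^ i\<close> into
  \<open>d * p ^ k\<close>.\<close>

lemma poly_fun_witt_coord:
  assumes "\<And>j. j \<le> k \<Longrightarrow> poly_fun n (d * p ^ j) (\<lambda>x. \<Phi> x j)"
  shows "poly_fun n (d * p ^ k) (\<lambda>x. witt_coord (\<Phi> x) k)"
  using assms
proof (induction k rule: less_induct)
  case (less k)
  have "poly_fun n (d * p ^ k) (\<lambda>x. witt_coord (\<Phi> x) i ^ (p ^ (k - i)))" if "i < k" for i
  proof -
    have "p ^ (k - i) * (d * p ^ i) = d * p ^ k"
      using that by (simp add: mult.left_commute flip: power_add)
    moreover have "poly_fun n (p ^ (k - i) * (d * p ^ i)) (\<lambda>x. witt_coord (\<Phi> x) i ^ (p ^ (k - i)))"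
      using that by (intro poly_fun_power less.IH less.prems) auto
    ultimately show ?thesis by (simp only:)
  qed
  then have "poly_fun n (d * p ^ k) (\<lambda>x. 1 / of_nat p ^ k *
     (\<Phi> x k + (\<Sum>i<k. (- (of_nat p ^ i)) * witt_coord (\<Phi> x) i ^ (p ^ (k - i)))))"
    by (intro poly_fun_scale poly_fun_add poly_fun_sum less.prems) auto
  then show ?case
    by (rule poly_fun_cong) (simp add: witt_coord.simps[of _ k] sum_negf)
qed

lemma absval_p_power: "absval (of_nat p ^ k :: 'a) = (1 / real p) ^ k"
  by (simp add: absval_power absval_p)

text \<open>The sums in the hypothesis are the ghost components of the coordinates
  \<open>\<tau> i ^ (p ^ i)\<close>. By induction the coordinates agree modulo \<open>p\<close>; an
  error divisible by \<open>p\<close> in the \<open>i\<close>-th one gains \<open>k - i\<close>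
  factors from its power and \<open>i\<close> from its coefficient, so it disappears modulo
  \<open>p ^ (k + 1)\<close>.\<close>

lemma witt_coord_digits:
  assumes \<tau>: "\<And>i. i < m \<Longrightarrow> \<tau> i \<in> Tq q"
    and \<Phi>: "\<And>k. k < m \<Longrightarrow> absval (\<Phi> k - (\<Sum>i\<le>k. of_nat p ^ i * \<tau> i ^ (p ^ k))) \<le> (1 / real p) ^ Suc k"
    and k: "k < m"
  shows "absval (witt_coord \<Phi> k - \<tau> k ^ (p ^ k)) \<le> 1 / real p"
  using k
proof (induction k rule: less_induct)
  case (less k)
  let ?w = "witt_coord \<Phi>"
  have "of_nat p ^ k * ?w k = \<Phi> k - (\<Sum>i<k. of_nat p ^ i * ?w i ^ (p ^ (k - i)))"
    by (simp add: witt_coord.simps[of \<Phi> k])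
  moreover have "(\<Sum>i\<le>k. of_nat p ^ i * \<tau> i ^ (p ^ k)) =
      (\<Sum>i<k. of_nat p ^ i * \<tau> i ^ (p ^ k)) + of_nat p ^ k * \<tau> k ^ (p ^ k)"
    by (simp flip: lessThan_Suc_atMost)
  ultimately have eq: "of_nat p ^ k * (?w k - \<tau> k ^ (p ^ k)) =
      (\<Phi> k - (\<Sum>i\<le>k. of_nat p ^ i * \<tau> i ^ (p ^ k)))
      - (\<Sum>i<k. of_nat p ^ i * (?w i ^ (p ^ (k - i)) - \<tau> i ^ (p ^ k)))"
    by (simp add: right_diff_distrib sum_subtractf)
  have "absval (of_nat p ^ i * (?w i ^ (p ^ (k - i)) - \<tau> i ^ (p ^ k))) \<le> (1 / real p) ^ Suc k" if i: "i < k" for i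
  proof -
    have IH: "absval (?w i - \<tau> i ^ (p ^ i)) \<le> (1 / real p) ^ Suc 0"
      using less.IH[OF i] less.prems i by simp
    have t1: "absval (\<tau> i ^ (p ^ i)) \<le> 1"
      using \<tau>[of i] less.prems i by (intro Tq_absval_le_1 Tq_power) simp
    have "absval (?w i - \<tau> i ^ (p ^ i)) \<le> 1" using IH inverse_p_less_1 by simp
    from absval_add_le[OF this t1] have w1: "absval (?w i) \<le> 1" by simp
    have "absval (?w i ^ (p ^ (k - i)) - (\<tau> i ^ (p ^ i)) ^ (p ^ (k - i))) \<le> (1 / real p) ^ Suc (0 + (k - i))"
      by (rule absval_power_p_power_diff_le[OF w1 t1 IH])
    moreover have "(\<tau> i ^ (p ^ i)) ^ (p ^ (k - i)) = \<tau> i ^ (p ^ k)"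
      using i by (simp flip: power_mult power_add)
    ultimately have "(1 / real p) ^ i * absval (?w i ^ (p ^ (k - i)) - \<tau> i ^ (p ^ k))
        \<le> (1 / real p) ^ i * (1 / real p) ^ Suc (k - i)"
      by (intro mult_left_mono) auto
    also have "\<dots> = (1 / real p) ^ Suc k" using i by (simp flip: power_add)
    finally show ?thesis by (simp only: absval_mult absval_p_power)
  qed
  then have "absval (\<Sum>i<k. of_nat p ^ i * (?w i ^ (p ^ (k - i)) - \<tau> i ^ (p ^ k))) \<le> (1 / real p) ^ Suc k"
    by (intro absval_sum_le) auto
  then have "absval (of_nat p ^ k * (?w k - \<tau> k ^ (p ^ k))) \<le> (1 / real p) ^ Suc k"
    unfolding eq by (intro absval_diff_le \<Phi> less.prems)
  then have "(1 / real p) ^ k * absval (?w k - \<tau> k ^ (p ^ k)) \<le> (1 / real p) ^ k * (1 / real p)"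
    by (simp only: absval_mult absval_p_power power_Suc2)
  then show ?case
    using p_gt_1 by (subst (asm) mult_le_cancel_left_pos) auto
qed

section \<open>Teichmueller digits and their comparison with Witt coordinates\<close>

lemma Teichmueller_digits:
  assumes "absval y \<le> (1::real)"
  shows "\<exists>\<tau>. (\<forall>i. \<tau> i \<in> Tq q) \<and> absval (y - (\<Sum>i<m. of_nat p ^ i * \<tau> i) :: 'a) \<le> (1 / real p) ^ m"
  using assms
proof (induction m arbitrary: y)
  case 0
  then show ?case by (intro exI[of _ "\<lambda>_. 0"]) auto
next
  case (Suc m)
  obtain t where t: "t \<in> Tq q" "absval (y - t) < 1" using Teichmueller_ex[OF Suc.prems] .
  define z where "z = (y - t) / of_nat p"
  have "absval z \<le> 1"
    using absval_less_1[OF t(2)] p_gt_1 by (simp add: z_def absval_divide absval_p field_simps)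
  from Suc.IH[OF this] obtain \<tau> where \<tau>: "\<And>i. \<tau> i \<in> Tq q"
    "absval (z - (\<Sum>i<m. of_nat p ^ i * \<tau> i)) \<le> (1 / real p) ^ m" by blast
  have "y - t = of_nat p * z" by (simp add: z_def)
  moreover have "(\<Sum>i<Suc m. of_nat p ^ i * case_nat t \<tau> i) = t + of_nat p * (\<Sum>i<m. of_nat p ^ i * \<tau> i)"
    unfolding sum.lessThan_Suc_shift by (simp add: sum_distrib_left mult.assoc)
  ultimately have "y - (\<Sum>i<Suc m. of_nat p ^ i * case_nat t \<tau> i) = of_nat p * (z - (\<Sum>i<m. of_nat p ^ i * \<tau> i))"
    by (simp add: right_diff_distrib diff_diff_eq[symmetric])
  then have "absval (y - (\<Sum>i<Suc m. of_nat p ^ i * case_nat t \<tau> i)) \<le> (1 / real p) ^ Suc m"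
    using mult_left_mono[OF \<tau>(2), of "1 / real p"] by (simp only: absval_mult absval_p power_Suc) simp
  moreover have "\<forall>i. case_nat t \<tau> i \<in> Tq q" using t(1) \<tau>(1) by (auto split: nat.split)
  ultimately show ?case by blast
qed

lemma Teichmueller_digits_zero:
  assumes "\<And>i. \<tau> i \<in> Tq q" "absval (\<Sum>i<m. of_nat p ^ i * \<tau> i :: 'a) \<le> (1 / real p) ^ m" "i < m"
  shows "\<tau> i = 0"
  using assms(2,3)
proof (induction m arbitrary: i)
  case (Suc m)
  let ?S = "\<Sum>i<m. of_nat p ^ i * \<tau> i"
  have "(1 / real p) ^ Suc m \<le> (1 / real p) ^ m"
    using inverse_p_less_1 by (intro power_decreasing) auto
  then have "absval (?S + of_nat p ^ m * \<tau> m) \<le> (1 / real p) ^ m"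
    using Suc.prems(1) by simp
  moreover have "absval (of_nat p ^ m * \<tau> m) \<le> (1 / real p) ^ m"
    unfolding absval_mult absval_p_power using Tq_absval_le_1[OF assms(1)[of m]]
    by (intro mult_right_le_one_le) auto
  ultimately have "absval ?S \<le> (1 / real p) ^ m"
    using absval_diff_le[of "?S + of_nat p ^ m * \<tau> m" _ "of_nat p ^ m * \<tau> m"] by simp
  then have z: "\<tau> i = 0" if "i < m" for i using Suc.IH that by blast
  then have "absval (of_nat p ^ m * \<tau> m) \<le> (1 / real p) ^ m * (1 / real p)"
    using Suc.prems(1) by (simp add: mult.commute)
  then have "absval (\<tau> m) \<le> 1 / real p"
    unfolding absval_mult absval_p_power using p_gt_1 by (subst (asm) mult_le_cancel_left_pos) auto
  then have "absval (\<tau> m) < 1" using inverse_p_less_1 by simp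
  then have "\<tau> m = 0" using Tq_absval[OF assms(1), of m] by auto
  then show ?case using z Suc.prems(2) by (auto simp: less_Suc_eq)
qed simp

lemma absval_truncate:
  assumes "\<And>i. i < m \<Longrightarrow> absval (g i :: 'a) \<le> 1" "k \<le> m"
  shows "absval ((\<Sum>i<m. of_nat p ^ i * g i) - (\<Sum>i<k. of_nat p ^ i * g i)) \<le> (1 / real p) ^ k"
proof -
  have "{..<m} = {..<k} \<union> {k..<m}" using assms(2) by auto
  then have "(\<Sum>i<m. of_nat p ^ i * g i) = (\<Sum>i<k. of_nat p ^ i * g i) + (\<Sum>i\<in>{k..<m}. of_nat p ^ i * g i)"
    by (simp add: sum.union_disjoint ivl_disj_int)
  moreover have "absval (\<Sum>i\<in>{k..<m}. of_nat p ^ i * g i) \<le> (1 / real p) ^ k"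
  proof (rule absval_sum_le)
    fix i assume i: "i \<in> {k..<m}"
    have "absval (of_nat p ^ i * g i) \<le> (1 / real p) ^ i"
      unfolding absval_mult absval_p_power using assms(1)[of i] i
      by (intro mult_right_le_one_le) auto
    also have "\<dots> \<le> (1 / real p) ^ k"
      using i inverse_p_less_1 by (intro power_decreasing) auto
    finally show "absval (of_nat p ^ i * g i) \<le> (1 / real p) ^ k" .
  qed simp
  ultimately show ?thesis by simp
qed

lemma Tq_power_q_power: "t \<in> Tq q \<Longrightarrow> t ^ (q ^ a) = (t::'a)"
  by (induction a) (auto simp: power_mult Tq_power_q)

text \<open>The unknown digits \<tau> and the given terms are two expressions for one number modulo
  \<open>p ^ m\<close>. Lifting \<open>t\<close> to \<open>t ^ (p ^ k)\<close> preserves this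
  congruence, so both have the same ghost components to the precision required by
  \<open>witt_coord_digits\<close>.\<close>

lemma witt_coord_Teichmueller_sum:
  fixes I :: "nat \<Rightarrow> 'b set" and t :: "nat \<Rightarrow> 'b \<Rightarrow> 'a"
  assumes t: "\<And>i \<mu>. i < m \<Longrightarrow> \<mu> \<in> I i \<Longrightarrow> t i \<mu> \<in> Tq q"
    and \<Phi>: "\<And>k. k < m \<Longrightarrow> \<Phi> k = (\<Sum>i\<le>k. of_nat p ^ i * (\<Sum>\<mu>\<in>I i. t i \<mu> ^ (p ^ (k - h * (i div h)))))"
  shows "k < m \<Longrightarrow> absval (witt_coord \<Phi> k) \<le> 1"
    and "absval (\<Sum>i<m. of_nat p ^ i * (\<Sum>\<mu>\<in>I i. t i \<mu>)) \<le> (1 / real p) ^ m \<longleftrightarrow>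
      (\<forall>k<m. absval (witt_coord \<Phi> k) < 1)"
proof -
  let ?y = "\<Sum>i<m. of_nat p ^ i * (\<Sum>\<mu>\<in>I i. t i \<mu>)"
  have "absval ?y \<le> 1"
    using absval_truncate[of m "\<lambda>i. \<Sum>\<mu>\<in>I i. t i \<mu>" 0] by (simp add: absval_sum_le Tq_absval_le_1 t)
  from Teichmueller_digits[OF this] obtain \<tau> where \<tau>: "\<And>i. \<tau> i \<in> Tq q"
    and y: "absval (?y - (\<Sum>i<m. of_nat p ^ i * \<tau> i)) \<le> (1 / real p) ^ m" by blast
  have ghost: "absval (\<Phi> k - (\<Sum>i\<le>k. of_nat p ^ i * \<tau> i ^ (p ^ k))) \<le> (1 / real p) ^ Suc k" if k: "k < m" for k
  proof -
    let ?A = "\<lambda>n. \<Sum>i<n. of_nat p ^ i * (\<Sum>\<mu>\<in>I i. t i \<mu> ^ (p ^ k))"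
    let ?B = "\<lambda>n. \<Sum>i<n. of_nat p ^ i * \<tau> i ^ (p ^ k)"
    have "t i \<mu> ^ (p ^ (k - h * (i div h))) = t i \<mu> ^ (p ^ k)" if "i \<le> k" "\<mu> \<in> I i" for i \<mu>
    proof -
      have "h * (i div h) \<le> k" using that(1) times_div_less_eq_dividend[of h i] by linarith
      \<comment> \<open>The missing part of the exponent is a power of \<open>q\<close>, which fixes
        \<open>t\<close>; this is why the ghost components may use the smaller exponent that keeps
        degrees low.\<close>
      then have "p ^ k = q ^ (i div h) * p ^ (k - h * (i div h))"
        by (simp add: q_eq flip: power_mult power_add)
      then show ?thesis
        using that k Tq_power_q_power[OF t, of i \<mu> "i div h"] by (simp add: power_mult)
    qed
    then have \<Phi>k: "\<Phi> k = ?A (Suc k)"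
      unfolding \<Phi>[OF k] lessThan_Suc_atMost by (intro sum.cong arg_cong2[of _ _ _ _ "(*)"]) auto
    have "frob_pair (p ^ k) (of_nat p ^ i) (of_nat p ^ i)" for i
      by (intro frob_pair_power frob_pair_of_nat)
    then have "frob_pair (p ^ k) (?y - (\<Sum>i<m. of_nat p ^ i * \<tau> i)) (?A m - ?B m)"
      using t by (intro frob_pair_diff frob_pair_sum frob_pair_mult frob_pair_Tq \<tau>) auto
    from frob_pair_absval_le[OF this y] have AB: "absval (?A m - ?B m) \<le> (1 / real p) ^ Suc k"
      using k inverse_p_less_1 power_decreasing[of "Suc k" m "1 / real p"] by simp
    \<comment> \<open>Terms of index above \<open>k\<close> are divisible by
      \<open>p ^ (k + 1)\<close>, so both sides can be cut off after index \<open>k\<close>.\<close>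
    have A: "absval (?A m - ?A (Suc k)) \<le> (1 / real p) ^ Suc k"
      using k t by (intro absval_truncate absval_sum_le Tq_absval_le_1 Tq_power) auto
    have B: "absval (?B m - ?B (Suc k)) \<le> (1 / real p) ^ Suc k"
      using k \<tau> by (intro absval_truncate Tq_absval_le_1 Tq_power) auto
    have "absval (?A m - ?B m - (?A m - ?A (Suc k)) + (?B m - ?B (Suc k))) \<le> (1 / real p) ^ Suc k"
      by (intro absval_add_le absval_diff_le AB A B)
    then show ?thesis unfolding \<Phi>k by (simp add: lessThan_Suc_atMost)
  qed
  have close: "absval (witt_coord \<Phi> k - \<tau> k ^ (p ^ k)) \<le> 1 / real p" if "k < m" for k
    using witt_coord_digits[of m \<tau> \<Phi> k] \<tau> ghost that by blast
  have \<tau>1: "absval (\<tau> k ^ (p ^ k)) \<le> 1" for k by (intro Tq_absval_le_1 Tq_power \<tau>)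
  show "absval (witt_coord \<Phi> k) \<le> 1" if "k < m"
    using absval_add_le[of "witt_coord \<Phi> k - \<tau> k ^ (p ^ k)" 1 "\<tau> k ^ (p ^ k)"] close[OF that] \<tau>1 inverse_p_less_1
    by simp
  \<comment> \<open>A digit is either 0 or a unit, so its vanishing is visible modulo
    \<open>p\<close>, where the Witt coordinate is a power of the digit.\<close>
  have iff: "absval (witt_coord \<Phi> k) < 1 \<longleftrightarrow> \<tau> k = 0" if "k < m" for k
  proof
    assume "absval (witt_coord \<Phi> k) < 1"
    then have "absval (\<tau> k ^ (p ^ k)) < 1"
      using absval_diff_less[of "witt_coord \<Phi> k" 1 "witt_coord \<Phi> k - \<tau> k ^ (p ^ k)"] close[OF that] inverse_p_less_1
      by simp
    then show "\<tau> k = 0"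
      using Tq_absval[OF \<tau>, of k] by (cases "\<tau> k = 0") (auto simp: absval_power)
  next
    assume "\<tau> k = 0"
    moreover have "p ^ k > 0" using p_gt_1 by simp
    ultimately have "\<tau> k ^ (p ^ k) = 0" by (simp only: zero_power)
    from close[OF that, unfolded this] show "absval (witt_coord \<Phi> k) < 1" using inverse_p_less_1 by simp
  qed
  show "absval ?y \<le> (1 / real p) ^ m \<longleftrightarrow> (\<forall>k<m. absval (witt_coord \<Phi> k) < 1)"
  proof
    assume "absval ?y \<le> (1 / real p) ^ m"
    from absval_diff_le[OF this y] have "absval (\<Sum>i<m. of_nat p ^ i * \<tau> i) \<le> (1 / real p) ^ m" by simp
    then show "\<forall>k<m. absval (witt_coord \<Phi> k) < 1"
      using Teichmueller_digits_zero[of \<tau> m] \<tau> iff by blast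
  next
    assume "\<forall>k<m. absval (witt_coord \<Phi> k) < 1"
    then have "(\<Sum>i<m. of_nat p ^ i * \<tau> i) = 0" using iff by simp
    then show "absval ?y \<le> (1 / real p) ^ m" using y by simp
  qed
qed

end

section \<open>Counting zeros\<close>

definition weak_compositions :: "'b set \<Rightarrow> nat \<Rightarrow> ('b \<Rightarrow> nat) set" where
  "weak_compositions E M = {u \<in> E \<rightarrow>\<^sub>E UNIV. sum u E = M}"

lemma finite_weak_compositions:
  assumes "finite E"
  shows "finite (weak_compositions E M)"
proof (rule finite_subset)
  show "weak_compositions E M \<subseteq> E \<rightarrow>\<^sub>E {..M}"
    using assms by (auto simp: weak_compositions_def PiE_iff extensional_def intro: member_le_sum)
  show "finite (E \<rightarrow>\<^sub>E {..M})" using assms by (intro finite_PiE) auto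
qed

lemma multinomial_theorem:
  fixes a :: "'b \<Rightarrow> 'c :: field_char_0"
  assumes "finite E"
  shows "(\<Sum>e\<in>E. a e) ^ M =
    (\<Sum>u\<in>weak_compositions E M. fact M / (\<Prod>e\<in>E. fact (u e)) * (\<Prod>e\<in>E. a e ^ u e))"
proof -
  \<comment> \<open>With the factorials distributed over the factors the right side is a coefficient
    of a product of exponential series, which suits induction on \<open>E\<close>.\<close>
  have "(\<Sum>e\<in>E. a e) ^ M = fact M * (\<Sum>u\<in>weak_compositions E M. \<Prod>e\<in>E. a e ^ u e / fact (u e))"
    using assms
  proof (induction E arbitrary: M rule: finite_induct)
    case empty
    have "weak_compositions ({}::'b set) M = (if M = 0 then {\<lambda>_. undefined} else {})"
      by (auto simp: weak_compositions_def)
    then show ?case by (cases M) auto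
  next
    case (insert e E)
    let ?g = "\<lambda>E u. \<Prod>e\<in>E. a e ^ u e / fact (u e) :: 'c"
    \<comment> \<open>A composition is split into its value at \<open>e\<close> and the rest; the
      rest is reset to \<open>undefined\<close> at \<open>e\<close> to be extensional on
      \<open>E\<close>.\<close>
    have "(\<Sum>u\<in>weak_compositions (insert e E) M. ?g (insert e E) u) =
        (\<Sum>(j, v)\<in>(SIGMA j:{..M}. weak_compositions E (M - j)). a e ^ j / fact j * ?g E v)"
    proof (rule sum.reindex_bij_witness[where i = "\<lambda>(j, v). v(e := j)" and j = "\<lambda>u. (u e, u(e := undefined))"])
      fix u assume u: "u \<in> weak_compositions (insert e E) M"
      have s: "sum (u(e := undefined)) E = sum u E"
        using insert.hyps by (intro sum.cong) auto
      show "(case (u e, u(e := undefined)) of (j, v) \<Rightarrow> v(e := j)) = u" by simp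
      show "(u e, u(e := undefined)) \<in> (SIGMA j:{..M}. weak_compositions E (M - j))"
        using u insert.hyps s by (auto simp: weak_compositions_def PiE_iff extensional_def)
      have "?g E (u(e := undefined)) = ?g E u"
        using insert.hyps by (intro prod.cong) auto
      then show "(case (u e, u(e := undefined)) of (j, v) \<Rightarrow> a e ^ j / fact j * ?g E v) = ?g (insert e E) u"
        using insert.hyps by simp
    next
      fix jv assume "jv \<in> (SIGMA j:{..M}. weak_compositions E (M - j))"
      then obtain j v where jv: "jv = (j, v)" "j \<le> M" "v \<in> weak_compositions E (M - j)" by auto
      have s: "sum (v(e := j)) E = sum v E"
        using insert.hyps by (intro sum.cong) auto
      show "(\<lambda>u. (u e, u(e := undefined))) (case jv of (j, v) \<Rightarrow> v(e := j)) = jv"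
        using jv insert.hyps by (auto simp: weak_compositions_def PiE_iff extensional_def)
      show "(case jv of (j, v) \<Rightarrow> v(e := j)) \<in> weak_compositions (insert e E) M"
        using jv insert.hyps s by (auto simp: weak_compositions_def PiE_iff extensional_def)
    qed
    also have "\<dots> = (\<Sum>j\<le>M. \<Sum>v\<in>weak_compositions E (M - j). a e ^ j / fact j * ?g E v)"
      by (rule sum.Sigma[symmetric]) (auto intro: finite_weak_compositions insert.hyps)
    also have "\<dots> = (\<Sum>j\<le>M. a e ^ j / fact j * (sum a E ^ (M - j) / fact (M - j)))"
    proof -
      have "sum a E ^ i / fact i = (\<Sum>v\<in>weak_compositions E i. ?g E v)" for i
        by (simp add: insert.IH)
      then show ?thesis by (simp only: sum_distrib_left)
    qed
    finally have eq: "(\<Sum>u\<in>weak_compositions (insert e E) M. ?g (insert e E) u) =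
        (\<Sum>j\<le>M. a e ^ j / fact j * (sum a E ^ (M - j) / fact (M - j)))" .
    have "sum a (insert e E) ^ M = (\<Sum>j\<le>M. of_nat (M choose j) * a e ^ j * sum a E ^ (M - j))"
      using insert.hyps by (simp add: binomial_ring)
    also have "\<dots> = (\<Sum>j\<le>M. fact M * (a e ^ j / fact j * (sum a E ^ (M - j) / fact (M - j))))"
      by (intro sum.cong) (auto simp: binomial_fact)
    finally show ?case unfolding eq by (simp add: sum_distrib_left)
  qed
  then show ?thesis
    by (simp add: sum_distrib_left prod_dividef)
qed

section \<open>The Ax--Katz estimate\<close>

context unramified
begin

text \<open>For \<open>y\<close> divisible by \<open>p\<close> the power is divisible by
  \<open>p ^ (h * N)\<close> since the exponent is that large. For a unit,
  \<open>y ^ (q - 1)\<close> is 1 modulo \<open>p\<close>, and each of the \<open>h * N\<close>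
  further \<open>p\<close>-th powers gains one factor \<open>p\<close>.\<close>

lemma absval_indicator:
  fixes y :: 'a
  assumes "absval y \<le> 1"
  shows "absval ((if absval y < 1 then 1 else 0) - (1 - y ^ ((q - 1) * q ^ N))) \<le> (1 / real p) ^ (h * N)"
proof (cases "absval y < 1")
  case True
  have "h * N \<le> (q - 1) * q ^ N"
  proof -
    have "h * N < 2 ^ (h * N)" by (rule less_exp)
    also have "\<dots> \<le> q ^ N" using p_gt_1 by (simp add: q_eq power_mono flip: power_mult)
    also have "\<dots> \<le> (q - 1) * q ^ N" using q_gt_1 by simp
    finally show ?thesis by simp
  qed
  have "absval (y ^ ((q - 1) * q ^ N)) \<le> (1 / real p) ^ ((q - 1) * q ^ N)"
    unfolding absval_power using absval_less_1[OF True] by (intro power_mono) auto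
  also have "\<dots> \<le> (1 / real p) ^ (h * N)"
    using inverse_p_less_1 by (intro power_decreasing \<open>h * N \<le> _\<close>) auto
  finally show ?thesis using True by simp
next
  case False
  then have y1: "absval y = 1" using assms by simp
  have "absval (y ^ (q - 1) - 1) \<le> (1 / real p) ^ Suc 0"
    using absval_less_1[OF absval_power_q_minus_1[OF y1]] by simp
  from absval_power_p_power_diff_le[OF _ _ this, of "h * N"]
  have "absval ((y ^ (q - 1)) ^ (p ^ (h * N)) - 1) \<le> (1 / real p) ^ Suc (h * N)"
    by (simp add: absval_power y1)
  also have "\<dots> \<le> (1 / real p) ^ (h * N)"
    using inverse_p_less_1 by (intro power_decreasing) auto
  also have "(y ^ (q - 1)) ^ (p ^ (h * N)) = y ^ ((q - 1) * q ^ N)"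
    by (simp add: q_eq flip: power_mult)
  finally show ?thesis using False by simp
qed

lemma sum_teich_box_mono: "(\<Sum>x\<in>teich_box n. mono_fun n s x) = (\<Prod>i<n. \<Sum>t\<in>Tq q. t ^ s i)"
  unfolding teich_box_def mono_fun_def using finite_Tq by (subst prod_sum_PiE) auto

lemma absval_fact: "absval (fact n :: 'a) = (1 / real p) ^ multiplicity p (fact n :: nat)"
  using absval_of_nat[of "fact n"] by simp

text \<open>The sum is a product of one-variable power sums; each variable with exponent 0
  contributes a factor \<open>q\<close>, that is \<open>p ^ h\<close>.\<close>

lemma absval_character_sum:
  "absval (\<Sum>x\<in>teich_box n. mono_fun n s x) \<le>
     (if \<forall>i<n. (q - 1) dvd s i then (1 / real p) ^ (h * card {i. i < n \<and> s i = 0}) else 0)"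
proof (cases "\<forall>i<n. (q - 1) dvd s i")
  case True
  have "absval (\<Sum>x\<in>teich_box n. mono_fun n s x) = (\<Prod>i<n. absval (\<Sum>t\<in>Tq q. t ^ s i :: 'a))"
    by (simp add: sum_teich_box_mono absval_prod)
  also have "\<dots> \<le> (\<Prod>i<n. if s i = 0 then (1 / real p) ^ h else 1)"
  proof (intro prod_mono conjI)
    fix i assume "i \<in> {..<n}"
    have "absval (of_nat q :: 'a) = (1 / real p) ^ h"
      by (simp add: q_eq absval_power absval_p)
    then show "absval (\<Sum>t\<in>Tq q. t ^ s i :: 'a) \<le> (if s i = 0 then (1 / real p) ^ h else 1)"
      unfolding sum_Tq_power using absval_of_nat_le_1[of "q - 1"] by auto
  qed simp
  also have "\<dots> = (1 / real p) ^ (h * card {i. i < n \<and> s i = 0})"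
  proof -
    have "{..<n} \<inter> {i. s i = 0} = {i. i < n \<and> s i = 0}" by auto
    then show ?thesis by (simp add: prod.If_cases power_mult)
  qed
  finally show ?thesis using True by simp
next
  case False
  then obtain i where i: "i < n" "\<not> (q - 1) dvd s i" by auto
  then have "(\<Sum>t\<in>Tq q. t ^ s i) = (0::'a)" unfolding sum_Tq_power by auto
  then have "(\<Prod>i<n. \<Sum>t\<in>Tq q. t ^ s i) = (0::'a)"
    using i(1) by (intro prod_zero) auto
  then have "(\<Sum>x\<in>teich_box n. mono_fun n s x) = 0" by (simp only: sum_teich_box_mono)
  then show ?thesis unfolding if_not_P[OF False] by simp
qed

lemma prod_mono_fun:
  assumes "finite S" "finite E"
  shows "(\<Prod>k\<in>S. \<Prod>e\<in>E. mono_fun n e x ^ u k e) = mono_fun n (\<lambda>i. \<Sum>k\<in>S. \<Sum>e\<in>E. u k e * e i) x"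
proof -
  have "(\<Prod>k\<in>S. \<Prod>e\<in>E. mono_fun n e x ^ u k e) = (\<Prod>k\<in>S. \<Prod>e\<in>E. \<Prod>i<n. x i ^ (u k e * e i))"
    by (simp add: mono_fun_def prod_power_distrib mult.commute flip: power_mult)
  also have "\<dots> = (\<Prod>k\<in>S. \<Prod>i<n. \<Prod>e\<in>E. x i ^ (u k e * e i))"
    by (intro prod.cong refl prod.swap)
  also have "\<dots> = (\<Prod>i<n. \<Prod>k\<in>S. \<Prod>e\<in>E. x i ^ (u k e * e i))"
    by (rule prod.swap)
  finally show ?thesis by (simp add: mono_fun_def power_sum)
qed

text \<open>In base \<open>p\<close> the number \<open>q - 1\<close> consists of \<open>h\<close>
  digits \<open>p - 1\<close>, and multiplying by \<open>q ^ N\<close> only appends zeros.\<close>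

lemma multiplicity_fact_exponent:
  "(p - 1) * multiplicity p (fact ((q - 1) * q ^ N) :: nat) + h * (p - 1) = (q - 1) * q ^ N"
proof -
  have "digit_sum p ((q - 1) * q ^ N) = digit_sum p (p ^ (h * N) * (p ^ h - 1))"
    by (simp add: q_eq power_mult mult.commute[of "p ^ h - Suc 0"])
  also have "\<dots> = h * (p - 1)"
    by (simp only: digit_sum_power_mult[OF p_gt_1] digit_sum_power_minus_1[OF p_gt_1])
  finally show ?thesis
    using multiplicity_fact_digit_sum[OF prime_p, of "(q - 1) * q ^ N"] by simp
qed

text \<open>Legendre's formula expresses the valuation of each multinomial coefficient by the digit
  sums of its parts less that of the exponent. The missing variables add \<open>h * r\<close>, and
  the total is what \<open>weight_bound\<close> estimates.\<close>

lemma absval_multinomial_term: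
  assumes S: "S \<subseteq> {..<m}" and m: "m \<ge> 1" and d: "d \<ge> 1" and E: "finite E"
    and u: "\<And>k. k \<in> S \<Longrightarrow> (\<Sum>e\<in>E. u k e) = (q - 1) * q ^ N"
    and c1: "\<And>k e. k \<in> S \<Longrightarrow> e \<in> E \<Longrightarrow> absval (c k e) \<le> 1"
    and c0: "\<And>k e. k \<in> S \<Longrightarrow> e \<in> E \<Longrightarrow> c k e \<noteq> 0 \<Longrightarrow> (\<Sum>i<n. e i) \<le> d * p ^ k"
    and B: "\<And>t. n \<le> d * p ^ (m - 1) * t + d * (\<Sum>k<m. p ^ k) \<Longrightarrow> B \<le> t"
  shows "absval (\<Sum>x\<in>teich_box n. \<Prod>k\<in>S. fact ((q - 1) * q ^ N) / (\<Prod>e\<in>E. fact (u k e)) *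
      (\<Prod>e\<in>E. (c k e * mono_fun n e x) ^ u k e) :: 'a) \<le> (1 / real p) ^ (h * B)"
proof -
  define M where "M = (q - 1) * q ^ N"
  define s where "s i = (\<Sum>k\<in>S. \<Sum>e\<in>E. u k e * e i)" for i
  define C where "C = (\<Prod>k\<in>S. fact M / (\<Prod>e\<in>E. fact (u k e)) * (\<Prod>e\<in>E. c k e ^ u k e) :: 'a)"
  have finS: "finite S" using S finite_subset by blast
  have "(\<Sum>x\<in>teich_box n. \<Prod>k\<in>S. fact M / (\<Prod>e\<in>E. fact (u k e)) * (\<Prod>e\<in>E. (c k e * mono_fun n e x) ^ u k e)) =
      (\<Sum>x\<in>teich_box n. C * mono_fun n s x)"
  proof (rule sum.cong[OF refl])
    fix x
    show "(\<Prod>k\<in>S. fact M / (\<Prod>e\<in>E. fact (u k e)) * (\<Prod>e\<in>E. (c k e * mono_fun n e x) ^ u k e)) = C * mono_fun n s x"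
      unfolding s_def prod_mono_fun[OF finS E, symmetric] C_def prod.distrib[symmetric] power_mult_distrib
      by (simp add: prod.distrib mult.assoc)
  qed
  also have "\<dots> = C * (\<Sum>x\<in>teich_box n. mono_fun n s x)" by (simp add: sum_distrib_left)
  finally have eq: "(\<Sum>x\<in>teich_box n. \<Prod>k\<in>S. fact M / (\<Prod>e\<in>E. fact (u k e)) *
      (\<Prod>e\<in>E. (c k e * mono_fun n e x) ^ u k e)) = C * (\<Sum>x\<in>teich_box n. mono_fun n s x)" .
  show ?thesis
  proof (cases "(\<forall>i<n. (q - 1) dvd s i) \<and> (\<forall>k\<in>S. \<forall>e\<in>E. u k e > 0 \<longrightarrow> c k e \<noteq> 0)")
    case False
    \<comment> \<open>Either a power sum vanishes or a zero coefficient is raised to a positive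
      power. In the remaining case the divisibility and degree hypotheses of
      \<open>weight_bound\<close> are available.\<close>
    have zero: "C * (\<Sum>x\<in>teich_box n. mono_fun n s x) = 0"
    proof (cases "\<forall>i<n. (q - 1) dvd s i")
      case True
      then obtain k e where "k \<in> S" "e \<in> E" "c k e ^ u k e = 0" using False by force
      then have "C = 0" unfolding C_def using E finS by (force simp: prod_zero_iff)
      then show ?thesis by simp
    next
      case False
      have "absval (\<Sum>x\<in>teich_box n. mono_fun n s x) \<le> 0"
        using absval_character_sum[of n s] unfolding if_not_P[OF False] .
      then have "absval (\<Sum>x\<in>teich_box n. mono_fun n s x) = 0" by (rule antisym) simp
      then show ?thesis by simp
    qed
    show ?thesis unfolding M_def[symmetric] eq zero by simp
  next
    case True
    define P where "P = p - 1"
    define r where "r = card {i. i < n \<and> s i = 0}"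
    define a where "a = multiplicity p (fact M :: nat)"
    define b where "b k = (\<Sum>e\<in>E. multiplicity p (fact (u k e) :: nat))" for k
    have "(p - 1) * h * (B + card S) \<le> (p - 1) * h * r + (\<Sum>k\<in>S. \<Sum>e\<in>E. digit_sum p (u k e))"
      unfolding r_def s_def
    proof (rule weight_bound[OF p_gt_1 h_pos E S m d _ _ _ _ _ B])
      show "M > 0" "(p ^ h - 1) dvd M" using q_gt_1 by (auto simp: M_def q_eq)
    qed (use True u c0 in \<open>auto simp: M_def s_def q_eq\<close>)
    moreover have "(p - 1) * b k + (\<Sum>e\<in>E. digit_sum p (u k e)) = M" if "k \<in> S" for k
    proof -
      have "(p - 1) * b k + (\<Sum>e\<in>E. digit_sum p (u k e)) =
          (\<Sum>e\<in>E. (p - 1) * multiplicity p (fact (u k e) :: nat) + digit_sum p (u k e))"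
        by (simp add: b_def sum_distrib_left sum.distrib)
      then show ?thesis
        using u[OF that] by (simp only: multiplicity_fact_digit_sum[OF prime_p] M_def)
    qed
    then have "(p - 1) * (\<Sum>k\<in>S. b k) + (\<Sum>k\<in>S. \<Sum>e\<in>E. digit_sum p (u k e)) = card S * M"
      by (simp add: sum_distrib_left flip: sum.distrib)
    moreover have "card S * ((p - 1) * a + h * (p - 1)) = card S * M"
      using multiplicity_fact_exponent[of N] by (simp add: a_def M_def)
    \<comment> \<open>Every \<open>k\<close> in \<open>S\<close> loses \<open>h * (p - 1)\<close>,
      the digit sum of \<open>M\<close>; the summand \<open>card S\<close> in
      \<open>weight_bound\<close> pays exactly for this.\<close>
    ultimately have "(p - 1) * (h * B + (\<Sum>k\<in>S. b k)) \<le> (p - 1) * (h * r + card S * a)"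
      unfolding P_def[symmetric] by (simp add: algebra_simps)
    then have main: "h * B + (\<Sum>k\<in>S. b k) \<le> h * r + card S * a"
      using p_gt_1 by simp
    have "absval C = (\<Prod>k\<in>S. (1 / real p) ^ a / (1 / real p) ^ b k * (\<Prod>e\<in>E. absval (c k e) ^ u k e))"
      unfolding C_def absval_prod
      by (simp add: absval_mult absval_divide absval_prod absval_fact absval_power a_def b_def power_sum)
    also have "\<dots> \<le> (\<Prod>k\<in>S. (1 / real p) ^ a / (1 / real p) ^ b k * 1)"
      using c1 by (intro prod_mono conjI mult_left_mono prod_le_1 mult_nonneg_nonneg prod_nonneg) (auto simp: power_le_one)
    also have "\<dots> = (1 / real p) ^ (card S * a) / (1 / real p) ^ (\<Sum>k\<in>S. b k)"
      by (simp add: prod_dividef power_sum power_mult[symmetric] mult.commute)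
    finally have "absval C * absval (\<Sum>x\<in>teich_box n. mono_fun n s x) \<le>
        (1 / real p) ^ (card S * a) / (1 / real p) ^ (\<Sum>k\<in>S. b k) * (1 / real p) ^ (h * r)"
      using absval_character_sum[of n s] True by (intro mult_mono) (auto simp: r_def)
    also have "\<dots> = (1 / real p) ^ (h * r + card S * a) / (1 / real p) ^ (\<Sum>k\<in>S. b k)"
      by (simp add: power_add)
    also have "\<dots> \<le> (1 / real p) ^ (h * B + (\<Sum>k\<in>S. b k)) / (1 / real p) ^ (\<Sum>k\<in>S. b k)"
      using inverse_p_less_1 by (intro divide_right_mono power_decreasing main) auto
    also have "\<dots> = (1 / real p) ^ (h * B)"
      using p_gt_1 by (simp add: power_add)
    finally show ?thesis unfolding M_def[symmetric] eq absval_mult .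
  qed
qed

lemma Ax_Katz:
  assumes m: "m \<ge> 1" and d: "d \<ge> 1"
    and A: "\<And>k. k < m \<Longrightarrow> poly_fun n (d * p ^ k) (A k)"
    and int: "\<And>k x. k < m \<Longrightarrow> x \<in> teich_box n \<Longrightarrow> absval (A k x) \<le> 1"
    and B: "\<And>t. n \<le> d * p ^ (m - 1) * t + d * (\<Sum>k<m. p ^ k) \<Longrightarrow> B \<le> t"
  shows "absval (of_nat (card {x \<in> teich_box n. \<forall>k<m. absval (A k x) < 1}) :: 'a) \<le> (1 / real p) ^ (h * B)"
proof -
  \<comment> \<open>Taking \<open>N = B\<close> makes the error of the indicator
    \<open>p ^ (h * B)\<close>, the precision to be proved.\<close>
  define M where "M = (q - 1) * q ^ B"
  define E :: "(nat \<Rightarrow> nat) set" where "E = ({..<n} \<rightarrow>\<^sub>E {..<q})"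
  have E: "finite E" unfolding E_def by (intro finite_PiE) auto
  have "\<exists>c. poly_rep n (d * p ^ k) c (A k)" if "k < m" for k
    using A[OF that] by (simp add: poly_fun_def)
  then obtain c where c: "\<And>k. k < m \<Longrightarrow> poly_rep n (d * p ^ k) (c k) (A k)" by metis
  \<comment> \<open>Extension by zero gives all \<open>A k\<close> the common index set
    \<open>E\<close>; the degree bounds survive as conditions on the support.\<close>
  define c' where "c' k e = (if e \<in> expos n (d * p ^ k) then c k e else 0)" for k e
  have A_eq: "A k x = (\<Sum>e\<in>E. c' k e * mono_fun n e x)" if "k < m" "x \<in> teich_box n" for k x
  proof -
    have "A k x = (\<Sum>e\<in>expos n (d * p ^ k). c' k e * mono_fun n e x)"
      using c[OF that(1)] that(2) by (simp add: poly_rep_def c'_def)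
    also have "\<dots> = (\<Sum>e\<in>E. c' k e * mono_fun n e x)"
      using E by (intro sum.mono_neutral_left) (auto simp: E_def expos_def c'_def)
    finally show ?thesis .
  qed
  have c1: "absval (c' k e) \<le> 1" if "k < m" for k e
    using poly_rep_integral[OF c[OF that] int[OF that]] by (simp add: c'_def)
  have c0: "(\<Sum>i<n. e i) \<le> d * p ^ k" if "c' k e \<noteq> 0" for k e
    using that by (auto simp: c'_def expos_def split: if_splits)
  define ind where "ind y = (if absval y < 1 then 1 else 0 :: 'a)" for y :: 'a
  have "of_nat (card {x \<in> teich_box n. \<forall>k<m. absval (A k x) < 1}) = (\<Sum>x\<in>teich_box n. \<Prod>k<m. ind (A k x))"
  proof -
    have "(\<Prod>k<m. ind (A k x)) = (if \<forall>k<m. absval (A k x) < 1 then 1 else 0)" for x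
      by (auto simp: ind_def prod_zero_iff)
    then show ?thesis by (simp add: sum.If_cases finite_teich_box Int_def)
  qed
  moreover have "absval ((\<Sum>x\<in>teich_box n. \<Prod>k<m. ind (A k x)) - (\<Sum>x\<in>teich_box n. \<Prod>k<m. 1 - A k x ^ M)) \<le> (1 / real p) ^ (h * B)"
    unfolding sum_subtractf[symmetric]
  proof (intro absval_sum_le absval_prod_diff_le)
    fix x k assume "x \<in> teich_box n" "k \<in> {..<m}"
    then have "absval (A k x) \<le> 1" using int by simp
    then show "absval (ind (A k x)) \<le> 1" "absval (1 - A k x ^ M) \<le> 1"
      "absval (ind (A k x) - (1 - A k x ^ M)) \<le> (1 / real p) ^ (h * B)"
      using absval_indicator by (auto simp: ind_def M_def absval_power power_le_one intro!: absval_diff_le)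
  qed auto
  moreover have "absval (\<Sum>x\<in>teich_box n. \<Prod>k<m. 1 - A k x ^ M) \<le> (1 / real p) ^ (h * B)"
  proof -
    \<comment> \<open>Expanding over subsets leaves products of pure powers, for which the exponents
      over \<open>k\<close> in \<open>S\<close> each sum to \<open>M\<close>, as
      \<open>absval_multinomial_term\<close> requires.\<close>
    have "(\<Sum>x\<in>teich_box n. \<Prod>k<m. 1 - A k x ^ M) =
        (\<Sum>x\<in>teich_box n. \<Sum>S\<in>Pow {..<m}. (-1) ^ card S * (\<Prod>k\<in>S. A k x ^ M))"
    proof (rule sum.cong[OF refl])
      fix x
      have "(\<Prod>k<m. 1 - A k x ^ M) = (\<Prod>k<m. (-1) * A k x ^ M + 1)" by simp
      also have "\<dots> = (\<Sum>S\<in>Pow {..<m}. (\<Prod>k\<in>S. (-1) * A k x ^ M) * (\<Prod>k\<in>{..<m} - S. 1))"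
        by (rule prod_add) simp
      also have "\<dots> = (\<Sum>S\<in>Pow {..<m}. (-1) ^ card S * (\<Prod>k\<in>S. A k x ^ M))"
        by (simp only: prod.distrib prod_constant power_one mult_1_right)
      finally show "(\<Prod>k<m. 1 - A k x ^ M) = (\<Sum>S\<in>Pow {..<m}. (-1) ^ card S * (\<Prod>k\<in>S. A k x ^ M))" .
    qed
    also have "\<dots> = (\<Sum>S\<in>Pow {..<m}. (-1) ^ card S * (\<Sum>x\<in>teich_box n. \<Prod>k\<in>S. A k x ^ M))"
      by (subst sum.swap) (simp add: sum_distrib_left)
    also have "absval \<dots> \<le> (1 / real p) ^ (h * B)"
    proof (rule absval_sum_le)
      fix S assume "S \<in> Pow {..<m}"
      then have S: "S \<subseteq> {..<m}" by simp
      then have finS: "finite S" using finite_subset by blast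
      let ?U = "weak_compositions E M"
      let ?T = "\<lambda>k u x. fact M / (\<Prod>e\<in>E. fact (u e)) * (\<Prod>e\<in>E. (c' k e * mono_fun n e x) ^ u e) :: 'a"
      have "(\<Sum>x\<in>teich_box n. \<Prod>k\<in>S. A k x ^ M) = (\<Sum>x\<in>teich_box n. \<Prod>k\<in>S. \<Sum>u\<in>?U. ?T k u x)"
        using S A_eq by (intro sum.cong prod.cong refl) (auto simp: multinomial_theorem[OF E])
      also have "\<dots> = (\<Sum>x\<in>teich_box n. \<Sum>w\<in>S \<rightarrow>\<^sub>E ?U. \<Prod>k\<in>S. ?T k (w k) x)"
        by (intro sum.cong refl prod_sum_PiE finS finite_weak_compositions E)
      also have "\<dots> = (\<Sum>w\<in>S \<rightarrow>\<^sub>E ?U. \<Sum>x\<in>teich_box n. \<Prod>k\<in>S. ?T k (w k) x)"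
        by (rule sum.swap)
      also have "absval \<dots> \<le> (1 / real p) ^ (h * B)"
      proof (rule absval_sum_le)
        fix w assume w: "w \<in> S \<rightarrow>\<^sub>E ?U"
        show "absval (\<Sum>x\<in>teich_box n. \<Prod>k\<in>S. ?T k (w k) x) \<le> (1 / real p) ^ (h * B)"
          unfolding M_def
        proof (rule absval_multinomial_term[OF S m d E _ _ _ B])
          fix k assume "k \<in> S"
          then have "w k \<in> ?U" using w by auto
          then show "(\<Sum>e\<in>E. w k e) = (q - 1) * q ^ B" by (simp add: weak_compositions_def M_def)
        qed (use S c1 c0 in auto)
      qed simp
      finally show "absval ((-1) ^ card S * (\<Sum>x\<in>teich_box n. \<Prod>k\<in>S. A k x ^ M)) \<le> (1 / real p) ^ (h * B)"
        by (simp add: absval_mult absval_power absval_minus_1)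
    qed simp
    finally show ?thesis .
  qed
  ultimately show ?thesis
    using absval_add_le[of "(\<Sum>x\<in>teich_box n. \<Prod>k<m. ind (A k x)) - (\<Sum>x\<in>teich_box n. \<Prod>k<m. 1 - A k x ^ M)"
        "(1 / real p) ^ (h * B)" "\<Sum>x\<in>teich_box n. \<Prod>k<m. 1 - A k x ^ M"] by simp
qed

section \<open>From the polynomial to its Witt coordinates\<close>

lemma cong_Zq_0_iff: "cong_Zq y 0 (of_nat p ^ m) \<longleftrightarrow> absval y \<le> (1 / real p) ^ m" for y :: 'a
proof
  assume "cong_Zq y 0 (of_nat p ^ m)"
  then obtain z where "absval z \<le> 1" "y = of_nat p ^ m * z" by (auto simp: cong_Zq_def Zq_def)
  then show "absval y \<le> (1 / real p) ^ m"
    by (simp only: absval_mult absval_p_power) (intro mult_right_le_one_le, auto)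
next
  assume y: "absval y \<le> (1 / real p) ^ m"
  have "absval (y / of_nat p ^ m) = absval y / (1 / real p) ^ m"
    by (simp only: absval_divide absval_p_power)
  also have "\<dots> \<le> 1" using y p_gt_1 by (subst divide_le_eq_1) auto
  finally have "y / of_nat p ^ m \<in> Zq" by (simp add: Zq_def)
  moreover have "y - 0 = of_nat p ^ m * (y / of_nat p ^ m)" by simp
  ultimately show "cong_Zq y 0 (of_nat p ^ m)" unfolding cong_Zq_def by blast
qed

lemma eval_mpoly_eq_sum:
  assumes "finite K" "Poly_Mapping.keys f \<subseteq> K" "\<And>\<mu>. \<mu> \<in> K \<Longrightarrow> Poly_Mapping.keys \<mu> \<subseteq> {..<n}"
  shows "eval_mpoly f x = (\<Sum>\<mu>\<in>K. Poly_Mapping.lookup f \<mu> * mono_fun n (Poly_Mapping.lookup \<mu>) (x :: nat \<Rightarrow> 'a))"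
proof -
  have "(\<Prod>i\<in>Poly_Mapping.keys \<mu>. x i ^ Poly_Mapping.lookup \<mu> i) = mono_fun n (Poly_Mapping.lookup \<mu>) x"
    if "\<mu> \<in> K" for \<mu>
    unfolding mono_fun_def using assms(3)[OF that]
    by (intro prod.mono_neutral_left) (auto simp: in_keys_iff)
  then have "eval_mpoly f x = (\<Sum>\<mu>\<in>Poly_Mapping.keys f. Poly_Mapping.lookup f \<mu> * mono_fun n (Poly_Mapping.lookup \<mu>) x)"
    unfolding eval_mpoly_def using assms(2) by (intro sum.cong) auto
  also have "\<dots> = (\<Sum>\<mu>\<in>K. Poly_Mapping.lookup f \<mu> * mono_fun n (Poly_Mapping.lookup \<mu>) x)"
    using assms(1,2) by (intro sum.mono_neutral_left) (auto simp: in_keys_iff)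
  finally show ?thesis .
qed

lemma absval_sums_truncate:
  assumes "(\<lambda>i. of_nat p ^ i * g i) sums (s :: 'a)" "\<And>i. absval (g i) \<le> 1"
  shows "absval (s - (\<Sum>i<m. of_nat p ^ i * g i)) \<le> (1 / real p) ^ m"
proof -
  have "(1 / real p) ^ m > 0" using p_gt_1 by simp
  then obtain N where N: "\<And>k. k \<ge> N \<Longrightarrow> dist (\<Sum>i<k. of_nat p ^ i * g i) s < (1 / real p) ^ m"
    using assms(1) unfolding sums_def lim_sequentially by blast
  have "absval (s - (\<Sum>i<N + m. of_nat p ^ i * g i)) \<le> (1 / real p) ^ m"
    using N[of "N + m"] by (simp add: dist_absval absval_diff_commute[of s])
  moreover have "absval ((\<Sum>i<N + m. of_nat p ^ i * g i) - (\<Sum>i<m. of_nat p ^ i * g i)) \<le> (1 / real p) ^ m"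
    using assms(2) by (intro absval_truncate) auto
  ultimately show ?thesis by (rule absval_diff_trans_le)
qed

lemma mono_fun_absval_le_1: "x \<in> teich_box n \<Longrightarrow> absval (mono_fun n e x) \<le> 1"
  unfolding mono_fun_def by (intro Tq_absval_le_1 Tq_prod Tq_power) (auto simp: teich_box_Tq)

lemma eval_mpoly_truncate:
  assumes "f \<in> mpolys Zq n" "teichmueller_expansion p q n f F" "x \<in> teich_box n"
  shows "absval (eval_mpoly f x - (\<Sum>i<m. of_nat p ^ i * eval_mpoly (F i) x)) \<le> (1 / real p) ^ m"
proof -
  \<comment> \<open>The expansion is given coefficient by coefficient; a common finite support lets
    it be summed over monomials.\<close>
  define K where "K = Poly_Mapping.keys f \<union> (\<Union>i<m. Poly_Mapping.keys (F i))"
  have K: "finite K" by (simp add: K_def)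
  have F: "F i \<in> mpolys (Tq q) n" for i using assms(2) by (simp add: teichmueller_expansion_def)
  have Kn: "Poly_Mapping.keys \<mu> \<subseteq> {..<n}" if "\<mu> \<in> K" for \<mu>
    using that assms(1) F by (auto simp: K_def mpolys_def)
  let ?l = Poly_Mapping.lookup
  let ?x = "\<lambda>\<mu>. mono_fun n (?l \<mu>) x"
  have "eval_mpoly (F i) x = (\<Sum>\<mu>\<in>K. ?l (F i) \<mu> * ?x \<mu>)" if "i < m" for i
    using that by (intro eval_mpoly_eq_sum K Kn) (auto simp: K_def)
  then have "(\<Sum>i<m. of_nat p ^ i * eval_mpoly (F i) x) = (\<Sum>i<m. \<Sum>\<mu>\<in>K. of_nat p ^ i * (?l (F i) \<mu> * ?x \<mu>))"
    by (simp add: sum_distrib_left)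
  also have "\<dots> = (\<Sum>\<mu>\<in>K. (\<Sum>i<m. of_nat p ^ i * ?l (F i) \<mu>) * ?x \<mu>)"
    by (subst sum.swap) (simp add: sum_distrib_right mult.assoc)
  moreover have "eval_mpoly f x = (\<Sum>\<mu>\<in>K. ?l f \<mu> * ?x \<mu>)"
    by (intro eval_mpoly_eq_sum K Kn) (auto simp: K_def)
  ultimately have "eval_mpoly f x - (\<Sum>i<m. of_nat p ^ i * eval_mpoly (F i) x) =
      (\<Sum>\<mu>\<in>K. (?l f \<mu> - (\<Sum>i<m. of_nat p ^ i * ?l (F i) \<mu>)) * ?x \<mu>)"
    by (simp add: left_diff_distrib sum_subtractf)
  also have "absval \<dots> \<le> (1 / real p) ^ m"
  proof (rule absval_sum_le)
    fix \<mu>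
    have "absval (?l f \<mu> - (\<Sum>i<m. of_nat p ^ i * ?l (F i) \<mu>)) \<le> (1 / real p) ^ m"
      using assms(2) F by (intro absval_sums_truncate Tq_absval_le_1) (auto simp: teichmueller_expansion_def mpolys_def)
    then have "absval (?l f \<mu> - (\<Sum>i<m. of_nat p ^ i * ?l (F i) \<mu>)) * absval (?x \<mu>) \<le> (1 / real p) ^ m * 1"
      using mono_fun_absval_le_1[OF assms(3)] by (intro mult_mono) auto
    then show "absval ((?l f \<mu> - (\<Sum>i<m. of_nat p ^ i * ?l (F i) \<mu>)) * ?x \<mu>) \<le> (1 / real p) ^ m"
      by (simp add: absval_mult)
  qed simp
  finally show ?thesis .
qed

lemma absval_card_zeros:
  assumes f: "f \<in> mpolys Zq n" and m: "m \<ge> 1" and d: "d \<ge> 1"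
    and F: "teichmueller_expansion p q n f F"
    and deg: "\<And>i. i < m \<Longrightarrow> total_degree (F i) \<le> d * p ^ (h * (i div h))"
    and B: "\<And>t. n \<le> d * p ^ (m - 1) * t + d * (\<Sum>k<m. p ^ k) \<Longrightarrow> B \<le> t"
  shows "absval (of_nat (card {x \<in> teich_box n. cong_Zq (eval_mpoly f x) 0 (of_nat p ^ m)}) :: 'a) \<le> (1 / real p) ^ (h * B)"
proof -
  let ?l = Poly_Mapping.lookup
  define T where "T x i \<mu> = ?l (F i) \<mu> * mono_fun n (?l \<mu>) x" for x i \<mu>
  \<comment> \<open>Each \<open>T x i \<mu>\<close> is a Teichmueller representative because
    coefficient and variables are. The exponent is lowered by \<open>h * (i div h)\<close>,
    precisely what the degree bound for \<open>F i\<close> allows for.\<close>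
  define \<Phi> where "\<Phi> x k = (\<Sum>i\<le>k. of_nat p ^ i *
      (\<Sum>\<mu>\<in>Poly_Mapping.keys (F i). T x i \<mu> ^ (p ^ (k - h * (i div h)))))" for x k
  have Fi: "F i \<in> mpolys (Tq q) n" for i using F by (simp add: teichmueller_expansion_def)
  have T: "T x i \<mu> \<in> Tq q" if "x \<in> teich_box n" for x i \<mu>
    unfolding T_def mono_fun_def using Fi[of i] that
    by (intro Tq_mult Tq_prod Tq_power) (auto simp: mpolys_def teich_box_Tq)
  have eval: "eval_mpoly (F i) x = (\<Sum>\<mu>\<in>Poly_Mapping.keys (F i). T x i \<mu>)" for i x
    unfolding T_def using Fi[of i] by (intro eval_mpoly_eq_sum) (auto simp: mpolys_def)
  have poly: "poly_fun n (d * p ^ k) (\<lambda>x. \<Phi> x k)" if k: "k < m" for k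
    unfolding \<Phi>_def
  proof (intro poly_fun_sum poly_fun_scale)
    fix i \<mu> assume i: "i \<in> {..k}" and \<mu>: "\<mu> \<in> Poly_Mapping.keys (F i)"
    let ?e = "p ^ (k - h * (i div h))"
    have "(\<Sum>j<n. ?l \<mu> j) = (\<Sum>j\<in>Poly_Mapping.keys \<mu>. ?l \<mu> j)"
      using Fi[of i] \<mu> by (intro sum.mono_neutral_right) (auto simp: mpolys_def in_keys_iff)
    also have "\<dots> \<le> total_degree (F i)"
      unfolding total_degree_def using \<mu> by (intro Max_ge) auto
    also have "\<dots> \<le> d * p ^ (h * (i div h))" using deg i k by simp
    finally have "?e * (\<Sum>j<n. ?l \<mu> j) \<le> ?e * (d * p ^ (h * (i div h)))" by simp
    \<comment> \<open>The growth allowed to the degree of \<open>F i\<close> and the reduction of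
      the exponent cancel, leaving a bound independent of \<open>i\<close>.\<close>
    also have "\<dots> = d * p ^ k"
    proof -
      have "h * (i div h) \<le> k" using i times_div_less_eq_dividend[of h i] by (meson atMost_iff le_trans)
      then have "p ^ (k - h * (i div h)) * p ^ (h * (i div h)) = p ^ k" by (simp flip: power_add)
      then show ?thesis by (simp add: mult.left_commute)
    qed
    finally have "poly_fun n (d * p ^ k) (\<lambda>x. ?l (F i) \<mu> ^ ?e * mono_fun n (\<lambda>j. ?l \<mu> j * ?e) x)"
      by (intro poly_fun_scale poly_fun_mono) (simp add: mult.commute flip: sum_distrib_right)
    then show "poly_fun n (d * p ^ k) (\<lambda>x. T x i \<mu> ^ ?e)"
      by (rule poly_fun_cong) (simp add: T_def mono_fun_def power_mult_distrib prod_power_distrib flip: power_mult)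
  qed
  have iff: "cong_Zq (eval_mpoly f x) 0 (of_nat p ^ m) \<longleftrightarrow> (\<forall>k<m. absval (witt_coord (\<Phi> x) k) < 1)"
    if x: "x \<in> teich_box n" for x
  proof -
    let ?y = "\<Sum>i<m. of_nat p ^ i * eval_mpoly (F i) x"
    have "absval (eval_mpoly f x) \<le> (1 / real p) ^ m \<longleftrightarrow> absval ?y \<le> (1 / real p) ^ m"
      using eval_mpoly_truncate[OF f F x, of m] absval_add_le[of "eval_mpoly f x - ?y" _ ?y]
        absval_diff_le[of "eval_mpoly f x" _ "eval_mpoly f x - ?y"] by auto
    also have "\<dots> \<longleftrightarrow> (\<forall>k<m. absval (witt_coord (\<Phi> x) k) < 1)"
      unfolding eval by (rule witt_coord_Teichmueller_sum(2)[OF T[OF x] \<Phi>_def])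
    finally show ?thesis by (simp only: cong_Zq_0_iff)
  qed
  have "absval (of_nat (card {x \<in> teich_box n. \<forall>k<m. absval (witt_coord (\<Phi> x) k) < 1}) :: 'a) \<le> (1 / real p) ^ (h * B)"
  proof (rule Ax_Katz[OF m d _ _ B])
    show "poly_fun n (d * p ^ k) (\<lambda>x. witt_coord (\<Phi> x) k)" if "k < m" for k
      using that by (intro poly_fun_witt_coord poly) simp
    show "absval (witt_coord (\<Phi> x) k) \<le> 1" if "k < m" "x \<in> teich_box n" for k x
      by (rule witt_coord_Teichmueller_sum(1)[OF T[OF that(2)] \<Phi>_def that(1)])
  qed
  also have "{x \<in> teich_box n. \<forall>k<m. absval (witt_coord (\<Phi> x) k) < 1} =
      {x \<in> teich_box n. cong_Zq (eval_mpoly f x) 0 (of_nat p ^ m)}"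
    using iff by blast
  finally show ?thesis .
qed

end

lemma ceiling_star_le: "t \<le> real k \<Longrightarrow> ceiling_star t \<le> k"
  unfolding ceiling_star_def by (rule Least_le)

theorem theorem3p1:
  fixes p h q n m d :: nat
    and f :: "'a::{field_char_0,complete_space} mpoly"
    and F :: "nat \<Rightarrow> 'a mpoly"
    and V :: "(nat \<Rightarrow> 'a) set"
  assumes "Factorial_Ring.prime p" and "h \<ge> 1" and "q = p ^ h"
    and "unramified_extension TYPE('a) p h"
    and "f \<in> mpolys Zq n" and "f \<noteq> 0"
    and "m \<ge> 1"
    and "V = {x \<in> {..<n} \<rightarrow>\<^sub>E Tq q. cong_Zq (eval_mpoly f x) 0 (of_nat p ^ m)}"
    and "teichmueller_expansion p q n f F"
    and "d \<ge> 1"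
    and "\<And>i. i \<in> {0..m - 1} \<Longrightarrow> total_degree (F i) \<le> d * p ^ (h * (i div h))"
  shows "ord_q p h (card V) \<ge>
    ereal (real (ceiling_star
      ((real n - (real p ^ m - 1) / (real p - 1) * real d) / (real p ^ (m - 1) * real d))))"
proof -
  interpret unramified "TYPE('a)" p h q
    by unfold_locales (fact assms)+
  define B where "B = ceiling_star
      ((real n - (real p ^ m - 1) / (real p - 1) * real d) / (real p ^ (m - 1) * real d))"
  \<comment> \<open>The rounded quotient is characterised by a division-free inequality, with the
    geometric sum \<open>(p ^ m - 1) / (p - 1)\<close> written out; this is the form in which each
    rotation of digits can use it.\<close>
  have B: "B \<le> t" if "n \<le> d * p ^ (m - 1) * t + d * (\<Sum>k<m. p ^ k)" for t
    unfolding B_def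
  proof (rule ceiling_star_le)
    have "real n \<le> real (d * p ^ (m - 1) * t + d * (\<Sum>k<m. p ^ k))"
      using that by (simp only: of_nat_le_iff)
    moreover have "(\<Sum>k<m. real p ^ k) = (real p ^ m - 1) / (real p - 1)"
      using p_gt_1 by (simp add: geometric_sum)
    ultimately have "real n - (real p ^ m - 1) / (real p - 1) * real d \<le> real t * (real p ^ (m - 1) * real d)"
      by (simp add: mult_ac)
    moreover have "real p ^ (m - 1) * real d > 0" using p_gt_1 assms(10) by simp
    ultimately show "(real n - (real p ^ m - 1) / (real p - 1) * real d) / (real p ^ (m - 1) * real d) \<le> real t"
      by (simp only: pos_divide_le_eq)
  qed
  have V_eq: "V = {x \<in> teich_box n. cong_Zq (eval_mpoly f x) 0 (of_nat p ^ m)}"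
    by (simp add: assms(8) teich_box_def)
  have "absval (of_nat (card V) :: 'a) \<le> (1 / real p) ^ (h * B)"
    unfolding V_eq
  proof (rule absval_card_zeros[OF assms(5,7,10,9) _ B])
    show "total_degree (F i) \<le> d * p ^ (h * (i div h))" if "i < m" for i
      using that by (intro assms(11)) auto
  qed
  moreover have "h * B \<le> multiplicity p (card V)" if "card V > 0"
  proof (rule ccontr)
    assume "\<not> h * B \<le> multiplicity p (card V)"
    then have "(1 / real p) ^ (h * B) < (1 / real p) ^ multiplicity p (card V)"
      using inverse_p_less_1 p_gt_1 by (intro power_strict_decreasing) auto
    then show False
      using calculation absval_of_nat[OF that] by simp
  qed
  ultimately have "ereal (real B) \<le> ord_q p h (card V)"
  proof -
    \<comment> \<open>An empty \<open>V\<close> has infinite order by definition, so only a positive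
      cardinality has to be treated.\<close>
    have "real B \<le> real (multiplicity p (card V)) / real h" if "card V > 0"
    proof -
      have "real h * real B \<le> real (multiplicity p (card V))"
        using \<open>card V > 0 \<Longrightarrow> h * B \<le> multiplicity p (card V)\<close>[OF that] by (simp flip: of_nat_mult)
      then show ?thesis using assms(2) by (simp add: field_simps)
    qed
    then show ?thesis by (auto simp: ord_q_def)
  qed
  then show ?thesis by (simp only: B_def)
qed

end
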